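(* There exist $\mu>0$ (sufficiently large), $\delta_0>0$ and $C>0$, independent of $k$, such that for every time mesh with $k-k_{\min}\le\delta_0$ the following holds. Let $f\in L^1(I;L^2(\Omega))$, $u_0\in L^2(\Omega)$, and let $u_k\in X_k^0$ be the dG(0) semidiscrete solution with data $f,u_0$. Then $$\sum_{m=1}^M\left(k_m\|A_{k,m}u_{k,m}\|_{L^2(\Omega)}+\|[u_k]_{m-1}\|_{L^2(\Omega)}\right)\le Ce^{\mu T}\ln\frac{T}{k}\left(\|f\|_{L^1(I;L^2(\Omega))}+\|u_0\|_{L^2(\Omega)}\right).$$
   Context: Problem data. $\Omega\subset\mathbb R^d$, $d\ge1$, is a bounded Lipschitz domain, $T>0$, $I=(0,T)$. The coefficients $a_{ij}\in L^\infty(I\times\Omega)$ ($1\le i,j\le d$) satisfy $a_{ij}=a_{ji}$ and $\sum_{i,j}a_{ij}(t,x)\xi_i\xi_j\ge\alpha|\xi|^2$ for all $\xi\in\mathbb R^d$ and a.e. $(t,x)$, with a constant $\alpha>0$; they are continuous in $t$ on $\bar I$ for almost all $x$, and $|a_{ij}(t_1,x)-a_{ij}(t_2,x)|\le\omega(|t_1-t_2|)$ for all $t_1,t_2\in\bar I$ and almost all $x\in\Omega$, where $\omega:[0,T]\to[0,\infty)$ is nondecreasing, $\omega(t)/t^{3/2}$ is non-increasing on $(0,T]$, and $\int_0^T\omega(t)t^{-3/2}\,dt<\infty$. For $u,v\in H^1_0(\Omega)$ set $a(t;u,v)=\int_\Omega\sum_{i,j}a_{ij}(t,x)\partial_iu\,\partial_jv\,dx$,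 and let $A(t):H^1_0(\Omega)\to H^{-1}(\Omega)$ be given by $\langle A(t)u,v\rangle=a(t;u,v)$. Time meshes. $0=t_0<t_1<\dots<t_M=T$, $I_m=(t_{m-1},t_m]$, $k_m=t_m-t_{m-1}$, $k=\max_mk_m$, $k_{\min}=\min_mk_m$. All meshes satisfy, with fixed constants $c,\beta,\kappa>0$: (i) $k_{\min}\ge ck^\beta$; (ii) $\kappa^{-1}\le k_m/k_{m+1}\le\kappa$ for $1\le m\le M-1$; (iii) $k\le T/4$. Discretization. $X_k^0$ is the space of functions $v_k\in L^2(I;H^1_0(\Omega))$ that are constant in time on each $I_m$; $v_{k,m}:=v_k|_{I_m}$. $A_{k,m}=\frac1{k_m}\int_{I_m}A(t)\,dt:H^1_0(\Omega)\to H^{-1}(\Omega)$. The dG(0) semidiscrete solution $u_k\in X_k^0$ with data $f,u_0$ is defined by $$\int_Ia(t;u_k,\varphi_k)\,dt+\sum_{m=2}^M(u_{k,m}-u_{k,m-1},\varphi_{k,m})_\Omega+(u_{k,1},\varphi_{k,1})_\Omega=\int_I(f,\varphi_k)_\Omega\,dt+(u_0,\varphi_{k,1})_\Omega\quad\forall\varphi_k\in X_k^0 .$$ Jumps: $[u_k]_m=u_{k,m+1}-u_{k,m}$ for $1\le m\le M-1$, and $[u_k]_0=u_{k,1}-u_0$. "Independent of $k$" means: depending only on $\Omega,d,T$, the coefficients $a_{ij}$ (including $\alpha,\omega$) and $c,\beta,\kappa$, and not otherwise on the time mesh, nor on $f,u_0$. *)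

theory Defs
  imports "HOL-Analysis.Analysis"
begin

text \<open>
  Near each boundary point, \<open>\<Omega>\<close> is the set above the graph of a Lipschitz function \<open>\<gamma>\<close> in
  suitable Cartesian coordinates. The unit vector \<open>e\<close> is the vertical direction; the hyperplane
  orthogonal to \<open>e\<close> carries the horizontal coordinates, so \<open>x - (e \<bullet> x) *\<^sub>R e\<close> and
  \<open>e \<bullet> x\<close> are the horizontal and the vertical part of \<open>x\<close>.
\<close>

definition bounded_lipschitz_domain :: "(real^'d) set \<Rightarrow> bool" where
  "bounded_lipschitz_domain \<Omega> \<longleftrightarrow>
     open \<Omega> \<and> connected \<Omega> \<and> \<Omega> \<noteq> {} \<and> bounded \<Omega> \<and>
     (\<forall>p\<in>frontier \<Omega>. \<exists>e r L \<gamma>. norm e = 1 \<and> r > 0 \<and> L-lipschitz_on {y. e \<bullet> y = 0} \<gamma> \<and>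
        (\<forall>x\<in>ball p r. x \<in> \<Omega> \<longleftrightarrow> \<gamma> (x - (e \<bullet> x) *\<^sub>R e) < e \<bullet> x))"

text \<open>
  Elements of the function spaces are represented by functions, not by classes of functions
  that agree almost everywhere; all norms and integrals below are invariant under changes on
  null sets.
\<close>

definition L2 :: "(real^'d) set \<Rightarrow> (real^'d \<Rightarrow> real) set" where
  "L2 \<Omega> = {u. u \<in> borel_measurable (lebesgue_on \<Omega>) \<and> integrable (lebesgue_on \<Omega>) (\<lambda>x. (u x)\<^sup>2)}"

definition L2_inner :: "(real^'d) set \<Rightarrow> (real^'d \<Rightarrow> real) \<Rightarrow> (real^'d \<Rightarrow> real) \<Rightarrow> real" where
  "L2_inner \<Omega> u v = (\<integral>x. u x * v x \<partial>lebesgue_on \<Omega>)"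

definition L2_norm :: "(real^'d) set \<Rightarrow> (real^'d \<Rightarrow> real) \<Rightarrow> real" where
  "L2_norm \<Omega> u = sqrt (L2_inner \<Omega> u u)"

definition partial :: "'d \<Rightarrow> (real^'d \<Rightarrow> real) \<Rightarrow> real^'d \<Rightarrow> real" where
  "partial i \<phi> x = frechet_derivative \<phi> (at x) (axis i 1)"

primrec C_k :: "nat \<Rightarrow> (real^'d \<Rightarrow> real) \<Rightarrow> bool" where
  "C_k 0 \<phi> \<longleftrightarrow> continuous_on UNIV \<phi>"
| "C_k (Suc n) \<phi> \<longleftrightarrow> \<phi> differentiable_on UNIV \<and> (\<forall>i. C_k n (partial i \<phi>))"

definition test_functions :: "(real^'d) set \<Rightarrow> (real^'d \<Rightarrow> real) set" where
  "test_functions \<Omega> =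
     {\<phi>. (\<forall>n. C_k n \<phi>) \<and> compact (closure {x. \<phi> x \<noteq> 0}) \<and> closure {x. \<phi> x \<noteq> 0} \<subseteq> \<Omega>}"

definition has_weak_partial ::
    "(real^'d) set \<Rightarrow> 'd \<Rightarrow> (real^'d \<Rightarrow> real) \<Rightarrow> (real^'d \<Rightarrow> real) \<Rightarrow> bool" where
  "has_weak_partial \<Omega> i u g \<longleftrightarrow>
     g \<in> L2 \<Omega> \<and> (\<forall>\<phi>\<in>test_functions \<Omega>. L2_inner \<Omega> u (partial i \<phi>) = - L2_inner \<Omega> g \<phi>)"

text \<open>The weak derivative is determined up to a null set; an arbitrary representative is chosen.\<close>

definition weak_partial :: "(real^'d) set \<Rightarrow> 'd \<Rightarrow> (real^'d \<Rightarrow> real) \<Rightarrow> real^'d \<Rightarrow> real" where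
  "weak_partial \<Omega> i u = (SOME g. has_weak_partial \<Omega> i u g)"

definition H1 :: "(real^'d) set \<Rightarrow> (real^'d \<Rightarrow> real) set" where
  "H1 \<Omega> = {u \<in> L2 \<Omega>. \<forall>i. \<exists>g. has_weak_partial \<Omega> i u g}"

definition H1_norm :: "(real^'d) set \<Rightarrow> (real^'d \<Rightarrow> real) \<Rightarrow> real" where
  "H1_norm \<Omega> u = sqrt ((L2_norm \<Omega> u)\<^sup>2 + (\<Sum>i\<in>UNIV. (L2_norm \<Omega> (weak_partial \<Omega> i u))\<^sup>2))"

definition H10 :: "(real^'d) set \<Rightarrow> (real^'d \<Rightarrow> real) set" where
  "H10 \<Omega> = {u \<in> H1 \<Omega>. \<forall>\<epsilon>>0. \<exists>\<phi>\<in>test_functions \<Omega>. H1_norm \<Omega> (\<lambda>x. u x - \<phi> x) < \<epsilon>}"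

text \<open>
  Functionals in \<open>H\<^sup>-\<^sup>1\<close> are represented by real-valued functions whose values are relevant on
  \<open>H10 \<Omega>\<close> only. The embedding of \<open>L2\<close> into \<open>H\<^sup>-\<^sup>1\<close> sends \<open>g\<close> to \<open>v \<mapsto> (g, v)\<close>; the following
  predicate says that \<open>g\<close> is the (almost everywhere unique) \<open>L2\<close> function identified with \<open>l\<close>.
\<close>

definition L2_represents ::
    "(real^'d) set \<Rightarrow> ((real^'d \<Rightarrow> real) \<Rightarrow> real) \<Rightarrow> (real^'d \<Rightarrow> real) \<Rightarrow> bool" where
  "L2_represents \<Omega> l g \<longleftrightarrow> g \<in> L2 \<Omega> \<and> (\<forall>v\<in>H10 \<Omega>. l v = L2_inner \<Omega> g v)"

text \<open>
  The space \<open>L\<^sup>p(I; V)\<close> for a space \<open>V\<close> of functions with norm \<open>N\<close>: strong measurability (almost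
  everywhere limit of simple functions with values in \<open>V\<close>) and integrability of \<open>N (f t) powr p\<close>.
  The library's Bochner integral is not applicable, since \<open>V\<close> is not a Banach space type.
\<close>

definition bochner_Lp ::
    "real \<Rightarrow> real set \<Rightarrow> ('a \<Rightarrow> real) set \<Rightarrow> (('a \<Rightarrow> real) \<Rightarrow> real) \<Rightarrow> (real \<Rightarrow> 'a \<Rightarrow> real) set" where
  "bochner_Lp p I V N =
     {f. (AE t in lebesgue_on I. f t \<in> V) \<and>
         (\<exists>s. (\<forall>n. simple_function (lebesgue_on I) (s n) \<and> (\<forall>t\<in>I. s n t \<in> V)) \<and>
              (AE t in lebesgue_on I. (\<lambda>n. N (\<lambda>x. s n t x - f t x)) \<longlonglongrightarrow> 0)) \<and>
         integrable (lebesgue_on I) (\<lambda>t. N (f t) powr p)}"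

definition bochner_Lp_norm ::
    "real \<Rightarrow> real set \<Rightarrow> (('a \<Rightarrow> real) \<Rightarrow> real) \<Rightarrow> (real \<Rightarrow> 'a \<Rightarrow> real) \<Rightarrow> real" where
  "bochner_Lp_norm p I N f = (\<integral>t. N (f t) powr p \<partial>lebesgue_on I) powr (1 / p)"

text \<open>The matrix \<open>a t x\<close> collects the coefficients: \<open>a t x $ i $ j\<close> is \<open>a\<^sub>i\<^sub>j(t,x)\<close>.\<close>

definition admissible_coefficients ::
    "(real^'d) set \<Rightarrow> real \<Rightarrow> real \<Rightarrow> (real \<Rightarrow> real) \<Rightarrow> (real \<Rightarrow> real^'d \<Rightarrow> real^'d^'d) \<Rightarrow> bool" where
  "admissible_coefficients \<Omega> T \<alpha> \<omega> a \<longleftrightarrow>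
     (\<forall>i j. (\<lambda>(t, x). a t x $ i $ j) \<in> borel_measurable (lebesgue_on ({0<..<T} \<times> \<Omega>))) \<and>
     (\<exists>B. AE (t, x) in lebesgue_on ({0<..<T} \<times> \<Omega>). \<forall>i j. \<bar>a t x $ i $ j\<bar> \<le> B) \<and>
     (AE (t, x) in lebesgue_on ({0<..<T} \<times> \<Omega>). \<forall>i j. a t x $ i $ j = a t x $ j $ i) \<and>
     (AE (t, x) in lebesgue_on ({0<..<T} \<times> \<Omega>).
        \<forall>\<xi>. (\<Sum>i\<in>UNIV. \<Sum>j\<in>UNIV. a t x $ i $ j * \<xi> $ i * \<xi> $ j) \<ge> \<alpha> * (norm \<xi>)\<^sup>2) \<and>
     (AE x in lebesgue_on \<Omega>. \<forall>i j. continuous_on {0..T} (\<lambda>t. a t x $ i $ j)) \<and>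
     (\<forall>t1\<in>{0..T}. \<forall>t2\<in>{0..T}. AE x in lebesgue_on \<Omega>. \<forall>i j.
        \<bar>a t1 x $ i $ j - a t2 x $ i $ j\<bar> \<le> \<omega> \<bar>t1 - t2\<bar>)"

definition admissible_modulus :: "real \<Rightarrow> (real \<Rightarrow> real) \<Rightarrow> bool" where
  "admissible_modulus T \<omega> \<longleftrightarrow>
     (\<forall>t\<in>{0..T}. \<omega> t \<ge> 0) \<and> mono_on {0..T} \<omega> \<and>
     antimono_on {0<..T} (\<lambda>t. \<omega> t / t powr (3/2)) \<and>
     integrable (lebesgue_on {0<..<T}) (\<lambda>t. \<omega> t * t powr (- 3/2))"

definition bilinear_form ::
    "(real^'d) set \<Rightarrow> (real \<Rightarrow> real^'d \<Rightarrow> real^'d^'d) \<Rightarrow> real \<Rightarrow>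
     (real^'d \<Rightarrow> real) \<Rightarrow> (real^'d \<Rightarrow> real) \<Rightarrow> real" where
  "bilinear_form \<Omega> a t u v =
     (\<integral>x. (\<Sum>i\<in>UNIV. \<Sum>j\<in>UNIV. a t x $ i $ j * weak_partial \<Omega> i u x * weak_partial \<Omega> j v x)
        \<partial>lebesgue_on \<Omega>)"

definition op_A ::
    "(real^'d) set \<Rightarrow> (real \<Rightarrow> real^'d \<Rightarrow> real^'d^'d) \<Rightarrow> real \<Rightarrow>
     (real^'d \<Rightarrow> real) \<Rightarrow> (real^'d \<Rightarrow> real) \<Rightarrow> real" where
  "op_A \<Omega> a t u = (\<lambda>v. bilinear_form \<Omega> a t u v)"

text \<open>A mesh is given by the number \<open>M\<close> of intervals and the nodes \<open>\<tau> 0, \<dots>, \<tau> M\<close>.\<close>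

definition step :: "(nat \<Rightarrow> real) \<Rightarrow> nat \<Rightarrow> real" where
  "step \<tau> m = \<tau> m - \<tau> (m - 1)"

definition max_step :: "nat \<Rightarrow> (nat \<Rightarrow> real) \<Rightarrow> real" where
  "max_step M \<tau> = Max (step \<tau> ` {1..M})"

definition min_step :: "nat \<Rightarrow> (nat \<Rightarrow> real) \<Rightarrow> real" where
  "min_step M \<tau> = Min (step \<tau> ` {1..M})"

definition interval :: "(nat \<Rightarrow> real) \<Rightarrow> nat \<Rightarrow> real set" where
  "interval \<tau> m = {\<tau> (m - 1)<..\<tau> m}"

definition time_mesh :: "real \<Rightarrow> real \<Rightarrow> real \<Rightarrow> real \<Rightarrow> nat \<Rightarrow> (nat \<Rightarrow> real) \<Rightarrow> bool" where
  "time_mesh T c \<beta> \<kappa> M \<tau> \<longleftrightarrow>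
     \<tau> 0 = 0 \<and> \<tau> M = T \<and> (\<forall>m\<in>{1..M}. \<tau> (m - 1) < \<tau> m) \<and>
     min_step M \<tau> \<ge> c * max_step M \<tau> powr \<beta> \<and>
     (\<forall>m\<in>{1..M - 1}. 1 / \<kappa> \<le> step \<tau> m / step \<tau> (m + 1) \<and> step \<tau> m / step \<tau> (m + 1) \<le> \<kappa>) \<and>
     max_step M \<tau> \<le> T / 4"

text \<open>
  The average of the operators over a mesh interval, tested pointwise. Under the assumptions on
  the coefficients, \<open>t \<mapsto> A(t)\<close> is continuous in the operator norm, so this is the
  operator-valued integral.
\<close>

definition op_A_avg ::
    "(real^'d) set \<Rightarrow> (real \<Rightarrow> real^'d \<Rightarrow> real^'d^'d) \<Rightarrow> (nat \<Rightarrow> real) \<Rightarrow> nat \<Rightarrow>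
     (real^'d \<Rightarrow> real) \<Rightarrow> (real^'d \<Rightarrow> real) \<Rightarrow> real" where
  "op_A_avg \<Omega> a \<tau> m u =
     (\<lambda>v. 1 / step \<tau> m * (\<integral>t. op_A \<Omega> a t u v \<partial>lebesgue_on (interval \<tau> m)))"

definition X_k0 ::
    "(real^'d) set \<Rightarrow> real \<Rightarrow> nat \<Rightarrow> (nat \<Rightarrow> real) \<Rightarrow> (real \<Rightarrow> real^'d \<Rightarrow> real) set" where
  "X_k0 \<Omega> T M \<tau> =
     {v \<in> bochner_Lp 2 {0<..<T} (H10 \<Omega>) (H1_norm \<Omega>).
        \<forall>m\<in>{1..M}. \<forall>s\<in>interval \<tau> m. \<forall>t\<in>interval \<tau> m. v s = v t}"

text \<open>The value on the \<open>m\<close>-th interval is attained at its right endpoint.\<close>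

definition piece :: "(nat \<Rightarrow> real) \<Rightarrow> (real \<Rightarrow> 'a \<Rightarrow> real) \<Rightarrow> nat \<Rightarrow> 'a \<Rightarrow> real" where
  "piece \<tau> v m = v (\<tau> m)"

definition jump ::
    "(nat \<Rightarrow> real) \<Rightarrow> ('a \<Rightarrow> real) \<Rightarrow> (real \<Rightarrow> 'a \<Rightarrow> real) \<Rightarrow> nat \<Rightarrow> 'a \<Rightarrow> real" where
  "jump \<tau> u0 u m =
     (\<lambda>x. piece \<tau> u (m + 1) x - (if m = 0 then u0 x else piece \<tau> u m x))"

definition dG0_solution ::
    "(real^'d) set \<Rightarrow> real \<Rightarrow> (real \<Rightarrow> real^'d \<Rightarrow> real^'d^'d) \<Rightarrow> nat \<Rightarrow> (nat \<Rightarrow> real) \<Rightarrow>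
     (real \<Rightarrow> real^'d \<Rightarrow> real) \<Rightarrow> (real^'d \<Rightarrow> real) \<Rightarrow> (real \<Rightarrow> real^'d \<Rightarrow> real) \<Rightarrow> bool" where
  "dG0_solution \<Omega> T a M \<tau> f u0 u \<longleftrightarrow>
     u \<in> X_k0 \<Omega> T M \<tau> \<and>
     (\<forall>\<phi>\<in>X_k0 \<Omega> T M \<tau>.
        (\<integral>t. bilinear_form \<Omega> a t (u t) (\<phi> t) \<partial>lebesgue_on {0<..<T})
        + (\<Sum>m=2..M. L2_inner \<Omega> (\<lambda>x. piece \<tau> u m x - piece \<tau> u (m - 1) x) (piece \<tau> \<phi> m))
        + L2_inner \<Omega> (piece \<tau> u 1) (piece \<tau> \<phi> 1)
        = (\<integral>t. L2_inner \<Omega> (f t) (\<phi> t) \<partial>lebesgue_on {0<..<T})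
          + L2_inner \<Omega> u0 (piece \<tau> \<phi> 1))"

end

theory Submission
  imports Defs "HOL-Library.Function_Algebras"
begin

text \<open>
  Write \<open>w\<^sub>m\<close> for the \<open>L2\<close> function that represents \<open>A\<^sub>m u\<^sub>m\<close>, where \<open>A\<^sub>m\<close> is the averaged operator, and
  \<open>F\<^sub>m\<close> for the integral of \<open>f\<close> over the \<open>m\<close>-th interval. The scheme reads
  \<open>u\<^sub>m - u\<^sub>m\<^sub>-\<^sub>1 + k\<^sub>m w\<^sub>m = F\<^sub>m\<close>. Hence \<open>w\<^sub>m\<close> exists, the jumps are \<open>F\<^sub>m - k\<^sub>m w\<^sub>m\<close>, and it suffices to bound
  the sum of \<open>k\<^sub>m \<parallel>w\<^sub>m\<parallel>\<close>.

  Fix \<open>m\<close> and freeze the operator at \<open>A\<^sub>m\<close>. Run the implicit Euler scheme for \<open>A\<^sub>m\<close> backwards in time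
  from \<open>\<psi>\<^sub>m\<^sub>+\<^sub>1 = w\<^sub>m\<close>, and let \<open>\<chi>\<^sub>i = A\<^sub>m \<psi>\<^sub>i = (\<psi>\<^sub>i\<^sub>+\<^sub>1 - \<psi>\<^sub>i) / k\<^sub>i\<close>. Testing the scheme for \<open>u\<close> with \<open>\<chi>\<close> gives a
  discrete Duhamel formula (lemma \<open>frozen_duality\<close>)
  \<open>\<parallel>w\<^sub>m\<parallel>\<^sup>2 = (\<Sum>i\<le>m. (F\<^sub>i, \<chi>\<^sub>i)) + (\<Sum>i<m. k\<^sub>i (a\<^sub>m - a\<^sub>i)(u\<^sub>i, \<chi>\<^sub>i))\<close>,
  where the initial value has been added to \<open>F\<^sub>1\<close>. The frozen scheme is autonomous and symmetric. With
  \<open>s = t\<^sub>m - t\<^sub>i\<^sub>-\<^sub>1\<close> it satisfies \<open>\<parallel>\<chi>\<^sub>i\<parallel> \<le> \<parallel>w\<^sub>m\<parallel> / s\<close> and \<open>a\<^sub>m(\<chi>\<^sub>i, \<chi>\<^sub>i) \<le> C \<parallel>w\<^sub>m\<parallel>\<^sup>2 / s\<^sup>3\<close> for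
  \<open>i < m\<close>; both bounds come from
  one weighted energy that decreases along the scheme (lemmas \<open>weighted_energy_decay\<close> and
  \<open>implicit_Euler_smoothing\<close>). The second bound is where neighbouring steps have to be comparable.

  Since \<open>a\<^sub>m - a\<^sub>i\<close> is bounded by a multiple of \<open>\<omega>(s)\<close> times the gradient norms, this yields
  \<open>\<parallel>w\<^sub>m\<parallel> \<le> (\<Sum>i\<le>m. \<parallel>F\<^sub>i\<parallel> / s) + C (\<Sum>i<m. k\<^sub>i \<parallel>\<nabla>u\<^sub>i\<parallel> \<omega>(s) / s powr (3/2))\<close>.
  Multiply by \<open>k\<^sub>m\<close> and sum over \<open>m\<close> first. In the first term the sum of \<open>k\<^sub>m / s\<close> is at most
  \<open>1 + ln (T / k\<^sub>m\<^sub>i\<^sub>n)\<close>, bounded by a multiple of \<open>ln (T / k)\<close> because \<open>k\<^sub>m\<^sub>i\<^sub>n\<close> is at least \<open>c * k powr \<beta>\<close>. In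
  the second term the sum of \<open>k\<^sub>m \<omega>(s) / s powr (3/2)\<close> is a lower Riemann sum of the integral of
  \<open>\<omega>(t) t powr (-3/2)\<close>, because the integrand is nonincreasing. What remains there is the sum of
  \<open>k\<^sub>i \<parallel>\<nabla>u\<^sub>i\<parallel>\<close>, which the basic energy estimate controls by the data.

  The frozen scheme is solved by the Riesz theorem in \<open>H10\<close>. This rests on the completeness of \<open>L2\<close>
  (\<open>L2_complete\<close>) and on the closedness and linearity of weak derivatives. As \<open>weak_partial\<close> picks an
  arbitrary representative, linearity holds only almost everywhere and requires uniqueness, that is
  the fundamental lemma (\<open>fundamental_lemma_test_functions\<close>). The coefficients are controlled
  almost everywhere in space-time only; continuity in time transfers this to every single time
  (\<open>elliptic_slice_all\<close>).
\<close>

section \<open>Semi-inner products and the Riesz representation\<close>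

text \<open>
  With pointwise operations, spaces of functions become subspaces of one vector space, and the
  forms on them instances of an abstract theory.
\<close>

instantiation "fun" :: (type, real_vector) real_vector
begin

definition "r *\<^sub>R f = (\<lambda>x. r *\<^sub>R f x)"

instance
  by standard (simp_all add: scaleR_fun_def fun_eq_iff scaleR_add_right scaleR_add_left)

end

lemma scaleR_fun_apply [simp]: "(r *\<^sub>R f) x = r *\<^sub>R f x"
  by (simp add: scaleR_fun_def)

text \<open>
  The form may vanish on nonzero vectors, because functions that agree almost everywhere are not
  identified.
\<close>

locale semi_inner =
  fixes V :: "'v::real_vector set" and b :: "'v \<Rightarrow> 'v \<Rightarrow> real"
  assumes subsp: "subspace V"
    and add_left: "\<lbrakk>u \<in> V; v \<in> V; w \<in> V\<rbrakk> \<Longrightarrow> b (u + v) w = b u w + b v w"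
    and scale_left: "\<lbrakk>u \<in> V; w \<in> V\<rbrakk> \<Longrightarrow> b (r *\<^sub>R u) w = r * b u w"
    and sym: "\<lbrakk>u \<in> V; v \<in> V\<rbrakk> \<Longrightarrow> b u v = b v u"
    and nonneg: "u \<in> V \<Longrightarrow> 0 \<le> b u u"
begin

lemma mem [simp, intro]:
  "0 \<in> V" "\<lbrakk>u \<in> V; v \<in> V\<rbrakk> \<Longrightarrow> u + v \<in> V" "u \<in> V \<Longrightarrow> r *\<^sub>R u \<in> V"
  "\<lbrakk>u \<in> V; v \<in> V\<rbrakk> \<Longrightarrow> u - v \<in> V"
  using subsp by (auto simp: subspace_0 subspace_add subspace_scale subspace_diff)

lemma add_right: "\<lbrakk>u \<in> V; v \<in> V; w \<in> V\<rbrakk> \<Longrightarrow> b w (u + v) = b w u + b w v"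
  by (simp add: add_left sym[of w])

lemma scale_right: "\<lbrakk>u \<in> V; w \<in> V\<rbrakk> \<Longrightarrow> b w (r *\<^sub>R u) = r * b w u"
  by (simp add: scale_left sym[of w])

lemma diff_left: "\<lbrakk>u \<in> V; v \<in> V; w \<in> V\<rbrakk> \<Longrightarrow> b (u - v) w = b u w - b v w"
  using add_left[of "u - v" v w] by simp

lemma diff_right: "\<lbrakk>u \<in> V; v \<in> V; w \<in> V\<rbrakk> \<Longrightarrow> b w (u - v) = b w u - b w v"
  by (simp add: diff_left sym[of w])

lemmas bilinear = add_left add_right scale_left scale_right diff_left diff_right

lemma zero_left [simp]: "v \<in> V \<Longrightarrow> b 0 v = 0"
  using scale_left[of 0 v 0] by simp

lemma zero_right [simp]: "v \<in> V \<Longrightarrow> b v 0 = 0"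
  using scale_right[of 0 v 0] by simp

lemma square_add:
  assumes "u \<in> V" "v \<in> V"
  shows "b (u + v) (u + v) = b u u + 2 * b u v + b v v"
  using assms by (simp add: bilinear sym[of v u])

lemma square_diff:
  assumes "u \<in> V" "v \<in> V"
  shows "b (u - v) (u - v) = b u u - 2 * b u v + b v v"
  using assms by (simp add: bilinear sym[of v u])

lemma two_le:
  assumes "u \<in> V" "v \<in> V"
  shows "2 * b u v \<le> b u u + b v v"
  using nonneg[of "u - v"] square_diff[OF assms] assms by simp

lemma Cauchy_Schwarz_sq:
  assumes u: "u \<in> V" and v: "v \<in> V"
  shows "(b u v)\<^sup>2 \<le> b u u * b v v"
proof -
  have q: "0 \<le> b u u + 2 * t * b u v + t\<^sup>2 * b v v" for t
    using nonneg[of "u + t *\<^sub>R v"] assms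
    by (simp add: bilinear sym[of v u] power2_eq_square algebra_simps)
  show ?thesis
  proof (cases "b v v = 0")
    case True
    have "b u v = 0"
    proof (rule ccontr)
      assume n: "b u v \<noteq> 0"
      show False
        using q[of "- (b u u + 1) / (2 * b u v)"] n True nonneg[OF u] by (simp add: field_simps)
    qed
    then show ?thesis using True by simp
  next
    case False
    then have p: "b v v > 0" using nonneg[OF v] by simp
    have "0 \<le> b u u - (b u v)\<^sup>2 / b v v"
      using q[of "- b u v / b v v"] p by (simp add: field_simps power2_eq_square)
    then show ?thesis using p by (simp add: field_simps)
  qed
qed

definition nrm :: "'v \<Rightarrow> real" where "nrm u = sqrt (b u u)"

lemma nrm_nonneg [simp]: "u \<in> V \<Longrightarrow> 0 \<le> nrm u"
  by (simp add: nrm_def nonneg)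

lemma nrm_sq: "u \<in> V \<Longrightarrow> (nrm u)\<^sup>2 = b u u"
  by (simp add: nrm_def nonneg)

lemma Cauchy_Schwarz:
  assumes "u \<in> V" "v \<in> V"
  shows "\<bar>b u v\<bar> \<le> nrm u * nrm v"
proof -
  have "\<bar>b u v\<bar> = sqrt ((b u v)\<^sup>2)" by simp
  also have "\<dots> \<le> sqrt (b u u * b v v)"
    using Cauchy_Schwarz_sq[OF assms] by (simp only: real_sqrt_le_iff)
  finally show ?thesis by (simp add: nrm_def real_sqrt_mult)
qed

lemma nrm_scale: "u \<in> V \<Longrightarrow> nrm (r *\<^sub>R u) = \<bar>r\<bar> * nrm u"
proof -
  assume u: "u \<in> V"
  have "b (r *\<^sub>R u) (r *\<^sub>R u) = r\<^sup>2 * b u u"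
    using u by (simp add: bilinear power2_eq_square)
  then show ?thesis by (simp add: nrm_def real_sqrt_mult)
qed

lemma nrm_add_le:
  assumes u: "u \<in> V" and v: "v \<in> V"
  shows "nrm (u + v) \<le> nrm u + nrm v"
proof (rule power2_le_imp_le)
  have "(nrm (u + v))\<^sup>2 = b u u + 2 * b u v + b v v"
    using assms by (simp add: nrm_sq square_add)
  also have "\<dots> \<le> (nrm u + nrm v)\<^sup>2"
    using Cauchy_Schwarz[OF assms] assms by (simp add: power2_sum nrm_sq)
  finally show "(nrm (u + v))\<^sup>2 \<le> (nrm u + nrm v)\<^sup>2" .
qed (simp add: assms)

lemma nrm_diff_le:
  assumes u: "u \<in> V" and v: "v \<in> V"
  shows "nrm (u - v) \<le> nrm u + nrm v"
  using nrm_add_le[OF u, of "(-1) *\<^sub>R v"] v nrm_scale[OF v, of "-1"] mem(3)[OF v, of "-1"] by simp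

text \<open>
  The limit is determined up to vectors of norm zero.
\<close>

definition complete_form :: bool where
  "complete_form \<longleftrightarrow>
     (\<forall>X. (\<forall>n. X n \<in> V) \<and> (\<forall>e>0. \<exists>N. \<forall>m\<ge>N. \<forall>n\<ge>N. nrm (X m - X n) < e) \<longrightarrow>
        (\<exists>x\<in>V. (\<lambda>n. nrm (X n - x)) \<longlonglongrightarrow> 0))"

text \<open>
  The representing vector minimizes \<open>b v v - 2 * l v\<close>. The functional is bounded below, and
  completeness provides the limit of a minimizing sequence.
\<close>

theorem Riesz_representation:
  assumes compl: complete_form
    and l_add: "\<And>u v. \<lbrakk>u \<in> V; v \<in> V\<rbrakk> \<Longrightarrow> l (u + v) = l u + l v"
    and l_scale: "\<And>u r. u \<in> V \<Longrightarrow> l (r *\<^sub>R u) = r * l u"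
    and l_bound: "\<And>u. u \<in> V \<Longrightarrow> \<bar>l u\<bar> \<le> K * nrm u"
  shows "\<exists>g\<in>V. \<forall>v\<in>V. l v = b g v"
proof -
  define J where "J v = b v v - 2 * l v" for v
  have J_ge: "- K\<^sup>2 \<le> J v" if "v \<in> V" for v
  proof -
    have "0 \<le> (nrm v - K)\<^sup>2" by simp
    then show ?thesis
      using l_bound[OF that] that by (simp add: J_def power2_diff nrm_sq mult.commute)
  qed
  define d where "d = Inf (J ` V)"
  have bdd: "bdd_below (J ` V)" using J_ge by (auto intro!: bdd_belowI2)
  have d_le: "d \<le> J v" if "v \<in> V" for v
    unfolding d_def using bdd that by (intro cInf_lower) auto
  have "\<exists>v\<in>V. J v < d + 1 / real (Suc n)" for n
  proof -
    have "\<exists>y\<in>J ` V. y < d + 1 / real (Suc n)"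
      unfolding d_def by (rule cInf_lessD) (use mem(1) in \<open>auto simp: d_def\<close>)
    then show ?thesis by auto
  qed
  then obtain X where X: "X n \<in> V" and XJ: "J (X n) < d + 1 / real (Suc n)" for n
    by metis
  \<comment> \<open>The parallelogram identity turns near-minimality into closeness.\<close>
  have par: "b (u - v) (u - v) = 2 * J u + 2 * J v - 4 * J ((1/2) *\<^sub>R (u + v))"
    if "u \<in> V" "v \<in> V" for u v
    using that by (simp add: J_def bilinear l_add l_scale sym[of v u] field_simps)
  have close: "(nrm (X m - X n))\<^sup>2 \<le> 2 / real (Suc m) + 2 / real (Suc n)" for m n
  proof -
    have "d \<le> J ((1/2) *\<^sub>R (X m + X n))" using X d_le by auto
    then show ?thesis
      using par[of "X m" "X n"] XJ[of m] XJ[of n] X by (simp add: nrm_sq)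
  qed
  have cauchy: "\<exists>N. \<forall>m\<ge>N. \<forall>n\<ge>N. nrm (X m - X n) < e" if "e > 0" for e
  proof -
    obtain N where N: "4 / e\<^sup>2 < real N" using reals_Archimedean2 by blast
    have "nrm (X m - X n) < e" if mn: "m \<ge> N" "n \<ge> N" for m n
    proof -
      have small: "1 / real (Suc j) < e\<^sup>2 / 4" if "j \<ge> N" for j
      proof -
        have "4 / e\<^sup>2 < real (Suc j)" using N that by linarith
        then show ?thesis using \<open>e > 0\<close> by (simp add: field_simps)
      qed
      have "(nrm (X m - X n))\<^sup>2 < e\<^sup>2"
        using close[of m n] small[OF mn(1)] small[OF mn(2)] by simp
      then show ?thesis using \<open>e > 0\<close> by (simp add: power_less_imp_less_base)
    qed
    then show ?thesis by blast
  qed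
  obtain g where g: "g \<in> V" and lim: "(\<lambda>n. nrm (X n - g)) \<longlonglongrightarrow> 0"
    using compl X cauchy unfolding complete_form_def by blast
  have Jg: "J g \<le> d"
  proof -
    have "J g \<le> J (X n) + 2 * nrm (X n - g) * (nrm g + K)" for n
    proof -
      have e: "X n - g \<in> V" using X g by simp
      have "J (X n) = J (g + (X n - g))" by simp
      also have "\<dots> = J g + 2 * b g (X n - g) + b (X n - g) (X n - g) - 2 * l (X n - g)"
        unfolding J_def square_add[OF g e] l_add[OF g e] by simp
      finally have "J g \<le> J (X n) - 2 * b g (X n - g) + 2 * l (X n - g)"
        using nonneg[OF e] by simp
      then show ?thesis
        using Cauchy_Schwarz[OF g e] l_bound[OF e] by (simp add: algebra_simps)
    qed
    then have "J g \<le> d + 1 / real (Suc n) + 2 * nrm (X n - g) * (nrm g + K)" for n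
      using XJ[of n] by (smt (verit))
    moreover have "(\<lambda>n. d + 1 / real (Suc n) + 2 * nrm (X n - g) * (nrm g + K))
        \<longlonglongrightarrow> d + 0 + 2 * 0 * (nrm g + K)"
      by (intro tendsto_intros lim LIMSEQ_Suc[OF lim_1_over_n])
    ultimately show ?thesis
      using LIMSEQ_le_const[of _ "d + 0 + 2 * 0 * (nrm g + K)" "J g"] by auto
  qed
  have "l v = b g v" if v: "v \<in> V" for v
  proof -
    have q: "0 \<le> t * (2 * (b g v - l v)) + t\<^sup>2 * b v v" for t
    proof -
      have "J g \<le> J (g + t *\<^sub>R v)" using Jg d_le[of "g + t *\<^sub>R v"] g v by simp
      then show ?thesis
        using g v by (simp add: J_def bilinear l_add l_scale sym[of v g] power2_eq_square algebra_simps)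
    qed
    \<comment> \<open>Choose \<open>t\<close> close to the minimizer \<open>- r / b v v\<close>; the summand 1 covers the case \<open>b v v = 0\<close>.\<close>
    define r where "r = b g v - l v"
    define B where "B = b v v + 1"
    have B: "B > 0" "b v v \<le> B" using nonneg[OF v] by (auto simp: B_def)
    have "0 \<le> - 2 * r\<^sup>2 / B + r\<^sup>2 / B\<^sup>2 * b v v"
      using q[of "- r / B"] by (simp add: r_def[symmetric] power2_eq_square mult_ac)
    also have "\<dots> \<le> - 2 * r\<^sup>2 / B + r\<^sup>2 / B\<^sup>2 * B"
      using B by (intro add_left_mono mult_left_mono) auto
    also have "\<dots> = - r\<^sup>2 / B" using B by (simp add: field_simps power2_eq_square)
    finally have "r\<^sup>2 \<le> 0" using B by (simp add: field_simps)
    then show ?thesis by (simp add: r_def)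
  qed
  then show ?thesis using g by blast
qed

end

lemma semi_inner_subspace:
  assumes "semi_inner V b" "W \<subseteq> V" "subspace W"
  shows "semi_inner W b"
proof -
  interpret semi_inner V b by (fact assms)
  show ?thesis
    using assms(2,3) by unfold_locales (auto simp: subset_iff add_left scale_left nonneg intro: sym)
qed

lemma complete_form_subspace:
  assumes b: "semi_inner V b" "semi_inner.complete_form V b" and W: "W \<subseteq> V" "subspace W"
    and closed: "\<And>X x. \<lbrakk>\<And>n. X n \<in> W; x \<in> V; (\<lambda>n. semi_inner.nrm b (X n - x)) \<longlonglongrightarrow> 0\<rbrakk> \<Longrightarrow> x \<in> W"
  shows "semi_inner.complete_form W b"
proof -
  interpret V: semi_inner V b by (fact b)
  interpret W: semi_inner W b by (rule semi_inner_subspace[OF b(1) W])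
  show ?thesis
    unfolding W.complete_form_def
  proof (intro allI impI, elim conjE)
    fix X :: "nat \<Rightarrow> 'a"
    assume X: "\<forall>n. X n \<in> W" and cauchy: "\<forall>e>0. \<exists>N. \<forall>m\<ge>N. \<forall>n\<ge>N. V.nrm (X m - X n) < e"
    obtain x where x: "x \<in> V" "(\<lambda>n. V.nrm (X n - x)) \<longlonglongrightarrow> 0"
      using b(2)[unfolded V.complete_form_def, rule_format, of X] X cauchy W(1) by blast
    then show "\<exists>x\<in>W. (\<lambda>n. V.nrm (X n - x)) \<longlonglongrightarrow> 0"
      using closed[of X x] X by blast
  qed
qed

lemma complete_form_equivalent:
  assumes b: "semi_inner V b" "semi_inner.complete_form V b" and b': "semi_inner V b'"
    and c: "c > 0" and lower: "\<And>u. u \<in> V \<Longrightarrow> c * b u u \<le> b' u u"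
    and upper: "\<And>u. u \<in> V \<Longrightarrow> b' u u \<le> C * b u u"
  shows "semi_inner.complete_form V b'"
proof -
  interpret V: semi_inner V b by (fact b)
  interpret V': semi_inner V b' by (fact b')
  have low: "sqrt c * V.nrm u \<le> V'.nrm u" if "u \<in> V" for u
    unfolding V.nrm_def V'.nrm_def real_sqrt_mult[symmetric] using lower[OF that] by simp
  have up: "V'.nrm u \<le> sqrt C * V.nrm u" if "u \<in> V" for u
    unfolding V.nrm_def V'.nrm_def real_sqrt_mult[symmetric] using upper[OF that] by simp
  show ?thesis
    unfolding V'.complete_form_def
  proof (intro allI impI, elim conjE)
    fix X :: "nat \<Rightarrow> 'a"
    assume X: "\<forall>n. X n \<in> V" and cauchy: "\<forall>e>0. \<exists>N. \<forall>m\<ge>N. \<forall>n\<ge>N. V'.nrm (X m - X n) < e"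
    have "\<exists>N. \<forall>m\<ge>N. \<forall>n\<ge>N. V.nrm (X m - X n) < e" if "e > 0" for e
    proof -
      obtain N where N: "V'.nrm (X m - X n) < sqrt c * e" if "m \<ge> N" "n \<ge> N" for m n
        using cauchy that c by (meson mult_pos_pos real_sqrt_gt_zero \<open>e > 0\<close>)
      have "V.nrm (X m - X n) < e" if "m \<ge> N" "n \<ge> N" for m n
      proof -
        have "sqrt c * V.nrm (X m - X n) < sqrt c * e"
          using low[of "X m - X n"] N[OF that] X by auto
        then show ?thesis using c by simp
      qed
      then show ?thesis by blast
    qed
    then obtain x where x: "x \<in> V" "(\<lambda>n. V.nrm (X n - x)) \<longlonglongrightarrow> 0"
      using b(2) X unfolding V.complete_form_def by blast
    have "(\<lambda>n. V'.nrm (X n - x)) \<longlonglongrightarrow> 0"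
    proof (rule tendsto_sandwich)
      show "\<forall>\<^sub>F n in sequentially. 0 \<le> V'.nrm (X n - x)"
        using X x(1) by (intro always_eventually) auto
      show "\<forall>\<^sub>F n in sequentially. V'.nrm (X n - x) \<le> sqrt C * V.nrm (X n - x)"
        using X x(1) up by (intro always_eventually) auto
      show "(\<lambda>n. sqrt C * V.nrm (X n - x)) \<longlonglongrightarrow> 0"
        using tendsto_mult[OF tendsto_const x(2), of "sqrt C"] by simp
    qed simp
    then show "\<exists>x\<in>V. (\<lambda>n. V'.nrm (X n - x)) \<longlonglongrightarrow> 0" using x(1) by blast
  qed
qed

section \<open>Smoothing by the implicit Euler scheme\<close>

text \<open>
  The sequences stand for \<open>\<parallel>p\<^sub>n\<parallel>\<^sup>2\<close>, \<open>a(p\<^sub>n, p\<^sub>n)\<close>, \<open>\<parallel>A p\<^sub>n\<parallel>\<^sup>2\<close> and \<open>a(A p\<^sub>n, A p\<^sub>n)\<close> along an implicit Euler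
  scheme with steps \<open>h\<close> and times \<open>s\<close>. Each energy dissipates the next one, and the weights are chosen
  so that the dissipation pays for the growth of the weights. The only term in the expansion of
  \<open>(s + h) ^ 3\<close> that is not dissipated directly is \<open>h ^ 3\<close>, which the comparability of neighbouring
  steps reduces to \<open>s * h\<^sup>2\<close>; this determines the factor \<open>1 / (3 + \<kappa>)\<close>.
\<close>

lemma weighted_energy_decay:
  fixes P Q R S h s :: "nat \<Rightarrow> real"
  assumes \<kappa>: "\<kappa> > 0"
    and s0: "s 0 = 0" and s_Suc: "\<And>n. s (Suc n) = s n + h (Suc n)"
    and h_pos: "\<And>n. \<lbrakk>1 \<le> n; n \<le> N\<rbrakk> \<Longrightarrow> h n > 0"
    and h_up: "\<And>n. \<lbrakk>1 \<le> n; n < N\<rbrakk> \<Longrightarrow> h (Suc n) \<le> \<kappa> * h n"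
    and h_down: "\<And>n. \<lbrakk>1 \<le> n; n < N\<rbrakk> \<Longrightarrow> h n \<le> \<kappa> * h (Suc n)"
    and nonneg: "\<And>n. \<lbrakk>1 \<le> n; n \<le> N\<rbrakk> \<Longrightarrow> 0 \<le> P n"
      "\<And>n. \<lbrakk>1 \<le> n; n \<le> N\<rbrakk> \<Longrightarrow> 0 \<le> Q n" "\<And>n. \<lbrakk>1 \<le> n; n \<le> N\<rbrakk> \<Longrightarrow> 0 \<le> R n"
      "\<And>n. \<lbrakk>2 \<le> n; n \<le> N\<rbrakk> \<Longrightarrow> 0 \<le> S n"
    and P: "\<And>n. n < N \<Longrightarrow>
      P (Suc n) + 2 * h (Suc n) * Q (Suc n) + (h (Suc n))\<^sup>2 * R (Suc n) \<le> P n"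
    and Q: "\<And>n. \<lbrakk>1 \<le> n; n < N\<rbrakk> \<Longrightarrow>
      Q (Suc n) + 2 * h (Suc n) * R (Suc n) + (h (Suc n))\<^sup>2 * S (Suc n) \<le> Q n"
    and R: "\<And>n. \<lbrakk>1 \<le> n; n < N\<rbrakk> \<Longrightarrow> R (Suc n) + 2 * h (Suc n) * S (Suc n) \<le> R n"
    and S: "\<And>n. \<lbrakk>2 \<le> n; n < N\<rbrakk> \<Longrightarrow> S (Suc n) \<le> S n"
    and n: "1 \<le> n" "n \<le> N"
  shows "P n + s n * Q n + (s n)\<^sup>2 * R n + (if n = 1 then 0 else (s n) ^ 3 * S n / (3 + \<kappa>)) \<le> P 0"
  using n
proof (induction n)
  case 0
  then show ?case by simp
next
  case (Suc n)
  define k where "k = h (Suc n)"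
  have k: "k > 0" using h_pos Suc.prems by (simp add: k_def)
  have s_nn: "0 \<le> s j" if "j \<le> N" for j
    using that
  proof (induction j)
    case (Suc j)
    then show ?case using h_pos[of "Suc j"] by (simp add: s_Suc)
  qed (simp add: s0)
  note nn = nonneg(1-3)[of "Suc n"] and SucN = Suc.prems
  show ?case
  proof (cases "n = 0")
    case True
    have "P 1 + s 1 * Q 1 + (s 1)\<^sup>2 * R 1 \<le> P 1 + 2 * h 1 * Q 1 + (h 1)\<^sup>2 * R 1"
      using s0 s_Suc[of 0] k nn Suc.prems True by (simp add: k_def)
    also have "\<dots> \<le> P 0" using P[of 0] Suc.prems True by simp
    finally show ?thesis using True by simp
  next
    case False
    then have n1: "1 \<le> n" "n < N" using Suc.prems by auto
    define \<sigma> where "\<sigma> = s n"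
    define p where "p = P (Suc n)"
    define q where "q = Q (Suc n)"
    define r where "r = R (Suc n)"
    define z where "z = S (Suc n)"
    have nonn: "0 \<le> q" "0 \<le> r" "0 \<le> z" "0 \<le> \<sigma>"
      using nonneg(2-4)[of "Suc n"] n1 s_nn[of n] by (auto simp: q_def r_def z_def \<sigma>_def)
    have hn: "h n \<le> \<sigma>"
      using s_Suc[of "n - 1"] s_nn[of "n - 1"] n1 by (simp add: \<sigma>_def)
    have k_le: "k \<le> \<kappa> * \<sigma>"
      using order_trans[OF h_up[OF n1] mult_left_mono[OF hn, of \<kappa>]] \<kappa> by (simp add: k_def)
    have k3: "k ^ 3 \<le> \<kappa> * \<sigma> * k\<^sup>2"
      using mult_right_mono[OF k_le, of "k\<^sup>2"] by (simp add: power2_eq_square power3_eq_cube)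
    have IH: "P n + \<sigma> * Q n + \<sigma>\<^sup>2 * R n + (if n = 1 then 0 else \<sigma> ^ 3 * S n / (3 + \<kappa>)) \<le> P 0"
      using Suc.IH[OF n1(1)] n1 unfolding \<sigma>_def by (simp only: less_imp_le)
    have eP: "p + 2 * k * q + k\<^sup>2 * r \<le> P n" using P n1 by (simp add: p_def q_def r_def k_def)
    have eQ: "\<sigma> * q + 2 * \<sigma> * k * r + \<sigma> * k\<^sup>2 * z \<le> \<sigma> * Q n"
      using mult_left_mono[OF Q[OF n1] nonn(4)]
      by (simp add: q_def r_def z_def k_def algebra_simps)
    have eR: "\<sigma>\<^sup>2 * r + 2 * \<sigma>\<^sup>2 * k * z \<le> \<sigma>\<^sup>2 * R n"
      using mult_left_mono[OF R[OF n1], of "\<sigma>\<^sup>2"]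
      by (simp add: r_def z_def k_def algebra_simps)
    have kq: "0 \<le> k * q" using k nonn by simp
    \<comment> \<open>In the step from 1 to 2 no previous value of \<open>S\<close> exists, and \<open>\<sigma> \<le> \<kappa> * k\<close> has to absorb \<open>\<sigma> ^ 3\<close> instead.\<close>
    have key: "(\<sigma> + k) ^ 3 * z / (3 + \<kappa>)
        \<le> (if n = 1 then 0 else \<sigma> ^ 3 * S n / (3 + \<kappa>)) + (2 * \<sigma>\<^sup>2 * k + \<sigma> * k\<^sup>2) * z"
    proof (cases "n = 1")
      case True
      have "\<sigma> \<le> \<kappa> * k"
        using h_down[OF n1] s0 s_Suc[of 0] True by (simp add: \<sigma>_def k_def)
      then have "\<sigma> ^ 3 \<le> \<kappa> * \<sigma>\<^sup>2 * k"
        using mult_right_mono[of \<sigma> "\<kappa> * k" "\<sigma>\<^sup>2"]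
        by (simp add: power2_eq_square power3_eq_cube mult_ac)
      moreover have "(3 + \<kappa>) * (2 * \<sigma>\<^sup>2 * k + \<sigma> * k\<^sup>2) - (\<sigma> + k) ^ 3
          = (\<kappa> * \<sigma>\<^sup>2 * k - \<sigma> ^ 3) + (\<kappa> * \<sigma> * k\<^sup>2 - k ^ 3) + (3 + \<kappa>) * (\<sigma>\<^sup>2 * k)"
        by (simp add: power2_eq_square power3_eq_cube algebra_simps)
      moreover have "0 \<le> (3 + \<kappa>) * (\<sigma>\<^sup>2 * k)" using \<kappa> k by simp
      ultimately have "(\<sigma> + k) ^ 3 \<le> (3 + \<kappa>) * (2 * \<sigma>\<^sup>2 * k + \<sigma> * k\<^sup>2)"
        using k3 by linarith
      then have "(\<sigma> + k) ^ 3 * z \<le> (3 + \<kappa>) * (2 * \<sigma>\<^sup>2 * k + \<sigma> * k\<^sup>2) * z"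
        using nonn by (intro mult_right_mono)
      then show ?thesis using True \<kappa> by (simp add: field_simps)
    next
      case False
      have "\<sigma> ^ 3 + (3 + \<kappa>) * (2 * \<sigma>\<^sup>2 * k + \<sigma> * k\<^sup>2) - (\<sigma> + k) ^ 3
          = (\<kappa> * \<sigma> * k\<^sup>2 - k ^ 3) + (3 + 2 * \<kappa>) * (\<sigma>\<^sup>2 * k)"
        by (simp add: power2_eq_square power3_eq_cube algebra_simps)
      moreover have "0 \<le> (3 + 2 * \<kappa>) * (\<sigma>\<^sup>2 * k)" using \<kappa> k by simp
      ultimately have "(\<sigma> + k) ^ 3 \<le> \<sigma> ^ 3 + (3 + \<kappa>) * (2 * \<sigma>\<^sup>2 * k + \<sigma> * k\<^sup>2)"
        using k3 by linarith
      then have "(\<sigma> + k) ^ 3 * z \<le> \<sigma> ^ 3 * z + (3 + \<kappa>) * (2 * \<sigma>\<^sup>2 * k + \<sigma> * k\<^sup>2) * z"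
        using mult_right_mono[OF _ nonn(3)] by (metis distrib_right)
      also have "\<sigma> ^ 3 * z \<le> \<sigma> ^ 3 * S n"
        using S[of n] n1 False nonn by (intro mult_left_mono) (auto simp: z_def)
      finally have "(\<sigma> + k) ^ 3 * z / (3 + \<kappa>)
          \<le> (\<sigma> ^ 3 * S n + (3 + \<kappa>) * ((2 * \<sigma>\<^sup>2 * k + \<sigma> * k\<^sup>2) * z)) / (3 + \<kappa>)"
        using \<kappa> by (intro divide_right_mono) (simp_all add: mult.assoc)
      then show ?thesis using False \<kappa> by (simp add: add_divide_distrib)
    qed
    have "p + (\<sigma> + k) * q + (\<sigma> + k)\<^sup>2 * r + (\<sigma> + k) ^ 3 * z / (3 + \<kappa>) \<le> P 0"
      using eP eQ eR kq key IH by (simp add: power2_eq_square algebra_simps)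
    then show ?thesis
      using False by (simp add: s_Suc p_def q_def r_def z_def k_def \<sigma>_def)
  qed
qed

locale gelfand = H: semi_inner H ip
  for H :: "'v::real_vector set" and ip :: "'v \<Rightarrow> 'v \<Rightarrow> real" +
  fixes V :: "'v set"
  assumes V_sub: "V \<subseteq> H"
begin

lemma in_H [simp, intro]: "v \<in> V \<Longrightarrow> v \<in> H"
  using V_sub by blast

definition resolvable :: "('v \<Rightarrow> 'v \<Rightarrow> real) \<Rightarrow> bool" where
  "resolvable a \<longleftrightarrow>
     (\<forall>k>0. \<forall>\<phi>\<in>H. \<exists>\<psi>\<in>V. \<forall>v\<in>V. ip \<psi> v + k * a \<psi> v = ip \<phi> v)"

end

text \<open>
  The scheme \<open>p\<^sub>n + h\<^sub>n A p\<^sub>n = p\<^sub>n\<^sub>-\<^sub>1\<close> for the operator \<open>A\<close> of the form \<open>a\<close>. The difference quotient \<open>q\<^sub>n\<close> is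
  \<open>A p\<^sub>n\<close>. It lies in \<open>V\<close> only from the second step on, because \<open>p\<^sub>0\<close> is an arbitrary element of the
  pivot space; this is why estimates in the energy norm start at index 2.
\<close>

locale implicit_Euler = gelfand H ip V + a: semi_inner V a
  for H :: "'v::real_vector set" and ip V a +
  fixes N :: nat and h :: "nat \<Rightarrow> real" and p q :: "nat \<Rightarrow> 'v"
  assumes h_pos: "\<And>n. \<lbrakk>1 \<le> n; n \<le> N\<rbrakk> \<Longrightarrow> h n > 0"
    and p_0: "p 0 \<in> H" and p_V: "\<And>n. \<lbrakk>1 \<le> n; n \<le> N\<rbrakk> \<Longrightarrow> p n \<in> V"
    and euler: "\<And>n v. \<lbrakk>1 \<le> n; n \<le> N; v \<in> V\<rbrakk> \<Longrightarrow>
      ip (p n) v + h n * a (p n) v = ip (p (n - 1)) v"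
    and q: "\<And>n. q n = (1 / h n) *\<^sub>R (p (n - 1) - p n)"
begin

lemma p_H: "n \<le> N \<Longrightarrow> p n \<in> H"
  using p_0 p_V[of n] by (cases "n = 0") auto

lemma q_H: "\<lbrakk>1 \<le> n; n \<le> N\<rbrakk> \<Longrightarrow> q n \<in> H"
  using p_H[of n] p_H[of "n - 1"] by (auto simp: q)

lemma q_V: "\<lbrakk>2 \<le> n; n \<le> N\<rbrakk> \<Longrightarrow> q n \<in> V"
  using p_V[of n] p_V[of "n - 1"] by (auto simp: q)

lemma p_eq: "\<lbrakk>1 \<le> n; n \<le> N\<rbrakk> \<Longrightarrow> p (n - 1) = p n + h n *\<^sub>R q n"
  using h_pos[of n] by (simp add: q)

lemma q_weak:
  assumes "1 \<le> n" "n \<le> N" "v \<in> V"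
  shows "ip (q n) v = a (p n) v"
proof -
  have pos: "h n > 0" using h_pos assms by blast
  have "h n * ip (q n) v = h n * a (p n) v"
    using euler[OF assms] p_eq[OF assms(1,2)] p_H[of n] q_H[of n] assms
    by (auto simp: H.bilinear)
  then show ?thesis using pos by simp
qed

lemma q_step:
  assumes "1 \<le> n" "n < N" "v \<in> V"
  shows "ip (q n) v = ip (q (Suc n)) v + h (Suc n) * a (q (Suc n)) v"
  using q_weak[of n v] q_weak[of "Suc n" v] p_eq[of "Suc n"] assms p_V[of "Suc n"] q_V[of "Suc n"]
  by (simp add: a.bilinear)

text \<open>
  These are the discrete counterparts of the bounds for \<open>A exp (- s A)\<close> as an operator on \<open>H\<close> and from
  \<open>H\<close> to \<open>V\<close>. The recursions for the four energies result from testing the scheme with \<open>p\<^sub>n\<close>, \<open>q\<^sub>n\<close> and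
  differences of the \<open>q\<^sub>n\<close>; symmetry of \<open>a\<close> makes them signed.
\<close>

lemma implicit_Euler_smoothing:
  assumes \<kappa>: "\<kappa> > 0"
    and s0: "s 0 = 0" and s_Suc: "\<And>n. s (Suc n) = s n + h (Suc n)"
    and h_up: "\<And>n. \<lbrakk>1 \<le> n; n < N\<rbrakk> \<Longrightarrow> h (Suc n) \<le> \<kappa> * h n"
    and h_down: "\<And>n. \<lbrakk>1 \<le> n; n < N\<rbrakk> \<Longrightarrow> h n \<le> \<kappa> * h (Suc n)"
    and n: "1 \<le> n" "n \<le> N"
  shows "(s n)\<^sup>2 * ip (q n) (q n) \<le> ip (p 0) (p 0)"
    and "2 \<le> n \<Longrightarrow> (s n) ^ 3 * a (q n) (q n) \<le> (3 + \<kappa>) * ip (p 0) (p 0)"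
proof -
  define P where "P n = ip (p n) (p n)" for n
  define Q where "Q n = a (p n) (p n)" for n
  define R where "R n = ip (q n) (q n)" for n
  define S where "S n = a (q n) (q n)" for n
  have nonn: "1 \<le> n \<Longrightarrow> n \<le> N \<Longrightarrow> 0 \<le> P n" "1 \<le> n \<Longrightarrow> n \<le> N \<Longrightarrow> 0 \<le> Q n"
     "1 \<le> n \<Longrightarrow> n \<le> N \<Longrightarrow> 0 \<le> R n" "2 \<le> n \<Longrightarrow> n \<le> N \<Longrightarrow> 0 \<le> S n" for n
    using p_H[of n] p_V[of n] q_H[of n] q_V[of n]
    by (auto simp: P_def Q_def R_def S_def H.nonneg a.nonneg)
  have s_nn: "0 \<le> s j" if "j \<le> N" for j
    using that
  proof (induction j)
    case (Suc j)
    then show ?case using h_pos[of "Suc j"] by (simp add: s_Suc)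
  qed (simp add: s0)
  have L: "P n + s n * Q n + (s n)\<^sup>2 * R n + (if n = 1 then 0 else (s n) ^ 3 * S n / (3 + \<kappa>)) \<le> P 0"
  proof (rule weighted_energy_decay[where h = h and N = N])
    fix n assume n: "n < N"
    have "P n = P (Suc n) + 2 * h (Suc n) * ip (p (Suc n)) (q (Suc n)) + (h (Suc n))\<^sup>2 * R (Suc n)"
      using p_eq[of "Suc n"] p_H[of "Suc n"] q_H[of "Suc n"] n
      by (simp add: P_def R_def H.bilinear H.sym[of "q (Suc n)" "p (Suc n)"] power2_eq_square
          algebra_simps)
    moreover have "ip (p (Suc n)) (q (Suc n)) = Q (Suc n)"
      using q_weak[of "Suc n" "p (Suc n)"] p_V[of "Suc n"] q_H[of "Suc n"] n
      by (simp add: Q_def H.sym)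
    ultimately show "P (Suc n) + 2 * h (Suc n) * Q (Suc n) + (h (Suc n))\<^sup>2 * R (Suc n) \<le> P n"
      by simp
  next
    fix n assume n: "1 \<le> n" "n < N"
    have V: "p (Suc n) \<in> V" "q (Suc n) \<in> V" using p_V[of "Suc n"] q_V[of "Suc n"] n by auto
    have "Q n = Q (Suc n) + 2 * h (Suc n) * a (p (Suc n)) (q (Suc n)) + (h (Suc n))\<^sup>2 * S (Suc n)"
      using p_eq[of "Suc n"] V n
      by (simp add: Q_def S_def a.bilinear a.sym[of "q (Suc n)" "p (Suc n)"] power2_eq_square
          algebra_simps)
    moreover have "a (p (Suc n)) (q (Suc n)) = R (Suc n)"
      using q_weak[of "Suc n" "q (Suc n)"] V n by (simp add: R_def)
    ultimately show "Q (Suc n) + 2 * h (Suc n) * R (Suc n) + (h (Suc n))\<^sup>2 * S (Suc n) \<le> Q n"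
      by simp
    have "ip (q n) (q (Suc n)) = R (Suc n) + h (Suc n) * S (Suc n)"
      using q_step[OF n V(2)] by (simp add: R_def S_def)
    moreover have "2 * ip (q n) (q (Suc n)) \<le> R n + R (Suc n)"
      unfolding R_def using q_H[of n] q_H[of "Suc n"] n by (intro H.two_le) auto
    ultimately show "R (Suc n) + 2 * h (Suc n) * S (Suc n) \<le> R n" by simp
  next
    fix n assume n: "2 \<le> n" "n < N"
    have V: "q n \<in> V" "q (Suc n) \<in> V" using q_V[of n] q_V[of "Suc n"] n by auto
    then have dV: "q n - q (Suc n) \<in> V" by simp
    have "ip (q n - q (Suc n)) (q n - q (Suc n)) = h (Suc n) * a (q (Suc n)) (q n - q (Suc n))"
      using q_step[of n, OF _ _ dV] n V dV by (simp add: H.diff_left)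
    then have "0 \<le> h (Suc n) * a (q (Suc n)) (q n - q (Suc n))"
      using H.nonneg[of "q n - q (Suc n)"] dV by auto
    then have "S (Suc n) \<le> a (q (Suc n)) (q n)"
      using h_pos[of "Suc n"] n V by (simp add: zero_le_mult_iff S_def a.diff_right)
    then show "S (Suc n) \<le> S n"
      using a.two_le[OF V(2,1)] by (simp add: S_def)
  qed (use nonn n in \<open>simp_all add: \<kappa> s0 s_Suc h_pos h_up h_down n\<close>)
  note nn = nonn(1)[OF n] nonn(2)[OF n] nonn(3)[OF n] s_nn[OF n(2)]
  show "(s n)\<^sup>2 * ip (q n) (q n) \<le> ip (p 0) (p 0)"
  proof -
    have "0 \<le> (if n = 1 then 0 else (s n) ^ 3 * S n / (3 + \<kappa>))"
      using \<kappa> nonn(4)[of n] n nn by auto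
    moreover have "0 \<le> s n * Q n" using nn by simp
    ultimately show ?thesis using L nn unfolding P_def R_def by linarith
  qed
  show "(s n) ^ 3 * a (q n) (q n) \<le> (3 + \<kappa>) * ip (p 0) (p 0)" if "2 \<le> n"
  proof -
    have "0 \<le> s n * Q n" "0 \<le> (s n)\<^sup>2 * R n" using nn by simp_all
    moreover have "P n + s n * Q n + (s n)\<^sup>2 * R n + (s n) ^ 3 * S n / (3 + \<kappa>) \<le> P 0"
      using L that by simp
    ultimately have "(s n) ^ 3 * S n / (3 + \<kappa>) \<le> P 0" using nn by linarith
    then show ?thesis using \<kappa> by (simp add: P_def S_def field_simps)
  qed
qed

end

lemma (in gelfand) implicit_Euler_exists:
  assumes a: "semi_inner V a" and res: "resolvable a" and \<phi>: "\<phi> \<in> H"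
    and h_pos: "\<And>n. \<lbrakk>1 \<le> n; n \<le> N\<rbrakk> \<Longrightarrow> h n > 0"
  shows "\<exists>p q. implicit_Euler H ip V a N h p q \<and> p 0 = \<phi>"
proof -
  define p where
    "p = rec_nat \<phi> (\<lambda>n x. SOME \<psi>. \<psi> \<in> V \<and> (\<forall>v\<in>V. ip \<psi> v + h (Suc n) * a \<psi> v = ip x v))"
  have step: "p (Suc n) \<in> V \<and> (\<forall>v\<in>V. ip (p (Suc n)) v + h (Suc n) * a (p (Suc n)) v = ip (p n) v)"
    if "p n \<in> H" "Suc n \<le> N" for n
  proof -
    have "\<exists>\<psi>. \<psi> \<in> V \<and> (\<forall>v\<in>V. ip \<psi> v + h (Suc n) * a \<psi> v = ip (p n) v)"
      using res[unfolded resolvable_def, rule_format, of "h (Suc n)" "p n"] that h_pos[of "Suc n"]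
      by auto
    from someI_ex[OF this] show ?thesis by (simp add: p_def)
  qed
  have "n \<le> N \<Longrightarrow> p n \<in> H" for n
  proof (induction n)
    case (Suc n)
    then show ?case using step[of n] by simp
  qed (simp add: p_def \<phi>)
  then have p: "p n \<in> V \<and> (\<forall>v\<in>V. ip (p n) v + h n * a (p n) v = ip (p (n - 1)) v)"
    if "1 \<le> n" "n \<le> N" for n
    using step[of "n - 1"] that by simp
  have p0: "p 0 = \<phi>" by (simp add: p_def)
  have "implicit_Euler H ip V a N h p (\<lambda>n. (1 / h n) *\<^sub>R (p (n - 1) - p n))"
    by (intro implicit_Euler.intro implicit_Euler_axioms.intro gelfand_axioms a h_pos)
      (use p p0 \<phi> in auto)
  then show ?thesis using p0 by blast
qed

section \<open>The nonautonomous scheme in a Gelfand triple\<close>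

text \<open>
  The scheme \<open>u\<^sub>m - u\<^sub>m\<^sub>-\<^sub>1 + k\<^sub>m A\<^sub>m u\<^sub>m = G\<^sub>m\<close> with zero initial value, where \<open>A\<^sub>m\<close> belongs to the form \<open>a m\<close> and
  \<open>w m\<close> is \<open>A\<^sub>m u\<^sub>m\<close>. An initial value is treated as a part of \<open>G 1\<close>. The numbers \<open>\<rho> i m\<close> measure how far
  the forms at two steps differ.
\<close>

locale discrete_parabolic = gelfand H ip V
  for H :: "'v::real_vector set" and ip and V +
  fixes a :: "nat \<Rightarrow> 'v \<Rightarrow> 'v \<Rightarrow> real" and \<tau> :: "nat \<Rightarrow> real" and M :: nat and \<kappa> :: real
    and u G w :: "nat \<Rightarrow> 'v" and \<rho> :: "nat \<Rightarrow> nat \<Rightarrow> real"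
  assumes form: "\<And>m. \<lbrakk>1 \<le> m; m \<le> M\<rbrakk> \<Longrightarrow> semi_inner V (a m)"
    and resolvable: "\<And>m. \<lbrakk>1 \<le> m; m \<le> M\<rbrakk> \<Longrightarrow> resolvable (a m)"
    and \<kappa>: "\<kappa> > 0"
    and step_pos: "\<And>m. \<lbrakk>1 \<le> m; m \<le> M\<rbrakk> \<Longrightarrow> 0 < step \<tau> m"
    and step_up: "\<And>m. \<lbrakk>1 \<le> m; m < M\<rbrakk> \<Longrightarrow> step \<tau> (Suc m) \<le> \<kappa> * step \<tau> m"
    and step_down: "\<And>m. \<lbrakk>1 \<le> m; m < M\<rbrakk> \<Longrightarrow> step \<tau> m \<le> \<kappa> * step \<tau> (Suc m)"
    and u_0: "u 0 = 0" and u_V: "\<And>m. \<lbrakk>1 \<le> m; m \<le> M\<rbrakk> \<Longrightarrow> u m \<in> V"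
    and G_H: "\<And>m. \<lbrakk>1 \<le> m; m \<le> M\<rbrakk> \<Longrightarrow> G m \<in> H"
    and w_eq: "\<And>m. \<lbrakk>1 \<le> m; m \<le> M\<rbrakk> \<Longrightarrow> step \<tau> m *\<^sub>R w m = G m + u (m - 1) - u m"
    and w_H: "\<And>m. \<lbrakk>1 \<le> m; m \<le> M\<rbrakk> \<Longrightarrow> w m \<in> H"
    and weak: "\<And>m v. \<lbrakk>1 \<le> m; m \<le> M; v \<in> V\<rbrakk> \<Longrightarrow> ip (w m) v = a m (u m) v"
    and perturb: "\<And>i m x v. \<lbrakk>1 \<le> i; i < m; m \<le> M; x \<in> V; v \<in> V\<rbrakk> \<Longrightarrow>
      \<bar>a m x v - a i x v\<bar> \<le> \<rho> i m * sqrt (a i x x) * sqrt (a m v v)"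
    and \<rho>_nonneg: "\<And>i m. \<lbrakk>1 \<le> i; i < m; m \<le> M\<rbrakk> \<Longrightarrow> 0 \<le> \<rho> i m"
begin

lemma u_H: "m \<le> M \<Longrightarrow> u m \<in> H"
  using u_V[of m] u_0 by (cases "m = 0") auto

lemma node_less: "i < m \<Longrightarrow> m \<le> M \<Longrightarrow> \<tau> i < \<tau> m"
proof (induction m)
  case (Suc m)
  have "\<tau> m < \<tau> (Suc m)" using step_pos[of "Suc m"] Suc.prems by (simp add: step_def)
  then show ?case using Suc by (cases "i = m") auto
qed simp

lemma tested_equation:
  assumes "1 \<le> m" "m \<le> M" "v \<in> V"
  shows "ip (u m) v + step \<tau> m * a m (u m) v = ip (u (m - 1)) v + ip (G m) v"
proof -
  have "step \<tau> m * a m (u m) v = ip (step \<tau> m *\<^sub>R w m) v"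
    using weak[OF assms] w_H[OF assms(1,2)] assms by (simp add: H.bilinear)
  also have "\<dots> = ip (G m) v + ip (u (m - 1)) v - ip (u m) v"
    unfolding w_eq[OF assms(1,2)]
    using G_H[of m] u_H[of m] u_H[of "m - 1"] assms by (simp add: H.bilinear)
  finally show ?thesis by simp
qed

text \<open>
  The discrete Duhamel formula. The dual scheme \<open>p\<close> uses the form \<open>a m\<close> at all steps and runs backwards
  in time, its step \<open>n\<close> sitting on the interval \<open>m + 1 - n\<close>. In the induction, one step of the dual
  scheme is undone with the equation for \<open>u\<close> on the same interval, which leaves the load and the
  difference of the two forms.
\<close>

lemma frozen_duality:
  assumes m: "1 \<le> m" "m \<le> M"
  defines "h \<equiv> \<lambda>n. step \<tau> (m + 1 - n)"
  assumes E: "implicit_Euler H ip V (a m) m h p q" and p0: "p 0 = w m"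
  shows "ip (w m) (w m) = (\<Sum>l=1..m. ip (G (m + 1 - l)) (q l) +
    h l * (a m (u (m + 1 - l)) (q l) - a (m + 1 - l) (u (m + 1 - l)) (q l)))"
proof -
  interpret E: implicit_Euler H ip V "a m" m h p q by (rule E)
  have "ip (w m) (w m) = ip (u (m - n)) (q n) + (\<Sum>l=1..n. ip (G (m + 1 - l)) (q l) +
    h l * (a m (u (m + 1 - l)) (q l) - a (m + 1 - l) (u (m + 1 - l)) (q l)))"
    if "1 \<le> n" "n \<le> m" for n
    using that
  proof (induction n)
    case (Suc n)
    show ?case
    proof (cases "n = 0")
      case True
      have mem: "p 1 \<in> V" "p 1 \<in> H" "q 1 \<in> H" "u m \<in> V" "w m \<in> H" "u (m - 1) \<in> H" "G m \<in> H"
        using E.p_V[of 1] E.q_H[of 1] u_V[of m] u_H[of "m - 1"] w_H[OF m] G_H[OF m] m by auto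
      have "w m = p 1 + h 1 *\<^sub>R q 1" using E.p_eq[of 1] p0 m by simp
      then have "ip (w m) (w m) = ip (w m) (p 1 + h 1 *\<^sub>R q 1)" by (rule arg_cong)
      also have "\<dots> = ip (w m) (p 1) + h 1 * ip (w m) (q 1)"
        using mem by (simp add: H.bilinear)
      also have "ip (w m) (p 1) = ip (u m) (q 1)"
        using weak[OF m mem(1)] E.q_weak[of 1 "u m"] mem m
        by (simp add: E.a.sym[of "u m"] H.sym[of "u m"])
      also have "h 1 * ip (w m) (q 1) = ip (G m + u (m - 1) - u m) (q 1)"
        using mem w_eq[OF m] H.scale_left[of "w m" "q 1" "h 1"] by (simp add: h_def)
      finally show ?thesis
        using True mem by (simp add: H.bilinear)
    next
      case False
      then have n: "1 \<le> n" "Suc n \<le> m" using Suc.prems by auto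
      define i where "i = m - n"
      have i: "1 \<le> i" "i \<le> M" and i_eq: "m - n = i" "m - Suc n = i - 1" "m + 1 - Suc n = i"
        and h_eq: "h (Suc n) = step \<tau> i"
        using n m by (auto simp: i_def h_def)
      have uV: "u i \<in> V" by (rule u_V[OF i])
      have mem: "q n \<in> H" "q (Suc n) \<in> V" "p n \<in> V" "p (Suc n) \<in> V"
        using E.q_H E.q_V E.p_V n by auto
      have "ip (u i) (q n) = a m (p n) (u i)"
        using E.q_weak[of n "u i"] n uV mem H.sym[of "u i" "q n"] by simp
      also have "\<dots> = a m (p (Suc n)) (u i) + h (Suc n) * a m (q (Suc n)) (u i)"
        using E.p_eq[of "Suc n"] n uV mem by (simp add: E.a.bilinear)
      also have "\<dots> = ip (u i) (q (Suc n)) + h (Suc n) * a m (u i) (q (Suc n))"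
        using E.q_weak[of "Suc n" "u i"] n uV mem H.sym[of "u i" "q (Suc n)"]
          E.a.sym[of "u i" "q (Suc n)"] by simp
      also have "\<dots> = ip (u (i - 1)) (q (Suc n)) + (ip (G i) (q (Suc n)) +
          h (Suc n) * (a m (u i) (q (Suc n)) - a i (u i) (q (Suc n))))"
        using tested_equation[OF i mem(2)] by (simp add: h_eq algebra_simps)
      finally show ?thesis
        using Suc.IH n by (simp add: i_eq)
    qed
  qed simp
  from this[of m] show ?thesis using m E.q_H[of m] u_0 by simp
qed

text \<open>
  In the duality formula the last interval contributes no difference of forms. For all others the dual
  variable belongs to \<open>V\<close>, and the bound of order \<open>-3/2\<close> for its energy norm applies.
\<close>

lemma pointwise_smoothing:
  assumes m: "1 \<le> m" "m \<le> M"
  shows "H.nrm (w m) \<le> (\<Sum>i=1..m. H.nrm (G i) / (\<tau> m - \<tau> (i - 1)))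
    + sqrt (3 + \<kappa>) * (\<Sum>i=1..<m. step \<tau> i * sqrt (a i (u i) (u i)) *
        (\<rho> i m / (\<tau> m - \<tau> (i - 1)) powr (3 / 2)))"
proof -
  define h where "h = (\<lambda>n. step \<tau> (m + 1 - n))"
  define s where "s n = \<tau> m - \<tau> (m - n)" for n
  have h_pos: "h n > 0" if "1 \<le> n" "n \<le> m" for n
    using step_pos that m by (simp add: h_def)
  have wH: "w m \<in> H" by (rule w_H[OF m])
  obtain p q where E: "implicit_Euler H ip V (a m) m h p q" and p0: "p 0 = w m"
    using implicit_Euler_exists[OF form[OF m] resolvable[OF m] wH, of m h] h_pos by blast
  interpret E: implicit_Euler H ip V "a m" m h p q by (rule E)
  have s_Suc: "s (Suc n) = s n + h (Suc n)" for n
    by (cases "n < m") (simp_all add: s_def h_def step_def)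
  have up: "h (Suc n) \<le> \<kappa> * h n" if "1 \<le> n" "n < m" for n
    using step_down[of "m - n"] that m by (simp add: h_def Suc_diff_le)
  have down: "h n \<le> \<kappa> * h (Suc n)" if "1 \<le> n" "n < m" for n
    using step_up[of "m - n"] that m by (simp add: h_def Suc_diff_le)
  note smoothing = E.implicit_Euler_smoothing[OF \<kappa>, of s, OF _ s_Suc up down]
  have qR: "(s n)\<^sup>2 * ip (q n) (q n) \<le> ip (w m) (w m)" if "1 \<le> n" "n \<le> m" for n
    using smoothing(1)[of n] that p0 by (simp add: s_def)
  have qS: "(s n) ^ 3 * a m (q n) (q n) \<le> (3 + \<kappa>) * ip (w m) (w m)" if "2 \<le> n" "n \<le> m" for n
    using smoothing(2)[of n] that p0 by (simp add: s_def)
  have s_pos: "s n > 0" if "1 \<le> n" "n \<le> m" for n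
    using node_less[of "m - n" m] that m by (simp add: s_def)
  have q_nrm: "H.nrm (q n) \<le> H.nrm (w m) / s n" if "1 \<le> n" "n \<le> m" for n
  proof -
    have "(s n * H.nrm (q n))\<^sup>2 \<le> (H.nrm (w m))\<^sup>2"
      using qR[OF that] H.nrm_sq[OF E.q_H[OF that]] H.nrm_sq[OF wH] by (simp add: power_mult_distrib)
    then have "s n * H.nrm (q n) \<le> H.nrm (w m)"
      by (rule power2_le_imp_le) (simp add: wH)
    then show ?thesis using s_pos[OF that] by (simp add: field_simps)
  qed
  have q_form: "sqrt (a m (q n) (q n)) \<le> sqrt (3 + \<kappa>) * H.nrm (w m) / s n powr (3 / 2)"
    if "2 \<le> n" "n \<le> m" for n
  proof -
    have sp: "s n > 0" using s_pos that by simp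
    have "sqrt ((s n) ^ 3) * sqrt (a m (q n) (q n)) \<le> sqrt (3 + \<kappa>) * sqrt (ip (w m) (w m))"
      using qS[OF that] by (simp only: real_sqrt_mult[symmetric] real_sqrt_le_iff)
    moreover have "s n powr (3 / 2) = sqrt ((s n) ^ 3)"
    proof -
      have "s n powr (3 / 2) = (s n powr 3) powr (1 / 2)" by (simp add: powr_powr)
      also have "\<dots> = sqrt ((s n) ^ 3)" using sp by (simp add: powr_half_sqrt)
      finally show ?thesis .
    qed
    ultimately show ?thesis
      using sp by (simp add: H.nrm_def pos_le_divide_eq mult.commute)
  qed
  define A where "A i = H.nrm (G i) / (\<tau> m - \<tau> (i - 1))" for i
  define B where "B i = (if i < m then sqrt (3 + \<kappa>) * (step \<tau> i * sqrt (a i (u i) (u i)) *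
        (\<rho> i m / (\<tau> m - \<tau> (i - 1)) powr (3 / 2))) else 0)" for i
  have term_le: "ip (G (m + 1 - l)) (q l) +
      h l * (a m (u (m + 1 - l)) (q l) - a (m + 1 - l) (u (m + 1 - l)) (q l))
      \<le> H.nrm (w m) * (A (m + 1 - l) + B (m + 1 - l))" if l: "l \<in> {1..m}" for l
  proof -
    define i where "i = m + 1 - l"
    have i: "1 \<le> i" "i \<le> m" "i \<le> M" and sl: "s l = \<tau> m - \<tau> (i - 1)"
      using l m by (auto simp: i_def s_def)
    have "ip (G i) (q l) \<le> H.nrm (G i) * H.nrm (q l)"
      using H.Cauchy_Schwarz[of "G i" "q l"] G_H[of i] E.q_H[of l] i l by auto
    also have "\<dots> \<le> H.nrm (G i) * (H.nrm (w m) / s l)"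
      using q_nrm[of l] G_H[of i] i l by (intro mult_left_mono) auto
    finally have 1: "ip (G i) (q l) \<le> H.nrm (w m) * A i" by (simp add: A_def sl mult.commute)
    have 2: "h l * (a m (u i) (q l) - a i (u i) (q l)) \<le> H.nrm (w m) * B i"
    proof (cases "i < m")
      case True
      then have l2: "2 \<le> l" "l \<le> m" using l by (auto simp: i_def)
      have hl: "h l = step \<tau> i" by (simp add: h_def i_def)
      interpret ai: semi_inner V "a i" by (rule form[OF i(1,3)])
      have "a m (u i) (q l) - a i (u i) (q l)
          \<le> \<rho> i m * sqrt (a i (u i) (u i)) * sqrt (a m (q l) (q l))"
        using perturb[of i m "u i" "q l"] i m True u_V[of i] E.q_V[OF l2] by auto
      also have "\<dots> \<le> \<rho> i m * sqrt (a i (u i) (u i)) *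
          (sqrt (3 + \<kappa>) * H.nrm (w m) / s l powr (3 / 2))"
        using q_form[OF l2] \<rho>_nonneg[of i m] True i m ai.nonneg[OF u_V[of i]]
        by (intro mult_left_mono) auto
      finally have "h l * (a m (u i) (q l) - a i (u i) (q l)) \<le> step \<tau> i * (\<rho> i m *
          sqrt (a i (u i) (u i)) * (sqrt (3 + \<kappa>) * H.nrm (w m) / s l powr (3 / 2)))"
        unfolding hl using step_pos[of i] i by (intro mult_left_mono) auto
      also have "\<dots> = H.nrm (w m) * B i"
        using True by (simp add: B_def sl mult_ac)
      finally show ?thesis .
    next
      case False
      then have "i = m" using i by simp
      then show ?thesis by (simp add: B_def)
    qed
    show ?thesis using 1 2 unfolding i_def[symmetric] by (simp add: distrib_left)
  qed
  have "(H.nrm (w m))\<^sup>2 = (\<Sum>l=1..m. ip (G (m + 1 - l)) (q l) +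
    h l * (a m (u (m + 1 - l)) (q l) - a (m + 1 - l) (u (m + 1 - l)) (q l)))"
    unfolding H.nrm_sq[OF wH] h_def
    by (rule frozen_duality[OF m E[unfolded h_def] p0])
  also have "\<dots> \<le> (\<Sum>l=1..m. H.nrm (w m) * (A (m + 1 - l) + B (m + 1 - l)))"
    by (rule sum_mono) (rule term_le)
  also have "\<dots> = H.nrm (w m) * (\<Sum>l=1..m. A (m + 1 - l) + B (m + 1 - l))"
    by (simp add: sum_distrib_left)
  also have "(\<Sum>l=1..m. A (m + 1 - l) + B (m + 1 - l)) = (\<Sum>i=1..m. A i + B i)"
    by (subst sum.atLeastAtMost_rev[of _ 1 m]) (simp add: add.commute)
  finally have le: "H.nrm (w m) * H.nrm (w m) \<le> H.nrm (w m) * (\<Sum>i=1..m. A i + B i)"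
    by (simp add: power2_eq_square)
  have "0 \<le> A i + B i" if "i \<in> {1..m}" for i
  proof -
    have "i - 1 < m" using that by simp arith
    then have "\<tau> (i - 1) < \<tau> m" by (rule node_less) (rule m)
    then have "0 \<le> A i" using that m G_H[of i] by (simp add: A_def)
    moreover have "0 \<le> B i"
    proof -
      interpret ai: semi_inner V "a i" by (rule form) (use that m in auto)
      show ?thesis
        using that m step_pos[of i] \<rho>_nonneg[of i m] \<kappa> ai.nonneg[OF u_V[of i]]
        by (auto simp: B_def intro!: mult_nonneg_nonneg divide_nonneg_nonneg)
    qed
    ultimately show ?thesis by simp
  qed
  then have nn: "0 \<le> (\<Sum>i=1..m. A i + B i)" by (rule sum_nonneg)
  have "H.nrm (w m) \<le> (\<Sum>i=1..m. A i + B i)"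
  proof (cases "H.nrm (w m) = 0")
    case False
    then have "H.nrm (w m) > 0" using H.nrm_nonneg[OF wH] by linarith
    then show ?thesis using le by simp
  qed (use nn in simp)
  also have "\<dots> = (\<Sum>i=1..m. A i) + (\<Sum>i=1..<m. B i)"
  proof -
    have "(\<Sum>i=1..m. B i) = (\<Sum>i=1..<m. B i)"
      by (rule sum.mono_neutral_right) (auto simp: B_def)
    then show ?thesis by (simp add: sum.distrib)
  qed
  also have "(\<Sum>i=1..<m. B i) = sqrt (3 + \<kappa>) * (\<Sum>i=1..<m. step \<tau> i * sqrt (a i (u i) (u i)) *
        (\<rho> i m / (\<tau> m - \<tau> (i - 1)) powr (3 / 2)))"
    unfolding sum_distrib_left by (rule sum.cong) (auto simp: B_def)
  finally show ?thesis by (simp add: A_def)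
qed

text \<open>
  Each resolvent step is a contraction of the pivot space.
\<close>

lemma nrm_u_le: "m \<le> M \<Longrightarrow> H.nrm (u m) \<le> (\<Sum>i=1..m. H.nrm (G i))"
proof (induction m)
  case 0
  then show ?case by (simp add: u_0 H.nrm_def)
next
  case (Suc m)
  interpret a: semi_inner V "a (Suc m)" by (rule form) (use Suc.prems in auto)
  have mem: "u (Suc m) \<in> V" "u (Suc m) \<in> H" "u m \<in> H" "G (Suc m) \<in> H"
    using u_V[of "Suc m"] u_H[of m] G_H[of "Suc m"] Suc.prems by auto
  have "H.nrm (u (Suc m)) * H.nrm (u (Suc m)) \<le> ip (u m) (u (Suc m)) + ip (G (Suc m)) (u (Suc m))"
  proof -
    have "0 \<le> step \<tau> (Suc m) * a (Suc m) (u (Suc m)) (u (Suc m))"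
      using a.nonneg[OF mem(1)] step_pos[of "Suc m"] Suc.prems by simp
    moreover have "H.nrm (u (Suc m)) * H.nrm (u (Suc m)) = ip (u (Suc m)) (u (Suc m))"
      using H.nrm_sq[OF mem(2)] by (simp add: power2_eq_square)
    ultimately show ?thesis
      using tested_equation[of "Suc m" "u (Suc m)"] mem Suc.prems by simp
  qed
  also have "\<dots> \<le> (H.nrm (u m) + H.nrm (G (Suc m))) * H.nrm (u (Suc m))"
    using H.Cauchy_Schwarz[OF mem(3,2)] H.Cauchy_Schwarz[OF mem(4,2)] by (simp add: distrib_right)
  finally have "H.nrm (u (Suc m)) \<le> H.nrm (u m) + H.nrm (G (Suc m))"
    using mem by (cases "H.nrm (u (Suc m)) = 0") (auto simp: less_le)
  then show ?case using Suc by simp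
qed

lemma energy_estimate:
  "(\<Sum>i=1..M. step \<tau> i * a i (u i) (u i)) \<le> (\<Sum>i=1..M. H.nrm (G i))\<^sup>2"
proof -
  define D where "D = (\<Sum>i=1..M. H.nrm (G i))"
  have G_nn: "0 \<le> H.nrm (G i)" if "i \<in> {1..M}" for i using that G_H by auto
  have "(\<Sum>i=1..m. step \<tau> i * a i (u i) (u i)) + ip (u m) (u m) / 2 \<le> D * (\<Sum>i=1..m. H.nrm (G i))"
    if "m \<le> M" for m
    using that
  proof (induction m)
    case (Suc m)
    have mem: "u (Suc m) \<in> V" "u (Suc m) \<in> H" "u m \<in> H" "G (Suc m) \<in> H"
      using u_V[of "Suc m"] u_H[of m] G_H[of "Suc m"] Suc.prems by auto
    have "H.nrm (u (Suc m)) \<le> (\<Sum>i=1..Suc m. H.nrm (G i))"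
      using nrm_u_le Suc.prems by blast
    also have "\<dots> \<le> D"
      unfolding D_def using G_nn Suc.prems by (intro sum_mono2) auto
    finally have "H.nrm (G (Suc m)) * H.nrm (u (Suc m)) \<le> H.nrm (G (Suc m)) * D"
      using mem by (intro mult_left_mono) auto
    then have "ip (G (Suc m)) (u (Suc m)) \<le> D * H.nrm (G (Suc m))"
      using H.Cauchy_Schwarz[OF mem(4,2)] by (simp add: mult.commute)
    moreover have "2 * ip (u m) (u (Suc m)) \<le> ip (u m) (u m) + ip (u (Suc m)) (u (Suc m))"
      by (rule H.two_le[OF mem(3,2)])
    ultimately show ?case
      using Suc tested_equation[of "Suc m" "u (Suc m)"] mem by (simp add: distrib_left)
  qed (simp add: u_0)
  from this[of M] show ?thesis
    using H.nonneg[OF u_H[of M]] by (simp add: D_def power2_eq_square)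
qed

text \<open>
  Cauchy-Schwarz in time turns the energy estimate into a bound for the time integral of the energy
  norm, which is what the perturbation term of \<open>pointwise_smoothing\<close> requires.
\<close>

lemma sum_sqrt_energy:
  "(\<Sum>i=1..M. step \<tau> i * sqrt (a i (u i) (u i))) \<le> sqrt (\<tau> M - \<tau> 0) * (\<Sum>i=1..M. H.nrm (G i))"
proof -
  define D where "D = (\<Sum>i=1..M. H.nrm (G i))"
  have D: "0 \<le> D" unfolding D_def using G_H by (intro sum_nonneg) auto
  have k: "0 \<le> step \<tau> i" "0 \<le> a i (u i) (u i)" if "i \<in> {1..M}" for i
  proof -
    interpret ai: semi_inner V "a i" by (rule form) (use that in auto)
    show "0 \<le> step \<tau> i" "0 \<le> a i (u i) (u i)"
      using that step_pos[of i] ai.nonneg[OF u_V[of i]] by auto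
  qed
  have tele: "m \<le> M \<Longrightarrow> (\<Sum>i=1..m. step \<tau> i) = \<tau> m - \<tau> 0" for m
    by (induction m) (auto simp: step_def)
  have "(\<Sum>i=1..M. step \<tau> i * sqrt (a i (u i) (u i)))\<^sup>2
      = (\<Sum>i=1..M. sqrt (step \<tau> i) * sqrt (step \<tau> i * a i (u i) (u i)))\<^sup>2"
    using k by (intro arg_cong[where f = "\<lambda>x. x\<^sup>2"] sum.cong) (auto simp: real_sqrt_mult)
  also have "\<dots> \<le> (\<Sum>i=1..M. (sqrt (step \<tau> i))\<^sup>2) * (\<Sum>i=1..M. (sqrt (step \<tau> i * a i (u i) (u i)))\<^sup>2)"
    by (rule Cauchy_Schwarz_ineq_sum)
  also have "\<dots> = (\<tau> M - \<tau> 0) * (\<Sum>i=1..M. step \<tau> i * a i (u i) (u i))"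
    using k tele[of M] by simp
  also have "\<dots> \<le> (\<tau> M - \<tau> 0) * D\<^sup>2"
    using energy_estimate node_less[of 0 M] by (intro mult_left_mono) (cases "M = 0"; auto simp: D_def)+
  finally have "sqrt ((\<Sum>i=1..M. step \<tau> i * sqrt (a i (u i) (u i)))\<^sup>2) \<le> sqrt ((\<tau> M - \<tau> 0) * D\<^sup>2)"
    by (simp only: real_sqrt_le_iff)
  then show ?thesis using D by (simp add: real_sqrt_mult D_def)
qed

text \<open>
  The double sums are exchanged: for fixed \<open>i\<close> the sum over the later steps \<open>m\<close> is the logarithmic or
  the Dini sum, and only then the sum over \<open>i\<close> is estimated by the data.
\<close>

theorem summed_smoothing:
  assumes log: "\<And>i. \<lbrakk>1 \<le> i; i \<le> M\<rbrakk> \<Longrightarrow> (\<Sum>m=i..M. step \<tau> m / (\<tau> m - \<tau> (i - 1))) \<le> \<Lambda>"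
    and dini: "\<And>i. \<lbrakk>1 \<le> i; i \<le> M\<rbrakk> \<Longrightarrow>
      (\<Sum>m=Suc i..M. step \<tau> m * (\<rho> i m / (\<tau> m - \<tau> (i - 1)) powr (3 / 2))) \<le> K"
    and K: "0 \<le> K"
  shows "(\<Sum>m=1..M. step \<tau> m * H.nrm (w m))
    \<le> (\<Lambda> + sqrt (3 + \<kappa>) * K * sqrt (\<tau> M - \<tau> 0)) * (\<Sum>i=1..M. H.nrm (G i))"
proof -
  define D where "D = (\<Sum>i=1..M. H.nrm (G i))"
  define e where "e i = step \<tau> i * sqrt (a i (u i) (u i))" for i
  have e: "0 \<le> e i" if "i \<in> {1..M}" for i
  proof -
    interpret ai: semi_inner V "a i" by (rule form) (use that in auto)
    show ?thesis
      using that step_pos[of i] ai.nonneg[OF u_V[of i]] by (auto simp: e_def)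
  qed
  have "(\<Sum>m=1..M. step \<tau> m * H.nrm (w m))
      \<le> (\<Sum>m=1..M. step \<tau> m * ((\<Sum>i=1..m. H.nrm (G i) / (\<tau> m - \<tau> (i - 1)))
        + sqrt (3 + \<kappa>) * (\<Sum>i=1..<m. e i * (\<rho> i m / (\<tau> m - \<tau> (i - 1)) powr (3 / 2)))))"
    using pointwise_smoothing step_pos unfolding e_def
    by (intro sum_mono mult_left_mono) (auto simp: less_imp_le)
  also have "\<dots> = (\<Sum>m=1..M. \<Sum>i=1..m. H.nrm (G i) * (step \<tau> m / (\<tau> m - \<tau> (i - 1))))
      + sqrt (3 + \<kappa>) * (\<Sum>m=1..M. \<Sum>i=1..<m.
          e i * (step \<tau> m * (\<rho> i m / (\<tau> m - \<tau> (i - 1)) powr (3 / 2))))"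
    by (simp add: distrib_left sum.distrib sum_distrib_left mult_ac)
  also have "(\<Sum>m=1..M. \<Sum>i=1..m. H.nrm (G i) * (step \<tau> m / (\<tau> m - \<tau> (i - 1))))
      = (\<Sum>i=1..M. \<Sum>m=i..M. H.nrm (G i) * (step \<tau> m / (\<tau> m - \<tau> (i - 1))))"
    unfolding sum.Sigma[OF finite_atLeastAtMost ballI[OF finite_atLeastAtMost]]
    by (rule sum.reindex_bij_witness[where i = prod.swap and j = prod.swap]) auto
  also have "(\<Sum>m=1..M. \<Sum>i=1..<m. e i * (step \<tau> m * (\<rho> i m / (\<tau> m - \<tau> (i - 1)) powr (3 / 2))))
      = (\<Sum>i=1..M. \<Sum>m=Suc i..M. e i * (step \<tau> m * (\<rho> i m / (\<tau> m - \<tau> (i - 1)) powr (3 / 2))))"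
    unfolding sum.Sigma[OF finite_atLeastAtMost ballI[OF finite_atLeastLessThan]]
      sum.Sigma[OF finite_atLeastAtMost ballI[OF finite_atLeastAtMost]]
    by (rule sum.reindex_bij_witness[where i = prod.swap and j = prod.swap]) auto
  also have "(\<Sum>i=1..M. \<Sum>m=i..M. H.nrm (G i) * (step \<tau> m / (\<tau> m - \<tau> (i - 1))))
      \<le> (\<Sum>i=1..M. H.nrm (G i) * \<Lambda>)"
    unfolding sum_distrib_left[symmetric]
    using log G_H by (intro sum_mono mult_left_mono) auto
  also have "(\<Sum>i=1..M. \<Sum>m=Suc i..M. e i * (step \<tau> m * (\<rho> i m / (\<tau> m - \<tau> (i - 1)) powr (3 / 2))))
      \<le> (\<Sum>i=1..M. e i * K)"
    unfolding sum_distrib_left[symmetric]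
    using dini e by (intro sum_mono mult_left_mono) auto
  also have "(\<Sum>i=1..M. H.nrm (G i) * \<Lambda>) = D * \<Lambda>" by (simp add: D_def sum_distrib_right)
  also have "(\<Sum>i=1..M. e i * K) = K * (\<Sum>i=1..M. e i)" by (simp add: sum_distrib_left mult.commute)
  also have "K * (\<Sum>i=1..M. e i) \<le> K * (sqrt (\<tau> M - \<tau> 0) * D)"
    using sum_sqrt_energy K unfolding e_def D_def by (intro mult_left_mono) auto
  finally show ?thesis using \<kappa> by (simp add: D_def algebra_simps)
qed

end

section \<open>The space of square integrable functions\<close>

lemma L2D: "u \<in> L2 \<Omega> \<Longrightarrow> u \<in> borel_measurable (lebesgue_on \<Omega>)"
  "u \<in> L2 \<Omega> \<Longrightarrow> integrable (lebesgue_on \<Omega>) (\<lambda>x. (u x)\<^sup>2)"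
  by (auto simp: L2_def)

lemma integrable_L2_mult:
  assumes "u \<in> L2 \<Omega>" "v \<in> L2 \<Omega>"
  shows "integrable (lebesgue_on \<Omega>) (\<lambda>x. u x * v x)"
proof (rule Bochner_Integration.integrable_bound)
  show "integrable (lebesgue_on \<Omega>) (\<lambda>x. (u x)\<^sup>2 + (v x)\<^sup>2)"
    using assms by (intro Bochner_Integration.integrable_add L2D)
  show "(\<lambda>x. u x * v x) \<in> borel_measurable (lebesgue_on \<Omega>)"
    using L2D(1)[OF assms(1)] L2D(1)[OF assms(2)] by simp
  have "\<bar>x * y\<bar> \<le> x\<^sup>2 + y\<^sup>2" for x y :: real
  proof -
    have "0 \<le> \<bar>x\<bar> * \<bar>y\<bar>" "2 * (\<bar>x\<bar> * \<bar>y\<bar>) \<le> x\<^sup>2 + y\<^sup>2"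
      using sum_squares_bound[of "\<bar>x\<bar>" "\<bar>y\<bar>"] by simp_all
    then show ?thesis unfolding abs_mult by linarith
  qed
  then show "AE x in lebesgue_on \<Omega>. norm (u x * v x) \<le> norm ((u x)\<^sup>2 + (v x)\<^sup>2)"
    by (auto intro!: always_eventually)
qed

lemma subspace_L2: "subspace (L2 \<Omega>)" for \<Omega> :: "(real^'d) set"
proof (rule subspaceI)
  show "0 \<in> L2 \<Omega>" by (simp add: L2_def zero_fun_def)
next
  fix u v :: "real^'d \<Rightarrow> real"
  assume uv: "u \<in> L2 \<Omega>" "v \<in> L2 \<Omega>"
  have "integrable (lebesgue_on \<Omega>) (\<lambda>x. (u x)\<^sup>2 + 2 * (u x * v x) + (v x)\<^sup>2)"
    using uv by (intro Bochner_Integration.integrable_add integrable_mult_right integrable_L2_mult L2D)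
  moreover have "(\<lambda>x. u x + v x) \<in> borel_measurable (lebesgue_on \<Omega>)"
    using L2D(1)[OF uv(1)] L2D(1)[OF uv(2)] by simp
  ultimately show "u + v \<in> L2 \<Omega>"
    by (simp add: L2_def plus_fun_def power2_sum algebra_simps)
next
  fix c and u :: "real^'d \<Rightarrow> real"
  assume u: "u \<in> L2 \<Omega>"
  then show "c *\<^sub>R u \<in> L2 \<Omega>"
    by (auto simp: L2_def scaleR_fun_def power_mult_distrib intro!: borel_measurable_times)
qed

global_interpretation L2: semi_inner "L2 \<Omega>" "L2_inner \<Omega>" for \<Omega> :: "(real^'d) set"
proof
  fix u v w :: "real^'d \<Rightarrow> real" and r :: real
  assume u: "u \<in> L2 \<Omega>" and w: "w \<in> L2 \<Omega>"
  show "L2_inner \<Omega> (r *\<^sub>R u) w = r * L2_inner \<Omega> u w"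
    by (simp add: L2_inner_def mult.assoc)
  assume v: "v \<in> L2 \<Omega>"
  show "L2_inner \<Omega> (u + v) w = L2_inner \<Omega> u w + L2_inner \<Omega> v w"
    using u v w by (simp add: L2_inner_def distrib_right integrable_L2_mult)
qed (simp_all add: subspace_L2 L2_inner_def mult.commute)

lemma L2_norm_eq: "L2_norm \<Omega> = L2.nrm \<Omega>"
  by (simp add: fun_eq_iff L2_norm_def L2.nrm_def)

lemma nn_integral_L2:
  assumes "u \<in> L2 \<Omega>"
  shows "(\<integral>\<^sup>+x. ennreal ((u x)\<^sup>2) \<partial>lebesgue_on \<Omega>) = ennreal ((L2_norm \<Omega> u)\<^sup>2)"
  using assms nn_integral_eq_integral[OF L2D(2)[OF assms]]
  by (simp add: L2_norm_eq L2.nrm_sq) (simp add: L2_inner_def power2_eq_square)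

lemma L2I_nn_integral:
  assumes "u \<in> borel_measurable (lebesgue_on \<Omega>)"
    and "(\<integral>\<^sup>+x. ennreal ((u x)\<^sup>2) \<partial>lebesgue_on \<Omega>) < \<infinity>"
  shows "u \<in> L2 \<Omega>"
  using assms by (auto simp: L2_def integrable_iff_bounded)

text \<open>
  The Riesz-Fischer argument: a sufficiently fast Cauchy subsequence converges almost everywhere, and
  Fatou's lemma turns the pointwise limit into a limit in the mean.
\<close>

theorem L2_complete: "semi_inner.complete_form (L2 \<Omega>) (L2_inner \<Omega>)" for \<Omega> :: "(real^'d) set"
  unfolding L2.complete_form_def
proof (intro allI impI, elim conjE)
  fix X :: "nat \<Rightarrow> real^'d \<Rightarrow> real"
  assume X: "\<forall>n. X n \<in> L2 \<Omega>"
    and cauchy: "\<forall>e>0. \<exists>N. \<forall>m\<ge>N. \<forall>n\<ge>N. L2.nrm \<Omega> (X m - X n) < e"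
  let ?M = "lebesgue_on \<Omega>"
  have XL: "X n \<in> L2 \<Omega>" for n using X by blast
  have [measurable]: "X n \<in> borel_measurable ?M" for n using L2D(1)[OF XL] .
  have "\<exists>N. \<forall>m\<ge>N. \<forall>n\<ge>N. L2.nrm \<Omega> (X m - X n) < (1/2) ^ k" for k :: nat
    using cauchy by simp
  then obtain N where N: "\<And>k m n. N k \<le> m \<Longrightarrow> N k \<le> n \<Longrightarrow> L2.nrm \<Omega> (X m - X n) < (1/2) ^ k"
    by metis
  define r where "r k = (\<Sum>j\<le>k. N j)" for k
  have r_ge: "N j \<le> r k" if "j \<le> k" for j k
    unfolding r_def using that by (intro member_le_sum) auto
  define d where "d k = X (r (Suc k)) - X (r k)" for k
  have dL: "d k \<in> L2 \<Omega>" for k using XL by (simp add: d_def)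
  have [measurable]: "d k \<in> borel_measurable ?M" for k using L2D(1)[OF dL] .
  have d_small: "(L2_norm \<Omega> (d k))\<^sup>2 \<le> (1/4) ^ k" for k
  proof -
    have "L2.nrm \<Omega> (d k) \<le> (1/2) ^ k"
      unfolding d_def using N[of k "r (Suc k)" "r k"] r_ge[of k "Suc k"] r_ge[of k k] by simp
    then have "(L2.nrm \<Omega> (d k))\<^sup>2 \<le> ((1/2) ^ k)\<^sup>2"
      using dL by (intro power_mono) auto
    also have "((1/2::real) ^ k)\<^sup>2 = (1/4) ^ k"
      by (simp add: power_mult_distrib[symmetric] power2_eq_square)
    finally show ?thesis by (simp add: L2_norm_eq)
  qed
  \<comment> \<open>The weight \<open>2 ^ k\<close> still leaves a convergent series of integrals, and it forces the increments to
    decay geometrically at almost every point.\<close>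
  have "(\<integral>\<^sup>+x. (\<Sum>k. ennreal (2 ^ k * (d k x)\<^sup>2)) \<partial>?M) = (\<Sum>k. \<integral>\<^sup>+x. ennreal (2 ^ k * (d k x)\<^sup>2) \<partial>?M)"
    by (intro nn_integral_suminf) measurable
  also have "\<dots> \<le> (\<Sum>k. ennreal ((1/2) ^ k))"
  proof (intro suminf_le allI)
    fix k
    have "(\<integral>\<^sup>+x. ennreal (2 ^ k * (d k x)\<^sup>2) \<partial>?M) = ennreal (2 ^ k) * ennreal ((L2_norm \<Omega> (d k))\<^sup>2)"
      by (simp add: ennreal_mult nn_integral_cmult nn_integral_L2[OF dL] del: ennreal_power)
    also have "\<dots> \<le> ennreal (2 ^ k) * ennreal ((1/4) ^ k)"
      using d_small by (intro mult_left_mono ennreal_leI) auto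
    also have "\<dots> = ennreal ((1/2) ^ k)"
      by (simp add: power_mult_distrib[symmetric] flip: ennreal_mult)
    finally show "(\<integral>\<^sup>+x. ennreal (2 ^ k * (d k x)\<^sup>2) \<partial>?M) \<le> ennreal ((1/2) ^ k)" .
  qed auto
  also have "\<dots> = ennreal (\<Sum>k. (1/2) ^ k)"
    by (intro suminf_ennreal2 summable_geometric) auto
  also have "\<dots> < \<infinity>" by simp
  finally have fin: "(\<integral>\<^sup>+x. (\<Sum>k. ennreal (2 ^ k * (d k x)\<^sup>2)) \<partial>?M) \<noteq> \<infinity>" by simp
  have "AE x in ?M. (\<Sum>k. ennreal (2 ^ k * (d k x)\<^sup>2)) \<noteq> \<infinity>"
    by (rule nn_integral_noteq_infinite[OF _ fin]) measurable
  then have conv: "AE x in ?M. convergent (\<lambda>k. X (r k) x)"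
  proof eventually_elim
    case (elim x)
    have "summable (\<lambda>k. 2 ^ k * (d k x)\<^sup>2)"
      using elim by (intro summable_suminf_not_top) auto
    then have "(\<lambda>k. 2 ^ k * (d k x)\<^sup>2) \<longlonglongrightarrow> 0" by (rule summable_LIMSEQ_zero)
    then have "Bseq (\<lambda>k. 2 ^ k * (d k x)\<^sup>2)" by (intro convergent_imp_Bseq convergentI)
    then obtain C where C: "\<And>k. 2 ^ k * (d k x)\<^sup>2 \<le> C" "0 < C"
      by (auto simp: Bseq_def)
    have "\<bar>d k x\<bar> \<le> sqrt C * (1 / sqrt 2) ^ k" for k
    proof -
      have "(d k x)\<^sup>2 \<le> C * (1/2) ^ k" using C(1)[of k] by (simp add: field_simps)
      then have "sqrt ((d k x)\<^sup>2) \<le> sqrt (C * (1/2) ^ k)" by (simp only: real_sqrt_le_iff)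
      then have "\<bar>d k x\<bar> \<le> sqrt (C * (1/2) ^ k)" by (simp only: real_sqrt_abs)
      then show ?thesis by (simp add: real_sqrt_mult real_sqrt_power real_sqrt_divide)
    qed
    then have d_le: "norm (d k x) \<le> sqrt C * (1 / sqrt 2) ^ k" for k by simp
    have geo: "summable (\<lambda>k. sqrt C * (1 / sqrt 2) ^ k)"
      by (intro summable_mult summable_geometric) simp
    have "summable (\<lambda>k. d k x)"
      by (rule summable_comparison_test'[OF geo, of 0]) (rule d_le)
    then have "convergent (\<lambda>n. \<Sum>k<n. d k x)" by (simp add: summable_iff_convergent)
    moreover have "(\<Sum>k<n. d k x) = X (r n) x - X (r 0) x" for n
      by (induction n) (simp_all add: d_def)
    ultimately have "convergent (\<lambda>n. X (r n) x - X (r 0) x)" by simp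
    then show ?case using convergent_add[OF _ convergent_const[of "X (r 0) x"]] by fastforce
  qed
  define u where "u x = lim (\<lambda>k. X (r k) x)" for x
  have [measurable]: "u \<in> borel_measurable ?M"
    unfolding u_def by (rule borel_measurable_lim_metric) measurable
  have fatou: "(\<integral>\<^sup>+x. ennreal (((X n - u) x)\<^sup>2) \<partial>?M) \<le> ennreal (((1/2) ^ j)\<^sup>2)" if "N j \<le> n" for n j
  proof -
    have "(\<integral>\<^sup>+x. ennreal (((X n - u) x)\<^sup>2) \<partial>?M)
        = (\<integral>\<^sup>+x. liminf (\<lambda>k. ennreal (((X n - X (r k)) x)\<^sup>2)) \<partial>?M)"
    proof (rule nn_integral_cong_AE)
      show "AE x in ?M. ennreal (((X n - u) x)\<^sup>2) = liminf (\<lambda>k. ennreal (((X n - X (r k)) x)\<^sup>2))"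
        using conv
      proof eventually_elim
        case (elim x)
        then have "(\<lambda>k. X (r k) x) \<longlonglongrightarrow> u x" by (simp add: u_def convergent_LIMSEQ_iff)
        then have "(\<lambda>k. ennreal (((X n - X (r k)) x)\<^sup>2)) \<longlonglongrightarrow> ennreal (((X n - u) x)\<^sup>2)"
          by (auto intro!: tendsto_intros)
        from lim_imp_Liminf[OF sequentially_bot this] show ?case by (rule sym)
      qed
    qed
    also have "\<dots> \<le> liminf (\<lambda>k. \<integral>\<^sup>+x. ennreal (((X n - X (r k)) x)\<^sup>2) \<partial>?M)"
      by (rule nn_integral_liminf) simp
    also have "\<dots> \<le> liminf (\<lambda>k. ennreal (((1/2) ^ j)\<^sup>2))"
    proof (rule Liminf_mono, rule eventually_sequentiallyI)
      fix k assume "j \<le> k"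
      then have "L2.nrm \<Omega> (X n - X (r k)) \<le> (1/2) ^ j"
        using N[OF that r_ge] by (simp add: less_imp_le)
      then have "(L2.nrm \<Omega> (X n - X (r k)))\<^sup>2 \<le> ((1/2) ^ j)\<^sup>2"
        using XL by (intro power_mono) auto
      then show "(\<integral>\<^sup>+x. ennreal (((X n - X (r k)) x)\<^sup>2) \<partial>?M) \<le> ennreal (((1/2) ^ j)\<^sup>2)"
        using XL by (subst nn_integral_L2) (auto simp: L2_norm_eq intro!: ennreal_leI)
    qed
    finally show ?thesis by (simp add: Liminf_const)
  qed
  have diffL: "X n - u \<in> L2 \<Omega>" if "N j \<le> n" for n j
    using fatou[OF that] by (intro L2I_nn_integral) (auto simp: le_less_trans fun_diff_def)
  have uL: "u \<in> L2 \<Omega>"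
    using L2.mem(4)[OF XL diffL[OF order_refl], of "N 0" 0] by simp
  have le: "L2.nrm \<Omega> (X n - u) \<le> (1/2) ^ j" if "N j \<le> n" for n j
  proof (rule power2_le_imp_le)
    show "(L2.nrm \<Omega> (X n - u))\<^sup>2 \<le> ((1/2) ^ j)\<^sup>2"
      using fatou[OF that] nn_integral_L2[OF diffL[OF that]] by (simp add: L2_norm_eq)
  qed simp
  have "(\<lambda>n. L2.nrm \<Omega> (X n - u)) \<longlonglongrightarrow> 0"
  proof (rule LIMSEQ_I)
    fix e :: real assume "e > 0"
    then obtain j where j: "(1/2) ^ j < e" using real_arch_pow_inv[of e "1/2"] by auto
    have "norm (L2.nrm \<Omega> (X n - u) - 0) < e" if "N j \<le> n" for n
      using le[OF that] j diffL[OF that] by simp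
    then show "\<exists>no. \<forall>n\<ge>no. norm (L2.nrm \<Omega> (X n - u) - 0) < e" by blast
  qed
  then show "\<exists>x\<in>L2 \<Omega>. (\<lambda>n. L2.nrm \<Omega> (X n - x)) \<longlonglongrightarrow> 0" using uL by blast
qed

section \<open>Bump functions and the fundamental lemma\<close>

text \<open>
  The powers in the denominator make the family closed under derivatives, and every member tends to 0
  at the origin faster than any power.
\<close>

definition cutoff :: "nat \<Rightarrow> real \<Rightarrow> real" where
  "cutoff n s = (if s > 0 then exp (- 1 / s) / s ^ n else 0)"

lemma cutoff_tendsto_0: "(cutoff n \<longlongrightarrow> 0) (at 0)"
proof (rule filterlim_split_at)
  show "(cutoff n \<longlongrightarrow> 0) (at_left 0)"
    by (rule tendsto_eventually) (auto simp: cutoff_def eventually_at_filter)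
  have "((\<lambda>s. inverse s ^ n / exp (inverse s)) \<longlongrightarrow> (0::real)) (at_right 0)"
    by (rule filterlim_compose[OF tendsto_power_div_exp_0 filterlim_inverse_at_top_right])
  moreover have "\<forall>\<^sub>F s in at_right 0. inverse s ^ n / exp (inverse s) = cutoff n s"
    by (auto simp: cutoff_def eventually_at_filter field_simps exp_minus)
  ultimately show "(cutoff n \<longlongrightarrow> 0) (at_right 0)"
    by (rule Lim_transform_eventually)
qed

lemma cutoff_has_derivative:
  "(cutoff n has_real_derivative cutoff (n + 2) s - real n * cutoff (n + 1) s) (at s)"
proof -
  consider "s > 0" | "s < 0" | "s = 0" by linarith
  then show ?thesis
  proof cases
    case 1
    have "((\<lambda>s. exp (- 1 / s) / s ^ n) has_real_derivative
        cutoff (n + 2) s - real n * cutoff (n + 1) s) (at s)"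
      using 1 by (auto intro!: derivative_eq_intros simp: cutoff_def field_simps power2_eq_square)
        (cases n; simp add: field_simps)
    then show ?thesis
      by (rule DERIV_cong_ev[THEN iffD1, rotated 3])
        (use 1 in \<open>auto intro!: eventually_mono[OF eventually_gt_at_top] simp: cutoff_def
          eventually_nhds intro: exI[of _ "{0<..}"]\<close>)
  next
    case 2
    have "((\<lambda>s. 0) has_real_derivative cutoff (n + 2) s - real n * cutoff (n + 1) s) (at s)"
      using 2 by (simp add: cutoff_def)
    then show ?thesis
      by (rule DERIV_cong_ev[THEN iffD1, rotated 3])
        (use 2 in \<open>auto simp: cutoff_def eventually_nhds intro!: exI[of _ "{..<0}"]\<close>)
  next
    case 3
    have "((\<lambda>h. (cutoff n (0 + h) - cutoff n 0) / h) \<longlongrightarrow> 0) (at 0)"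
    proof (rule Lim_transform_eventually[OF cutoff_tendsto_0[of "Suc n"]])
      show "\<forall>\<^sub>F h in at 0. cutoff (Suc n) h = (cutoff n (0 + h) - cutoff n 0) / h"
        by (auto simp: eventually_at_filter cutoff_def)
    qed
    then show ?thesis using 3 by (simp add: DERIV_def cutoff_def)
  qed
qed

text \<open>
  A class of functions that contains the bumps below and is closed under partial derivatives,
  so that infinite differentiability needs no separate bookkeeping of orders.
\<close>

inductive_set smooth_funs :: "(real^'d \<Rightarrow> real) set" where
  const: "(\<lambda>x. c) \<in> smooth_funs"
| coord: "(\<lambda>x. x $ i) \<in> smooth_funs"
| add: "\<lbrakk>f \<in> smooth_funs; g \<in> smooth_funs\<rbrakk> \<Longrightarrow> (\<lambda>x. f x + g x) \<in> smooth_funs"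
| mult: "\<lbrakk>f \<in> smooth_funs; g \<in> smooth_funs\<rbrakk> \<Longrightarrow> (\<lambda>x. f x * g x) \<in> smooth_funs"
| cutoff: "f \<in> smooth_funs \<Longrightarrow> (\<lambda>x. cutoff n (f x)) \<in> smooth_funs"

lemma partial_eqI: "(\<phi> has_derivative \<phi>') (at x) \<Longrightarrow> partial i \<phi> x = \<phi>' (axis i 1)"
  unfolding partial_def by (simp add: frechet_derivative_at[symmetric])

lemma partial_mult:
  assumes "f differentiable at x" "g differentiable at x"
  shows "partial i (\<lambda>x. f x * g x) x = f x * partial i g x + partial i f x * g x"
  unfolding partial_def
  by (subst frechet_derivative_at[OF has_derivative_mult, symmetric])
    (use assms frechet_derivative_works in blast, use assms frechet_derivative_works in blast, simp)

lemma partial_add: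
  assumes "f differentiable at x" "g differentiable at x"
  shows "partial i (\<lambda>x. f x + g x) x = partial i f x + partial i g x"
  unfolding partial_def
  by (subst frechet_derivative_at[OF has_derivative_add, symmetric])
    (use assms frechet_derivative_works in blast, use assms frechet_derivative_works in blast, simp)

lemma smooth_funs_partial:
  fixes f :: "real^'d \<Rightarrow> real"
  assumes "f \<in> smooth_funs"
  shows "(\<forall>x. f differentiable at x) \<and> (\<forall>i. partial i f \<in> smooth_funs)"
  using assms
proof induction
  case (const c)
  have "partial i (\<lambda>x :: real^'d. c) = (\<lambda>x. 0)" for i :: 'd
    by (rule ext) (simp add: partial_def)
  then show ?case by (simp add: smooth_funs.const)
next
  case (coord j)
  have d: "((\<lambda>x. x $ j) has_derivative (\<lambda>h. h $ j)) (at x)" for x :: "real^'d"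
    by (rule bounded_linear.has_derivative[OF bounded_linear_vec_nth has_derivative_ident])
  have "partial i (\<lambda>x. x $ j) = (\<lambda>x. axis i 1 $ j)" for i :: 'd
    by (rule ext) (rule partial_eqI[OF d])
  then show ?case using d by (auto simp: differentiable_def intro: smooth_funs.const)
next
  case (add f g)
  then have "partial i (\<lambda>x. f x + g x) = (\<lambda>x. partial i f x + partial i g x)" for i
    by (simp add: fun_eq_iff partial_add)
  then show ?case using add by (auto intro: smooth_funs.add)
next
  case (mult f g)
  then have "partial i (\<lambda>x. f x * g x) = (\<lambda>x. f x * partial i g x + partial i f x * g x)" for i
    by (simp add: fun_eq_iff partial_mult)
  then show ?case using mult by (auto intro!: smooth_funs.add smooth_funs.mult)
next
  case (cutoff f n)
  have d: "((\<lambda>x. cutoff n (f x)) has_derivative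
      (\<lambda>h. frechet_derivative f (at x) h * (cutoff (n + 2) (f x) - real n * cutoff (n + 1) (f x)))) (at x)"
    for x
    by (rule DERIV_compose_FDERIV[OF cutoff_has_derivative])
      (use cutoff frechet_derivative_works in blast)
  have "partial i (\<lambda>x. cutoff n (f x)) =
     (\<lambda>x. partial i f x * (cutoff (n + 2) (f x) - real n * cutoff (n + 1) (f x)))" for i
    using partial_eqI[OF d] by (simp add: fun_eq_iff partial_def)
  moreover have "(\<lambda>x. cutoff (n + 2) (f x) - real n * cutoff (n + 1) (f x)) \<in> smooth_funs"
    using smooth_funs.add[OF smooth_funs.cutoff smooth_funs.mult[OF smooth_funs.const smooth_funs.cutoff],
        of f f "n + 2" "- real n" "n + 1"] cutoff.hyps by simp
  then have "(\<lambda>x. partial i f x * (cutoff (n + 2) (f x) - real n * cutoff (n + 1) (f x))) \<in> smooth_funs" for i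
    by (rule smooth_funs.mult[rotated]) (use cutoff.IH in blast)
  ultimately have "partial i (\<lambda>x. cutoff n (f x)) \<in> smooth_funs" for i by simp
  then show ?case using d by (auto simp: differentiable_def)
qed

lemma smooth_funs_C_k: "f \<in> smooth_funs \<Longrightarrow> C_k n f"
proof (induction n arbitrary: f)
  case 0
  then show ?case
    using smooth_funs_partial
    by (auto simp: continuous_on_eq_continuous_at intro: differentiable_imp_continuous_within)
next
  case (Suc n)
  then show ?case
    using smooth_funs_partial by (auto simp: differentiable_on_def)
qed

lemma smooth_funs_prod:
  "finite I \<Longrightarrow> (\<And>i. i \<in> I \<Longrightarrow> f i \<in> smooth_funs) \<Longrightarrow> (\<lambda>x. \<Prod>i\<in>I. f i x) \<in> smooth_funs"
  by (induction I rule: finite_induct) (auto intro: smooth_funs.const smooth_funs.mult)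

text \<open>
  As \<open>N\<close> grows, these functions converge to the indicator of the box, with values in \<open>{0..1}\<close>.
\<close>

definition bump :: "nat \<Rightarrow> real^'d \<Rightarrow> real^'d \<Rightarrow> real^'d \<Rightarrow> real" where
  "bump N a b x = (\<Prod>i\<in>UNIV. cutoff 0 (real N * (x $ i - a $ i)) * cutoff 0 (real N * (b $ i - x $ i)))"

lemma cutoff_0_bounds: "0 \<le> cutoff 0 s" "cutoff 0 s \<le> 1" "s \<le> 0 \<Longrightarrow> cutoff 0 s = 0"
  by (auto simp: cutoff_def)

lemma bump_bounds: "0 \<le> bump N a b x" "bump N a b x \<le> 1"
  unfolding bump_def
  by (auto intro!: prod_nonneg prod_le_1 mult_nonneg_nonneg mult_le_one cutoff_0_bounds(1,2))

lemma bump_outside: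
  fixes a b x :: "real^'d"
  assumes "x \<notin> box a b"
  shows "bump N a b x = 0"
proof -
  obtain i where "x $ i \<le> a $ i \<or> b $ i \<le> x $ i"
    using assms by (auto simp: mem_box_cart not_less)
  then have "cutoff 0 (real N * (x $ i - a $ i)) * cutoff 0 (real N * (b $ i - x $ i)) = 0"
    by (auto simp: cutoff_0_bounds(3) mult_nonneg_nonpos)
  then show ?thesis unfolding bump_def by (intro prod_zero) auto
qed

lemma bump_test_function:
  fixes a b :: "real^'d"
  assumes "cbox a b \<subseteq> \<Omega>"
  shows "bump N a b \<in> test_functions \<Omega>"
proof -
  have "(\<lambda>x. x $ i - a $ i) \<in> smooth_funs" "(\<lambda>x. b $ i - x $ i) \<in> smooth_funs" for i :: 'd
    using smooth_funs.add[OF smooth_funs.coord[of i] smooth_funs.const[of "- a $ i"]]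
      smooth_funs.add[OF smooth_funs.const[of "b $ i"]
        smooth_funs.mult[OF smooth_funs.const[of "-1"] smooth_funs.coord[of i]]] by simp_all
  then have "bump N a b \<in> smooth_funs"
    unfolding bump_def
    by (intro smooth_funs_prod smooth_funs.mult smooth_funs.cutoff smooth_funs.const) auto
  moreover have "closure {x. bump N a b x \<noteq> 0} \<subseteq> cbox a b"
    using bump_outside[of _ a b N] box_subset_cbox by (intro closure_minimal) auto
  ultimately show ?thesis
    using assms bounded_subset[OF bounded_cbox]
    by (auto simp: test_functions_def smooth_funs_C_k compact_eq_bounded_closed)
qed

lemma bump_tendsto_indicator:
  fixes a b :: "real^'d"
  shows "(\<lambda>N. bump N a b x) \<longlonglongrightarrow> indicator (box a b) x"
proof (cases "x \<in> box a b")
  case True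
  have "(\<lambda>N. cutoff 0 (real N * s)) \<longlonglongrightarrow> 1" if "s > 0" for s
  proof -
    have "(\<lambda>N. exp (- (1 / s) * (1 / real N))) \<longlonglongrightarrow> exp (- (1 / s) * 0)"
      by (intro tendsto_intros lim_1_over_n)
    moreover have "\<forall>\<^sub>F N in sequentially. exp (- (1 / s) * (1 / real N)) = cutoff 0 (real N * s)"
      using eventually_gt_at_top[of 0] by eventually_elim (use that in \<open>simp add: cutoff_def field_simps\<close>)
    ultimately show ?thesis by (simp add: Lim_transform_eventually)
  qed
  then have "(\<lambda>N. bump N a b x) \<longlonglongrightarrow> (\<Prod>i\<in>(UNIV::'d set). 1 * 1)"
    unfolding bump_def using True by (intro tendsto_prod tendsto_mult) (auto simp: mem_box_cart)
  then show ?thesis using True by simp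
qed (simp add: bump_outside)

text \<open>
  Bumps approximate the indicator of a box, so the integral of \<open>g\<close> over every closed box inside \<open>\<Omega>\<close>
  and over its intersections with open boxes vanishes. Open boxes generate the Borel sets and are
  stable under intersections, hence \<open>g\<close> has integral zero over all Borel subsets of the closed box.
\<close>

theorem fundamental_lemma_test_functions:
  fixes \<Omega> :: "(real^'d) set"
  assumes \<Omega>: "open \<Omega>" and g: "g \<in> L2 \<Omega>"
    and orth: "\<And>\<phi>. \<phi> \<in> test_functions \<Omega> \<Longrightarrow> L2_inner \<Omega> g \<phi> = 0"
  shows "AE x in lebesgue_on \<Omega>. g x = 0"
proof -
  have [measurable]: "\<Omega> \<in> sets lebesgue" using \<Omega> by auto
  have box_zero: "AE x in lborel. x \<in> cbox a b \<longrightarrow> g x = 0" if ab: "cbox a b \<subseteq> \<Omega>" for a b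
  proof -
    define G where "G x = (if x \<in> cbox a b then g x else 0)" for x
    have "(\<lambda>x. if x \<in> \<Omega> then g x else 0) \<in> borel_measurable lebesgue"
      using L2D(1)[OF g] by (simp add: borel_measurable_if)
    then have "(\<lambda>x. indicator (cbox a b) x * (if x \<in> \<Omega> then g x else 0)) \<in> borel_measurable lebesgue"
      by (intro borel_measurable_times borel_measurable_indicator) auto
    moreover have "(\<lambda>x. indicator (cbox a b) x * (if x \<in> \<Omega> then g x else 0)) = G"
      using ab by (auto simp: G_def fun_eq_iff indicator_def)
    ultimately have Gm: "G \<in> borel_measurable lebesgue" by simp
    have "integrable lebesgue (\<lambda>x. if x \<in> \<Omega> then (g x)\<^sup>2 else 0)"
      using L2D(2)[OF g] by (simp add: Lebesgue_Measure.integrable_restrict_UNIV)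
    moreover have "integrable lebesgue (indicator (cbox a b) :: _ \<Rightarrow> real)"
      by (rule integrable_real_indicator) (use lmeasurable_cbox[of a b] in \<open>auto simp: fmeasurable_def\<close>)
    ultimately have dom: "integrable lebesgue (\<lambda>x. indicator (cbox a b) x + (if x \<in> \<Omega> then (g x)\<^sup>2 else 0))"
      by (rule Bochner_Integration.integrable_add[rotated])
    have abs_le: "\<bar>t\<bar> \<le> 1 + t\<^sup>2" for t :: real
      using sum_squares_bound[of "\<bar>t\<bar>" 1] by simp
    have Gi: "integrable lebesgue G"
      by (rule Bochner_Integration.integrable_bound[OF dom Gm])
        (use ab abs_le in \<open>auto simp: G_def indicator_def intro!: always_eventually\<close>)
    \<comment> \<open>A Borel version of \<open>G\<close>: the generator argument below reaches Borel sets only.\<close>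
    obtain H where H: "H \<in> borel_measurable lborel" and GH: "AE x in lborel. G x = H x"
      using completion_ex_borel_measurable_real[OF Gm] by blast
    have GH': "AE x in lebesgue. G x = H x" using GH by (rule AE_completion)
    have "integrable lebesgue H"
      using Gi integrable_cong_AE[OF Gm measurable_completion[OF H] GH'] by simp
    then have Hi: "integrable lborel H" using H by (simp add: integrable_completion)
    have H_box: "(LINT x:box c d|lborel. H x) = 0" for c d
    proof -
      obtain c' d' where cd: "box a b \<inter> box c d = box c' d'" using box_Int_box by blast
      have sub: "cbox c' d' \<subseteq> \<Omega>" if "box c' d' \<noteq> {}"
      proof -
        have "closure (box c' d') \<subseteq> cbox a b"
          using cd box_subset_cbox[of a b] by (intro closure_minimal) auto
        then show ?thesis using ab that by (simp add: closure_box)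
      qed
      have "(\<integral>x. indicator (box c' d') x * G x \<partial>lebesgue) = 0"
      proof (cases "box c' d' = {}")
        case False
        have "(\<lambda>N. \<integral>x. bump N c' d' x * G x \<partial>lebesgue) \<longlonglongrightarrow> (\<integral>x. indicator (box c' d') x * G x \<partial>lebesgue)"
        proof (rule integral_dominated_convergence[where w = "\<lambda>x. \<bar>G x\<bar>"])
          show "integrable lebesgue (\<lambda>x. \<bar>G x\<bar>)" using Gi by simp
          show "(\<lambda>x. indicator (box c' d') x * G x) \<in> borel_measurable lebesgue"
            using Gm by (intro borel_measurable_times borel_measurable_indicator) auto
          have "bump N c' d' \<in> borel_measurable borel" for N
            using bump_test_function[OF sub[OF False], of N]
            by (intro borel_measurable_continuous_onI) (auto simp: test_functions_def dest: spec[of _ 0])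
          then show "(\<lambda>x. bump N c' d' x * G x) \<in> borel_measurable lebesgue" for N
            by (intro borel_measurable_times[OF measurable_completion Gm]) simp
          show "AE x in lebesgue. (\<lambda>N. bump N c' d' x * G x) \<longlonglongrightarrow> indicator (box c' d') x * G x"
            by (intro always_eventually allI tendsto_intros bump_tendsto_indicator)
          show "AE x in lebesgue. norm (bump N c' d' x * G x) \<le> \<bar>G x\<bar>" for N
            using bump_bounds[of N c' d']
            by (intro always_eventually allI) (auto simp: abs_mult intro!: mult_left_le_one_le)
        qed
        moreover have "(\<integral>x. bump N c' d' x * G x \<partial>lebesgue) = 0" for N
        proof -
          have "bump N c' d' x * G x = (if x \<in> \<Omega> then g x * bump N c' d' x else 0)" for x
            using ab cd bump_outside[of x c' d' N] box_subset_cbox[of a b] by (auto simp: G_def)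
          then have "(\<integral>x. bump N c' d' x * G x \<partial>lebesgue) = L2_inner \<Omega> g (bump N c' d')"
            by (simp add: L2_inner_def Lebesgue_Measure.integral_restrict_UNIV)
          then show ?thesis using orth[OF bump_test_function[OF sub[OF False]]] by simp
        qed
        ultimately show ?thesis by (simp add: LIMSEQ_const_iff)
      qed simp
      also have "(\<integral>x. indicator (box c' d') x * G x \<partial>lebesgue) = (\<integral>x. indicator (box c d) x * H x \<partial>lebesgue)"
      proof (rule integral_cong_AE)
        have "AE x in lebesgue. x \<notin> cbox a b - box a b"
          using null_sets_cbox_Diff_box[of a b] by (intro AE_completion AE_not_in)
        then show "AE x in lebesgue. indicator (box c' d') x * G x = indicator (box c d) x * H x"
          using GH' by eventually_elim (auto simp: cd[symmetric] indicator_def G_def)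
      qed (use Gm measurable_completion[OF H] in
          \<open>auto intro!: borel_measurable_times borel_measurable_indicator\<close>)
      finally show ?thesis
        using H by (simp add: set_lebesgue_integral_def integral_completion)
    qed
    have H_int: "set_integrable lborel A H" if "A \<in> sets borel" for A
      unfolding set_integrable_def using that Hi by (intro integrable_mult_indicator) auto
    have H_set: "(LINT x:A|lborel. H x) = 0" if "A \<in> sets borel" for A
    proof -
      have "Int_stable (range (\<lambda>(c, d). box c d :: (real^'d) set))"
        by (auto simp: Int_stable_def box_Int_box)
      moreover have "range (\<lambda>(c, d). box c d :: (real^'d) set) \<subseteq> Pow UNIV" by simp
      moreover have "A \<in> sigma_sets UNIV (range (\<lambda>(c, d). box c d))"
        using that by (simp add: borel_eq_box)
      ultimately show ?thesis
      proof (induction rule: sigma_sets_induct_disjoint[consumes 3])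
        case (basic A)
        then show ?case using H_box by auto
      next
        case empty
        then show ?case by (simp add: set_lebesgue_integral_def)
      next
        case (compl A)
        have [measurable]: "A \<in> sets borel" using compl(1) by (simp add: borel_eq_box)
        define B :: "nat \<Rightarrow> (real^'d) set" where "B n = box (- (real n *\<^sub>R One)) (real n *\<^sub>R One)" for n
        have B_UN: "(\<Union>n. B n) = UNIV" unfolding B_def by (rule UN_box_eq_UNIV)
        have B_sets: "B n \<in> sets lborel" for n by (simp add: B_def)
        have "incseq B"
          unfolding incseq_def B_def by (auto simp: subset_box)
        then have "(\<lambda>n. LINT x:B n|lborel. H x) \<longlonglongrightarrow> (LINT x:(\<Union>n. B n)|lborel. H x)"
          using Hi B_sets by (intro set_integral_cont_up) (simp_all add: B_UN set_integrable_def)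
        then have "(LINT x:UNIV|lborel. H x) = 0"
          unfolding B_UN unfolding B_def by (simp add: H_box LIMSEQ_const_iff)
        moreover have "(LINT x:UNIV|lborel. H x) = (LINT x:UNIV - A|lborel. H x) + (LINT x:A|lborel. H x)"
          using Hi by (subst set_integral_Un[symmetric])
            (auto intro!: H_int)
        ultimately show ?case using compl by simp
      next
        case (union A)
        have [measurable]: "A i \<in> sets borel" for i using union(2) by (auto simp: borel_eq_box)
        have "(LINT x:(\<Union>i. A i)|lborel. H x) = (\<Sum>i. LINT x:A i|lborel. H x)"
          using union(1) Hi
          by (intro lebesgue_integral_countable_add)
            (auto simp: disjoint_family_on_def intro!: H_int)
        then show ?case using union by simp
      qed
    qed
    have "AE x in lborel. H x = 0"
      by (rule density_unique_real[OF Hi, of "\<lambda>_. 0"]) (auto simp: H_set)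
    with GH show ?thesis by eventually_elim (auto simp: G_def split: if_splits)
  qed
  obtain \<D> where \<D>: "countable \<D>" "\<D> \<subseteq> Pow \<Omega>" "\<And>X. X \<in> \<D> \<Longrightarrow> \<exists>a b. X = cbox a b" "\<Union>\<D> = \<Omega>"
    using open_countable_Union_open_cbox[OF \<Omega>] by blast
  have "AE x in lborel. \<forall>X\<in>\<D>. x \<in> X \<longrightarrow> g x = 0"
    unfolding AE_ball_countable[OF \<D>(1)]
  proof
    fix X assume X: "X \<in> \<D>"
    then obtain a b where "X = cbox a b" using \<D> by blast
    then show "AE x in lborel. x \<in> X \<longrightarrow> g x = 0" using box_zero[of a b] X \<D>(2) by auto
  qed
  then have "AE x in lborel. x \<in> \<Omega> \<longrightarrow> g x = 0"
    by eventually_elim (use \<D>(4) in auto)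
  then have "AE x in lebesgue. x \<in> \<Omega> \<longrightarrow> g x = 0" by (rule AE_completion)
  then show ?thesis by (simp add: AE_restrict_space_iff)
qed

section \<open>Test functions and integration by parts\<close>

lemma C_k_add: "C_k n f \<Longrightarrow> C_k n g \<Longrightarrow> C_k n (\<lambda>x. f x + g x)"
proof (induction n arbitrary: f g)
  case (Suc n)
  have "partial i (\<lambda>x. f x + g x) = (\<lambda>x. partial i f x + partial i g x)" for i
    using Suc.prems by (simp add: fun_eq_iff partial_add differentiable_on_def)
  then show ?case using Suc by (auto intro: differentiable_on_add)
qed (auto intro: continuous_on_add)

lemma partial_cmult:
  assumes "f differentiable at x"
  shows "partial i (\<lambda>x. c * f x) x = c * partial i f x"
  using partial_mult[of "\<lambda>x. c" x f i] assms by (simp add: partial_def)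

lemma C_k_cmult: "C_k n f \<Longrightarrow> C_k n (\<lambda>x. c * f x)"
proof (induction n arbitrary: f)
  case (Suc n)
  have "partial i (\<lambda>x. c * f x) = (\<lambda>x. c * partial i f x)" for i
    using Suc.prems by (simp add: fun_eq_iff partial_cmult differentiable_on_def)
  then show ?case using Suc by (auto intro: differentiable_on_mult)
qed (auto intro: continuous_on_mult)

lemma test_functionsI:
  assumes "\<And>n. C_k n \<phi>" "compact K" "K \<subseteq> \<Omega>" "\<And>x. x \<notin> K \<Longrightarrow> \<phi> x = 0"
  shows "\<phi> \<in> test_functions \<Omega>"
proof -
  have sub: "closure {x. \<phi> x \<noteq> 0} \<subseteq> K"
    using assms(4) compact_imp_closed[OF assms(2)] by (intro closure_minimal) auto
  then have "compact (closure {x. \<phi> x \<noteq> 0})"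
    using bounded_subset[OF compact_imp_bounded[OF assms(2)]] by (simp add: compact_eq_bounded_closed)
  then show ?thesis using sub assms by (auto simp: test_functions_def)
qed

lemma test_functionsE:
  assumes "\<phi> \<in> test_functions \<Omega>"
  obtains K where "\<And>n. C_k n \<phi>" "compact K" "K \<subseteq> \<Omega>" "\<And>x. x \<notin> K \<Longrightarrow> \<phi> x = 0"
proof (rule that[of "closure {x. \<phi> x \<noteq> 0}"])
  show "\<phi> x = 0" if "x \<notin> closure {x. \<phi> x \<noteq> 0}" for x
    using that closure_subset[of "{x. \<phi> x \<noteq> 0}"] by blast
qed (use assms in \<open>auto simp: test_functions_def\<close>)

lemma subspace_test_functions: "subspace (test_functions \<Omega>)" for \<Omega> :: "(real^'d) set"
proof (rule subspaceI)
  have "C_k n (\<lambda>x :: real^'d. 0 :: real)" for n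
    using smooth_funs_C_k[OF smooth_funs.const] .
  then show "0 \<in> test_functions \<Omega>"
    by (auto simp: zero_fun_def intro!: test_functionsI[of _ "{}"])
next
  fix \<phi> \<psi> :: "real^'d \<Rightarrow> real"
  assume "\<phi> \<in> test_functions \<Omega>" "\<psi> \<in> test_functions \<Omega>"
  then obtain K L where "\<And>n. C_k n \<phi>" "compact K" "K \<subseteq> \<Omega>" "\<And>x. x \<notin> K \<Longrightarrow> \<phi> x = 0"
    "\<And>n. C_k n \<psi>" "compact L" "L \<subseteq> \<Omega>" "\<And>x. x \<notin> L \<Longrightarrow> \<psi> x = 0"
    by (metis test_functionsE)
  then show "\<phi> + \<psi> \<in> test_functions \<Omega>"
    by (intro test_functionsI[of _ "K \<union> L"]) (auto simp: plus_fun_def C_k_add)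
next
  fix c and \<phi> :: "real^'d \<Rightarrow> real"
  assume "\<phi> \<in> test_functions \<Omega>"
  then obtain K where "\<And>n. C_k n \<phi>" "compact K" "K \<subseteq> \<Omega>" "\<And>x. x \<notin> K \<Longrightarrow> \<phi> x = 0"
    by (metis test_functionsE)
  then show "c *\<^sub>R \<phi> \<in> test_functions \<Omega>"
    by (intro test_functionsI[of _ K]) (auto simp: scaleR_fun_def C_k_cmult)
qed

lemma partial_outside:
  assumes "closed K" "\<And>x. x \<notin> K \<Longrightarrow> \<phi> x = 0" "x \<notin> K"
  shows "partial i \<phi> x = 0"
proof -
  have "((\<lambda>x. 0) has_derivative (\<lambda>h. 0)) (at x)" by simp
  then have "(\<phi> has_derivative (\<lambda>h. 0)) (at x)"
    by (rule has_derivative_transform_within_open[where s = "- K"]) (use assms in auto)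
  then show ?thesis by (rule partial_eqI)
qed

lemma continuous_compact_support_bounded:
  fixes f :: "real^'d \<Rightarrow> real"
  assumes "continuous_on UNIV f" "compact K" "\<And>x. x \<notin> K \<Longrightarrow> f x = 0"
  obtains B where "B > 0" "\<And>x. \<bar>f x\<bar> \<le> B"
proof -
  have "bounded (f ` K)"
    using assms continuous_on_subset by (blast intro: compact_imp_bounded compact_continuous_image)
  then obtain B where B: "B > 0" "\<And>x. x \<in> K \<Longrightarrow> \<bar>f x\<bar> \<le> B" by (auto simp: bounded_pos)
  have "\<bar>f x\<bar> \<le> B" for x using B assms(3)[of x] by (cases "x \<in> K") auto
  then show ?thesis using that B by blast
qed

lemma continuous_compact_support_integrable:
  fixes f :: "real^'d \<Rightarrow> real"
  assumes "continuous_on UNIV f" "compact K" "\<And>x. x \<notin> K \<Longrightarrow> f x = 0"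
  shows "integrable lborel f"
proof -
  obtain B where B: "B > 0" "\<And>x. \<bar>f x\<bar> \<le> B" using continuous_compact_support_bounded assms by blast
  show ?thesis
  proof (rule Bochner_Integration.integrable_bound)
    have "integrable lborel (indicator K :: _ \<Rightarrow> real)"
      using assms(2) by (intro integrable_real_indicator) (use emeasure_bounded_finite[of K] in \<open>auto simp: compact_imp_bounded compact_imp_closed\<close>)
    then show "integrable lborel (\<lambda>x. B * indicator K x)" by simp
    show "f \<in> borel_measurable lborel"
      using borel_measurable_continuous_onI[OF assms(1)] by simp
    show "AE x in lborel. norm (f x) \<le> norm (B * indicator K x)"
      using B assms(3) by (auto intro!: always_eventually simp: indicator_def)
  qed
qed

lemma continuous_compact_support_L2:
  fixes f :: "real^'d \<Rightarrow> real"
  assumes "open \<Omega>" "continuous_on UNIV f" "compact K" "\<And>x. x \<notin> K \<Longrightarrow> f x = 0"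
  shows "f \<in> L2 \<Omega>"
proof -
  have "f \<in> borel_measurable lebesgue"
    using borel_measurable_continuous_onI[OF assms(2)] by (intro measurable_completion) simp
  then have "f \<in> borel_measurable (lebesgue_on \<Omega>)" by (rule measurable_restrict_space1)
  moreover have "integrable lborel (\<lambda>x. (f x)\<^sup>2)"
    by (rule continuous_compact_support_integrable[of _ K])
      (use assms in \<open>auto intro!: continuous_intros\<close>)
  then have "integrable lebesgue (\<lambda>x. (f x)\<^sup>2)"
    using borel_measurable_continuous_onI[OF assms(2)] by (subst integrable_completion) auto
  then have "integrable (lebesgue_on \<Omega>) (\<lambda>x. (f x)\<^sup>2)"
    using assms(1) integrable_mult_indicator[of \<Omega> lebesgue "\<lambda>x. (f x)\<^sup>2"]
    by (subst integrable_restrict_space) auto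
  ultimately show ?thesis by (simp add: L2_def)
qed

lemma test_functions_C1:
  assumes "\<phi> \<in> test_functions \<Omega>"
  shows "\<phi> differentiable at x" "continuous_on UNIV \<phi>" "continuous_on UNIV (partial i \<phi>)"
  using assms unfolding test_functions_def
  by (auto simp: differentiable_on_def dest: spec[of _ 0] spec[of _ "Suc 0"])

lemma test_functions_L2:
  assumes "open \<Omega>" "\<phi> \<in> test_functions \<Omega>"
  shows "\<phi> \<in> L2 \<Omega>" "partial i \<phi> \<in> L2 \<Omega>"
proof -
  obtain K where K: "compact K" "\<And>x. x \<notin> K \<Longrightarrow> \<phi> x = 0"
    using assms(2) by (metis test_functionsE)
  show "\<phi> \<in> L2 \<Omega>" "partial i \<phi> \<in> L2 \<Omega>"
    using K partial_outside[of K \<phi>] assms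
    by (auto intro!: continuous_compact_support_L2[of \<Omega> _ K] test_functions_C1 simp: compact_imp_closed)
qed

text \<open>
  The difference quotients of \<open>F\<close> have integral zero by translation invariance, and they converge
  boundedly to the partial derivative.
\<close>

lemma integral_partial_eq_0:
  fixes F :: "real^'d \<Rightarrow> real"
  assumes diff: "\<And>x. F differentiable at x" and cont: "continuous_on UNIV (partial i F)"
    and K: "compact K" "\<And>x. x \<notin> K \<Longrightarrow> F x = 0"
  shows "(\<integral>x. partial i F x \<partial>lborel) = 0"
proof -
  define e :: "real^'d" where "e = axis i 1"
  define h where "h n = 1 / real (Suc n)" for n
  define D where "D n x = (F (h n *\<^sub>R e + x) - F x) / h n" for n x
  have F_cont: "continuous_on UNIV F"
    using diff by (auto simp: continuous_on_eq_continuous_at intro: differentiable_imp_continuous_within)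
  have F_int: "integrable lborel F" by (rule continuous_compact_support_integrable[OF F_cont K])
  have line: "((\<lambda>t. F (t *\<^sub>R e + x)) has_real_derivative partial i F (t *\<^sub>R e + x)) (at t)" for x t
  proof -
    have "(F has_derivative frechet_derivative F (at (t *\<^sub>R e + x))) (at (t *\<^sub>R e + x))"
      using diff frechet_derivative_works by blast
    moreover have "((\<lambda>t. t *\<^sub>R e + x) has_derivative (\<lambda>s. s *\<^sub>R e)) (at t)"
      by (auto intro!: derivative_eq_intros)
    ultimately have "((\<lambda>t. F (t *\<^sub>R e + x)) has_derivative
        (\<lambda>s. frechet_derivative F (at (t *\<^sub>R e + x)) (s *\<^sub>R e))) (at t)"
      by (rule has_derivative_compose[rotated])
    moreover have "frechet_derivative F (at (t *\<^sub>R e + x)) (s *\<^sub>R e) = partial i F (t *\<^sub>R e + x) * s" for s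
      using linear_frechet_derivative[OF diff[of "t *\<^sub>R e + x"]] linear_scale
      by (simp add: partial_def e_def linear_scale)
    ultimately show ?thesis by (simp add: has_field_derivative_def)
  qed
  have dK: "partial i F x = 0" if "x \<notin> K" for x
    using partial_outside[of K F] K compact_imp_closed that by blast
  obtain B where B: "B > 0" "\<And>x. \<bar>partial i F x\<bar> \<le> B"
    using continuous_compact_support_bounded[OF cont K(1) dK] by blast
  obtain r where r: "K \<subseteq> cball 0 r"
    using compact_imp_bounded[OF K(1)] by (auto simp: bounded_pos subset_iff)
  have h: "0 < h n" "h n \<le> 1" for n by (auto simp: h_def)
  have D_le: "\<bar>D n x\<bar> \<le> B * indicator (cball 0 (r + 1)) x" for n x
  proof (cases "x \<in> cball 0 (r + 1)")
    case True
    obtain z where z: "F (h n *\<^sub>R e + x) - F (0 *\<^sub>R e + x) = (h n - 0) * partial i F (z *\<^sub>R e + x)"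
      using MVT2[of 0 "h n" "\<lambda>t. F (t *\<^sub>R e + x)" "\<lambda>t. partial i F (t *\<^sub>R e + x)"] line h by blast
    then have "D n x = partial i F (z *\<^sub>R e + x)" using h[of n] by (simp add: D_def)
    then show ?thesis using B True by simp
  next
    case False
    have "norm (h n *\<^sub>R e) \<le> 1" using h[of n] by (simp add: e_def)
    moreover have "norm x \<le> norm (h n *\<^sub>R e + x) + norm (h n *\<^sub>R e)"
      using norm_triangle_ineq4[of "h n *\<^sub>R e + x" "h n *\<^sub>R e"] by simp
    ultimately have "h n *\<^sub>R e + x \<notin> K" "x \<notin> K" using False r by auto
    then show ?thesis using K(2) False by (simp add: D_def)
  qed
  have "(\<lambda>n. \<integral>x. D n x \<partial>lborel) \<longlonglongrightarrow> (\<integral>x. partial i F x \<partial>lborel)"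
  proof (rule integral_dominated_convergence[where w = "\<lambda>x. B * indicator (cball 0 (r + 1)) x"])
    show "partial i F \<in> borel_measurable lborel"
      using borel_measurable_continuous_onI[OF cont] by simp
    have [measurable]: "F \<in> borel_measurable borel" by (rule borel_measurable_continuous_onI[OF F_cont])
    show "D n \<in> borel_measurable lborel" for n unfolding D_def by measurable
    have "integrable lborel (indicator (cball (0::real^'d) (r + 1)) :: _ \<Rightarrow> real)"
      by (intro integrable_real_indicator)
        (use emeasure_bounded_finite[of "cball (0::real^'d) (r + 1)"] in auto)
    then show "integrable lborel (\<lambda>x :: real^'d. B * indicator (cball 0 (r + 1)) x)" by simp
    show "AE x in lborel. (\<lambda>n. D n x) \<longlonglongrightarrow> partial i F x"
    proof (rule always_eventually, rule allI)
      fix x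
      have "((\<lambda>t. (F ((0 + t) *\<^sub>R e + x) - F (0 *\<^sub>R e + x)) / t) \<longlongrightarrow> partial i F (0 *\<^sub>R e + x)) (at 0)"
        using line[of x 0] by (simp only: DERIV_def)
      moreover have "filterlim h (at 0) sequentially"
      proof -
        have "h = (\<lambda>n. 1 / real (Suc n))" by (simp add: h_def fun_eq_iff)
        then have "h \<longlonglongrightarrow> 0" using LIMSEQ_Suc[OF lim_1_over_n[where 'a = real]] by simp
        then show ?thesis unfolding filterlim_at using h by (auto intro!: always_eventually simp: less_imp_neq[symmetric])
      qed
      ultimately show "(\<lambda>n. D n x) \<longlonglongrightarrow> partial i F x"
        unfolding D_def by (auto dest: filterlim_compose)
    qed
    show "AE x in lborel. norm (D n x) \<le> B * indicator (cball 0 (r + 1)) x" for n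
      using D_le by simp
  qed
  moreover have "(\<integral>x. D n x \<partial>lborel) = 0" for n
  proof -
    have Fm: "F \<in> borel_measurable borel" by (rule borel_measurable_continuous_onI[OF F_cont])
    have "(\<integral>x. F (h n *\<^sub>R e + x) \<partial>lborel) = (\<integral>x. F x \<partial>distr lborel borel ((+) (h n *\<^sub>R e)))"
      using Fm by (subst integral_distr) auto
    moreover have "integrable (distr lborel borel ((+) (h n *\<^sub>R e))) F"
      using F_int by (simp add: lborel_distr_plus)
    then have "integrable lborel (\<lambda>x. F (h n *\<^sub>R e + x))"
      using Fm by (subst (asm) integrable_distr_eq) auto
    ultimately show ?thesis
      using F_int by (simp add: D_def lborel_distr_plus)
  qed
  ultimately show ?thesis by (simp add: LIMSEQ_const_iff)
qed

lemma test_function_weak_partial: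
  fixes \<Omega> :: "(real^'d) set"
  assumes \<Omega>: "open \<Omega>" and \<phi>: "\<phi> \<in> test_functions \<Omega>"
  shows "has_weak_partial \<Omega> i \<phi> (partial i \<phi>)"
  unfolding has_weak_partial_def
proof (intro conjI ballI)
  show "partial i \<phi> \<in> L2 \<Omega>" by (rule test_functions_L2[OF \<Omega> \<phi>])
next
  fix \<psi> assume \<psi>: "\<psi> \<in> test_functions \<Omega>"
  obtain K where K: "compact K" "K \<subseteq> \<Omega>" "\<And>x. x \<notin> K \<Longrightarrow> \<phi> x = 0"
    using \<phi> by (metis test_functionsE)
  have dK: "partial i \<phi> x = 0" if "x \<notin> K" for x
    using partial_outside[of K \<phi>] K compact_imp_closed that by blast
  note C1 = test_functions_C1[OF \<phi>] test_functions_C1[OF \<psi>]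
  have p: "partial i (\<lambda>x. \<phi> x * \<psi> x) = (\<lambda>x. \<phi> x * partial i \<psi> x + partial i \<phi> x * \<psi> x)"
    using C1 by (simp add: fun_eq_iff partial_mult)
  have to_lborel: "L2_inner \<Omega> f g = (\<integral>x. f x * g x \<partial>lborel)"
    if "continuous_on UNIV f" "continuous_on UNIV g" "\<And>x. x \<notin> K \<Longrightarrow> f x = 0" for f g :: "real^'d \<Rightarrow> real"
  proof -
    have "(\<lambda>x. if x \<in> \<Omega> then f x * g x else 0) = (\<lambda>x. f x * g x)"
      using that(3) K(2) by (auto simp: fun_eq_iff)
    then have "L2_inner \<Omega> f g = (\<integral>x. f x * g x \<partial>lebesgue)"
      unfolding L2_inner_def using \<Omega>
      by (subst Lebesgue_Measure.integral_restrict_UNIV[symmetric]) auto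
    also have "\<dots> = (\<integral>x. f x * g x \<partial>lborel)"
      using borel_measurable_continuous_onI[OF that(1)] borel_measurable_continuous_onI[OF that(2)]
      by (intro integral_completion) auto
    finally show ?thesis .
  qed
  have "0 = (\<integral>x. \<phi> x * partial i \<psi> x + partial i \<phi> x * \<psi> x \<partial>lborel)"
    unfolding p[symmetric]
    by (rule integral_partial_eq_0[of _ i K, symmetric])
      (use C1 K in \<open>auto simp: p intro!: continuous_intros differentiable_mult\<close>)
  also have "\<dots> = (\<integral>x. \<phi> x * partial i \<psi> x \<partial>lborel) + (\<integral>x. partial i \<phi> x * \<psi> x \<partial>lborel)"
    by (intro Bochner_Integration.integral_add continuous_compact_support_integrable[of _ K])
      (use C1 K dK in \<open>auto intro!: continuous_intros\<close>)
  also have "\<dots> = L2_inner \<Omega> \<phi> (partial i \<psi>) + L2_inner \<Omega> (partial i \<phi>) \<psi>"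
    using C1 K dK by (simp add: to_lborel)
  finally show "L2_inner \<Omega> \<phi> (partial i \<psi>) = - L2_inner \<Omega> (partial i \<phi>) \<psi>" by simp
qed

section \<open>Sobolev spaces\<close>

lemma L2_inner_cong_AE:
  assumes "u \<in> L2 \<Omega>" "u' \<in> L2 \<Omega>" "v \<in> L2 \<Omega>" "AE x in lebesgue_on \<Omega>. u x = u' x"
  shows "L2_inner \<Omega> u v = L2_inner \<Omega> u' v"
  unfolding L2_inner_def
proof (rule integral_cong_AE)
  show "AE x in lebesgue_on \<Omega>. u x * v x = u' x * v x" using assms(4) by eventually_elim simp
qed (intro borel_measurable_times L2D(1) assms)+

lemma L2_norm_cong_AE:
  assumes "u \<in> L2 \<Omega>" "u' \<in> L2 \<Omega>" "AE x in lebesgue_on \<Omega>. u x = u' x"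
  shows "L2_norm \<Omega> u = L2_norm \<Omega> u'"
  using L2_inner_cong_AE[OF assms(1,2) assms(1) assms(3)] L2_inner_cong_AE[OF assms(1,2,2,3)]
    L2.sym[OF assms(1,2)] by (simp add: L2_norm_def)

text \<open>
  By uniqueness, the arbitrary representative chosen by \<open>weak_partial\<close> agrees almost everywhere with
  any weak derivative at hand; linearity of \<open>weak_partial\<close> is a consequence.
\<close>

lemma has_weak_partial_unique:
  assumes "open \<Omega>" "has_weak_partial \<Omega> i u g" "has_weak_partial \<Omega> i u h"
  shows "AE x in lebesgue_on \<Omega>. g x = h x"
proof -
  have L: "g \<in> L2 \<Omega>" "h \<in> L2 \<Omega>" using assms by (auto simp: has_weak_partial_def)
  have "AE x in lebesgue_on \<Omega>. (g - h) x = 0"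
  proof (rule fundamental_lemma_test_functions[OF assms(1)])
    show "g - h \<in> L2 \<Omega>" using L by simp
    fix \<phi> assume \<phi>: "\<phi> \<in> test_functions \<Omega>"
    then show "L2_inner \<Omega> (g - h) \<phi> = 0"
      using assms(2,3) L test_functions_L2[OF assms(1) \<phi>]
      by (simp add: has_weak_partial_def L2.diff_left)
  qed
  then show ?thesis by eventually_elim simp
qed

locale open_domain =
  fixes \<Omega> :: "(real^'d) set"
  assumes open_\<Omega>: "open \<Omega>"
begin

abbreviation D :: "'d \<Rightarrow> (real^'d \<Rightarrow> real) \<Rightarrow> real^'d \<Rightarrow> real" where
  "D i \<equiv> weak_partial \<Omega> i"

lemma H1_L2: "u \<in> H1 \<Omega> \<Longrightarrow> u \<in> L2 \<Omega>"
  by (simp add: H1_def)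

lemma weak_partial: "u \<in> H1 \<Omega> \<Longrightarrow> has_weak_partial \<Omega> i u (D i u)"
  unfolding weak_partial_def using someI_ex[of "has_weak_partial \<Omega> i u"] by (auto simp: H1_def)

lemma weak_partial_L2: "u \<in> H1 \<Omega> \<Longrightarrow> D i u \<in> L2 \<Omega>"
  using weak_partial[of u i] by (simp add: has_weak_partial_def)

lemma has_weak_partial_AE:
  "u \<in> H1 \<Omega> \<Longrightarrow> has_weak_partial \<Omega> i u g \<Longrightarrow> AE x in lebesgue_on \<Omega>. D i u x = g x"
  by (rule has_weak_partial_unique[OF open_\<Omega> weak_partial])

lemma has_weak_partial_linear:
  assumes "u \<in> L2 \<Omega>" "v \<in> L2 \<Omega>" "has_weak_partial \<Omega> i u g" "has_weak_partial \<Omega> i v h"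
  shows "has_weak_partial \<Omega> i (u + v) (g + h)" "has_weak_partial \<Omega> i (c *\<^sub>R u) (c *\<^sub>R g)"
  using assms test_functions_L2[OF open_\<Omega>]
  by (auto simp: has_weak_partial_def L2.bilinear)

lemma subspace_H1: "subspace (H1 \<Omega>)"
proof (rule subspaceI)
  have "has_weak_partial \<Omega> i 0 0" for i
    using test_functions_L2[OF open_\<Omega>] by (auto simp: has_weak_partial_def)
  then show "0 \<in> H1 \<Omega>" by (auto simp: H1_def)
next
  fix u v assume "u \<in> H1 \<Omega>" "v \<in> H1 \<Omega>"
  then show "u + v \<in> H1 \<Omega>"
    using has_weak_partial_linear(1)[of u v] by (fastforce simp: H1_def)
next
  fix c u assume "u \<in> H1 \<Omega>"
  then show "c *\<^sub>R u \<in> H1 \<Omega>"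
    using has_weak_partial_linear(2)[of u u _ _ _ c] by (fastforce simp: H1_def)
qed

lemma H1_mem [simp, intro]:
  "0 \<in> H1 \<Omega>" "\<lbrakk>u \<in> H1 \<Omega>; v \<in> H1 \<Omega>\<rbrakk> \<Longrightarrow> u + v \<in> H1 \<Omega>" "u \<in> H1 \<Omega> \<Longrightarrow> c *\<^sub>R u \<in> H1 \<Omega>"
  "\<lbrakk>u \<in> H1 \<Omega>; v \<in> H1 \<Omega>\<rbrakk> \<Longrightarrow> u - v \<in> H1 \<Omega>"
  using subspace_H1 by (auto simp: subspace_0 subspace_add subspace_scale subspace_diff)

lemma weak_partial_add_AE:
  assumes "u \<in> H1 \<Omega>" "v \<in> H1 \<Omega>"
  shows "AE x in lebesgue_on \<Omega>. D i (u + v) x = D i u x + D i v x"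
  using has_weak_partial_AE[OF _ has_weak_partial_linear(1)[OF _ _ weak_partial weak_partial]] assms H1_L2
  by simp

lemma weak_partial_scale_AE:
  assumes "u \<in> H1 \<Omega>"
  shows "AE x in lebesgue_on \<Omega>. D i (c *\<^sub>R u) x = c * D i u x"
  using has_weak_partial_AE[OF _ has_weak_partial_linear(2)[OF _ _ weak_partial weak_partial]] assms H1_L2
  by simp

lemma weak_partial_diff_AE:
  assumes "u \<in> H1 \<Omega>" "v \<in> H1 \<Omega>"
  shows "AE x in lebesgue_on \<Omega>. D i (u - v) x = D i u x - D i v x"
  using weak_partial_add_AE[OF H1_mem(4)[OF assms] assms(2), of i] by eventually_elim simp

lemma weak_partial_0_AE: "AE x in lebesgue_on \<Omega>. D i 0 x = 0"
  using weak_partial_scale_AE[OF H1_mem(1), of i 0] by simp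

definition H1_inner :: "(real^'d \<Rightarrow> real) \<Rightarrow> (real^'d \<Rightarrow> real) \<Rightarrow> real" where
  "H1_inner u v = L2_inner \<Omega> u v + (\<Sum>i\<in>UNIV. L2_inner \<Omega> (D i u) (D i v))"

lemma semi_inner_H1: "semi_inner (H1 \<Omega>) H1_inner"
proof
  fix u v w :: "real^'d \<Rightarrow> real" and r :: real
  assume u: "u \<in> H1 \<Omega>" and w: "w \<in> H1 \<Omega>"
  have "L2_inner \<Omega> (D i (r *\<^sub>R u)) (D i w)
      = L2_inner \<Omega> (r *\<^sub>R D i u) (D i w)" for i
    using weak_partial_scale_AE[OF u] u w by (intro L2_inner_cong_AE) (auto intro!: weak_partial_L2)
  then show "H1_inner (r *\<^sub>R u) w = r * H1_inner u w"
    using u w by (simp add: H1_inner_def H1_L2 weak_partial_L2 L2.bilinear sum_distrib_left distrib_left)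
  assume v: "v \<in> H1 \<Omega>"
  have "L2_inner \<Omega> (D i (u + v)) (D i w)
      = L2_inner \<Omega> (D i u + D i v) (D i w)" for i
    using weak_partial_add_AE[OF u v] u v w by (intro L2_inner_cong_AE) (auto intro!: weak_partial_L2)
  then show "H1_inner (u + v) w = H1_inner u w + H1_inner v w"
    using u v w by (simp add: H1_inner_def H1_L2 weak_partial_L2 L2.bilinear sum.distrib)
next
  fix u v assume "u \<in> H1 \<Omega>" "v \<in> H1 \<Omega>"
  then show "H1_inner u v = H1_inner v u"
    by (simp add: H1_inner_def L2.sym[of u \<Omega> v] H1_L2 weak_partial_L2
        L2.sym[of "D _ u" \<Omega> "D _ v"])
next
  fix u assume "u \<in> H1 \<Omega>"
  then show "0 \<le> H1_inner u u"
    by (auto simp: H1_inner_def H1_L2 weak_partial_L2 L2.nonneg intro!: add_nonneg_nonneg sum_nonneg)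
qed (rule subspace_H1)

sublocale H1: semi_inner "H1 \<Omega>" H1_inner by (rule semi_inner_H1)

lemma H1_inner_nrm_sq:
  assumes "u \<in> H1 \<Omega>"
  shows "(H1.nrm u)\<^sup>2 = (L2_norm \<Omega> u)\<^sup>2 + (\<Sum>i\<in>UNIV. (L2_norm \<Omega> (D i u))\<^sup>2)"
  using assms by (simp add: H1.nrm_sq H1_inner_def L2_norm_eq L2.nrm_sq H1_L2 weak_partial_L2)

lemma H1_norm_eq: "u \<in> H1 \<Omega> \<Longrightarrow> H1_norm \<Omega> u = H1.nrm u"
  unfolding H1_norm_def H1_inner_nrm_sq[symmetric] by simp

lemma L2_norm_le_H1: "u \<in> H1 \<Omega> \<Longrightarrow> L2_norm \<Omega> u \<le> H1.nrm u"
  by (rule power2_le_imp_le) (auto simp: H1_inner_nrm_sq intro!: sum_nonneg)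

lemma L2_norm_partial_le_H1:
  assumes "u \<in> H1 \<Omega>"
  shows "L2_norm \<Omega> (D i u) \<le> H1.nrm u"
proof (rule power2_le_imp_le)
  have "(L2_norm \<Omega> (D i u))\<^sup>2 \<le> (\<Sum>i\<in>UNIV. (L2_norm \<Omega> (D i u))\<^sup>2)"
    by (rule member_le_sum) auto
  then show "(L2_norm \<Omega> (D i u))\<^sup>2 \<le> (H1.nrm u)\<^sup>2"
    using assms by (simp add: H1_inner_nrm_sq add_increasing)
qed (simp add: assms)

lemma L2_norm_weak_partial_diff:
  assumes "u \<in> H1 \<Omega>" "v \<in> H1 \<Omega>"
  shows "L2_norm \<Omega> (D i (u - v)) = L2_norm \<Omega> (D i u - D i v)"
  using weak_partial_diff_AE[OF assms] assms
  by (intro L2_norm_cong_AE) (auto intro!: weak_partial_L2)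

lemma L2_inner_limit:
  assumes "\<And>n. X n \<in> L2 \<Omega>" "x \<in> L2 \<Omega>" "(\<lambda>n. L2.nrm \<Omega> (X n - x)) \<longlonglongrightarrow> 0" "v \<in> L2 \<Omega>"
  shows "(\<lambda>n. L2_inner \<Omega> (X n) v) \<longlonglongrightarrow> L2_inner \<Omega> x v"
proof (rule LIM_zero_cancel, rule Lim_null_comparison)
  show "\<forall>\<^sub>F n in sequentially. norm (L2_inner \<Omega> (X n) v - L2_inner \<Omega> x v) \<le> L2.nrm \<Omega> (X n - x) * L2.nrm \<Omega> v"
    using assms L2.Cauchy_Schwarz[of "X _ - x" \<Omega> v]
    by (intro always_eventually allI) (simp add: L2.diff_left[symmetric])
  show "(\<lambda>n. L2.nrm \<Omega> (X n - x) * L2.nrm \<Omega> v) \<longlonglongrightarrow> 0"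
    using tendsto_mult_right[OF assms(3), of "L2.nrm \<Omega> v"] by simp
qed

text \<open>
  Functions and weak derivatives converge in \<open>L2\<close> separately, and the defining identity of weak
  derivatives passes to the limit.
\<close>

theorem H1_complete: "H1.complete_form"
  unfolding H1.complete_form_def
proof (intro allI impI, elim conjE)
  fix X :: "nat \<Rightarrow> real^'d \<Rightarrow> real"
  assume X: "\<forall>n. X n \<in> H1 \<Omega>" and cauchy: "\<forall>e>0. \<exists>N. \<forall>m\<ge>N. \<forall>n\<ge>N. H1.nrm (X m - X n) < e"
  have XH: "X n \<in> H1 \<Omega>" for n using X by blast
  have transfer: "\<forall>e>0. \<exists>N. \<forall>m\<ge>N. \<forall>n\<ge>N. d m n < e"
    if le: "\<And>m n. d m n \<le> H1.nrm (X m - X n)" for d :: "nat \<Rightarrow> nat \<Rightarrow> real"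
  proof (intro allI impI)
    fix e :: real assume "e > 0"
    then obtain N where "\<forall>m\<ge>N. \<forall>n\<ge>N. H1.nrm (X m - X n) < e" using cauchy by blast
    then show "\<exists>N. \<forall>m\<ge>N. \<forall>n\<ge>N. d m n < e" using le le_less_trans by blast
  qed
  have "\<forall>e>0. \<exists>N. \<forall>m\<ge>N. \<forall>n\<ge>N. L2.nrm \<Omega> (X m - X n) < e"
    by (rule transfer) (use L2_norm_le_H1[unfolded L2_norm_eq] XH in auto)
  then obtain u where u: "u \<in> L2 \<Omega>" "(\<lambda>n. L2.nrm \<Omega> (X n - u)) \<longlonglongrightarrow> 0"
    using L2_complete[unfolded L2.complete_form_def, rule_format, of X] XH H1_L2 by blast
  have "\<exists>g\<in>L2 \<Omega>. (\<lambda>n. L2.nrm \<Omega> (D i (X n) - g)) \<longlonglongrightarrow> 0" for i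
  proof -
    have "L2.nrm \<Omega> (D i (X m) - D i (X n)) \<le> H1.nrm (X m - X n)" for m n
      using L2_norm_partial_le_H1[of "X m - X n" i] L2_norm_weak_partial_diff[of "X m" "X n" i] XH
      by (simp add: L2_norm_eq)
    then have "\<forall>e>0. \<exists>N. \<forall>m\<ge>N. \<forall>n\<ge>N.
        L2.nrm \<Omega> (D i (X m) - D i (X n)) < e" by (rule transfer)
    then show ?thesis
      using L2_complete[unfolded L2.complete_form_def, rule_format, of "\<lambda>n. D i (X n)"]
        XH weak_partial_L2 by blast
  qed
  then obtain g where g: "\<And>i. g i \<in> L2 \<Omega>"
    "\<And>i. (\<lambda>n. L2.nrm \<Omega> (D i (X n) - g i)) \<longlonglongrightarrow> 0"
    by metis
  have wp: "has_weak_partial \<Omega> i u (g i)" for i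
    unfolding has_weak_partial_def
  proof (intro conjI ballI)
    fix \<phi> assume \<phi>: "\<phi> \<in> test_functions \<Omega>"
    note L = test_functions_L2[OF open_\<Omega> \<phi>]
    have "(\<lambda>n. L2_inner \<Omega> (X n) (partial i \<phi>)) \<longlonglongrightarrow> L2_inner \<Omega> u (partial i \<phi>)"
      using L2_inner_limit[OF _ u] XH H1_L2 L by blast
    moreover have "(\<lambda>n. - L2_inner \<Omega> (D i (X n)) \<phi>) \<longlonglongrightarrow> - L2_inner \<Omega> (g i) \<phi>"
      using L2_inner_limit[OF _ g[of i]] XH weak_partial_L2 L by (intro tendsto_minus) blast
    moreover have "L2_inner \<Omega> (X n) (partial i \<phi>) = - L2_inner \<Omega> (D i (X n)) \<phi>" for n
      using weak_partial[OF XH] \<phi> by (simp add: has_weak_partial_def)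
    ultimately show "L2_inner \<Omega> u (partial i \<phi>) = - L2_inner \<Omega> (g i) \<phi>"
      using LIMSEQ_unique by simp
  qed (rule g)
  have uH: "u \<in> H1 \<Omega>" using u wp by (auto simp: H1_def)
  have eq: "L2_norm \<Omega> (D i (X n - u)) = L2.nrm \<Omega> (D i (X n) - g i)" for i n
  proof -
    have "AE x in lebesgue_on \<Omega>. D i (X n - u) x = (D i (X n) - g i) x"
      using weak_partial_diff_AE[OF XH[of n] uH, of i] has_weak_partial_AE[OF uH wp, of i] by eventually_elim simp
    then show ?thesis
      unfolding L2_norm_eq[symmetric] using XH uH g
      by (intro L2_norm_cong_AE) (auto intro!: weak_partial_L2 L2.mem)
  qed
  have "(\<lambda>n. sqrt ((L2.nrm \<Omega> (X n - u))\<^sup>2 + (\<Sum>i\<in>UNIV. (L2.nrm \<Omega> (D i (X n) - g i))\<^sup>2)))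
      \<longlonglongrightarrow> sqrt (0\<^sup>2 + (\<Sum>i\<in>(UNIV::'d set). 0\<^sup>2))"
    by (intro tendsto_intros u g)
  moreover have "H1.nrm (X n - u) = sqrt ((L2.nrm \<Omega> (X n - u))\<^sup>2 +
      (\<Sum>i\<in>UNIV. (L2.nrm \<Omega> (D i (X n) - g i))\<^sup>2))" for n
    using H1_norm_eq[of "X n - u"] XH uH by (simp add: H1_norm_def eq) (simp add: L2_norm_eq)
  ultimately have "(\<lambda>n. H1.nrm (X n - u)) \<longlonglongrightarrow> 0" by simp
  then show "\<exists>x\<in>H1 \<Omega>. (\<lambda>n. H1.nrm (X n - x)) \<longlonglongrightarrow> 0" using uH by blast
qed

lemma test_functions_H1: "\<phi> \<in> test_functions \<Omega> \<Longrightarrow> \<phi> \<in> H1 \<Omega>"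
  using test_function_weak_partial[OF open_\<Omega>] test_functions_L2[OF open_\<Omega>] by (auto simp: H1_def)

lemma H10_iff: "u \<in> H10 \<Omega> \<longleftrightarrow> u \<in> H1 \<Omega> \<and> (\<forall>\<epsilon>>0. \<exists>\<phi>\<in>test_functions \<Omega>. H1.nrm (u - \<phi>) < \<epsilon>)"
proof -
  have "H1_norm \<Omega> (\<lambda>x. u x - \<phi> x) = H1.nrm (u - \<phi>)" if "u \<in> H1 \<Omega>" "\<phi> \<in> test_functions \<Omega>" for \<phi>
  proof -
    have "u - \<phi> \<in> H1 \<Omega>" using that test_functions_H1 by auto
    from H1_norm_eq[OF this] show ?thesis by (simp only: fun_diff_def)
  qed
  then show ?thesis by (auto simp: H10_def)
qed

lemma H10_H1: "u \<in> H10 \<Omega> \<Longrightarrow> u \<in> H1 \<Omega>"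
  by (simp add: H10_def)

lemma H10_closed:
  assumes X: "\<And>n. X n \<in> H10 \<Omega>" and x: "x \<in> H1 \<Omega>" and lim: "(\<lambda>n. H1.nrm (X n - x)) \<longlonglongrightarrow> 0"
  shows "x \<in> H10 \<Omega>"
  unfolding H10_iff
proof (intro conjI allI impI x)
  fix \<epsilon> :: real assume "\<epsilon> > 0"
  then have "\<forall>\<^sub>F n in sequentially. H1.nrm (X n - x) < \<epsilon> / 2"
    using order_tendstoD(2)[OF lim, of "\<epsilon> / 2"] by simp
  then obtain n where n: "H1.nrm (X n - x) < \<epsilon> / 2" using eventually_happens'[OF sequentially_bot] by blast
  obtain \<phi> where \<phi>: "\<phi> \<in> test_functions \<Omega>" "H1.nrm (X n - \<phi>) < \<epsilon> / 2"
    using X[of n] \<open>\<epsilon> > 0\<close> unfolding H10_iff by (meson half_gt_zero)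
  have mem: "X n - \<phi> \<in> H1 \<Omega>" "X n - x \<in> H1 \<Omega>"
    using H10_H1[OF X] test_functions_H1[OF \<phi>(1)] x by auto
  have "H1.nrm (x - \<phi>) \<le> H1.nrm (X n - \<phi>) + H1.nrm (X n - x)"
    using H1.nrm_diff_le[OF mem] by simp
  then show "\<exists>\<phi>\<in>test_functions \<Omega>. H1.nrm (x - \<phi>) < \<epsilon>" using n \<phi> by force
qed

lemma subspace_H10: "subspace (H10 \<Omega>)"
proof (rule subspaceI)
  have "0 \<in> test_functions \<Omega>" using subspace_test_functions subspace_0 by blast
  then show "0 \<in> H10 \<Omega>" by (auto simp: H10_iff H1.nrm_def intro!: bexI[of _ 0])
next
  fix u v assume uv: "u \<in> H10 \<Omega>" "v \<in> H10 \<Omega>"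
  show "u + v \<in> H10 \<Omega>"
    unfolding H10_iff
  proof (intro conjI allI impI)
    show "u + v \<in> H1 \<Omega>" using uv H10_H1 by auto
    fix \<epsilon> :: real assume "\<epsilon> > 0"
    then obtain \<phi> \<psi> where t: "\<phi> \<in> test_functions \<Omega>" "\<psi> \<in> test_functions \<Omega>"
      "H1.nrm (u - \<phi>) < \<epsilon> / 2" "H1.nrm (v - \<psi>) < \<epsilon> / 2"
      using uv unfolding H10_iff by (meson half_gt_zero)
    have "u - \<phi> \<in> H1 \<Omega>" "v - \<psi> \<in> H1 \<Omega>" using uv H10_H1 t test_functions_H1 by auto
    then have "H1.nrm ((u - \<phi>) + (v - \<psi>)) < \<epsilon>" using H1.nrm_add_le[of "u - \<phi>" "v - \<psi>"] t by simp
    moreover have "(u - \<phi>) + (v - \<psi>) = (u + v) - (\<phi> + \<psi>)" by simp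
    moreover have "\<phi> + \<psi> \<in> test_functions \<Omega>" using t subspace_test_functions subspace_add by blast
    ultimately show "\<exists>\<phi>\<in>test_functions \<Omega>. H1.nrm (u + v - \<phi>) < \<epsilon>" by metis
  qed
next
  fix c u assume u: "u \<in> H10 \<Omega>"
  show "c *\<^sub>R u \<in> H10 \<Omega>"
    unfolding H10_iff
  proof (intro conjI allI impI)
    show "c *\<^sub>R u \<in> H1 \<Omega>" using u H10_H1 by auto
    fix \<epsilon> :: real assume "\<epsilon> > 0"
    then have "\<epsilon> / (\<bar>c\<bar> + 1) > 0" by simp
    then obtain \<phi> where \<phi>: "\<phi> \<in> test_functions \<Omega>" "H1.nrm (u - \<phi>) < \<epsilon> / (\<bar>c\<bar> + 1)"
      using u unfolding H10_iff by meson
    have d: "u - \<phi> \<in> H1 \<Omega>" using u H10_H1 \<phi> test_functions_H1 by auto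
    have "H1.nrm (c *\<^sub>R u - c *\<^sub>R \<phi>) = \<bar>c\<bar> * H1.nrm (u - \<phi>)"
      using H1.nrm_scale[OF d, of c] by (simp add: scaleR_diff_right)
    also have "\<dots> \<le> (\<bar>c\<bar> + 1) * H1.nrm (u - \<phi>)"
      using d by (intro mult_right_mono) auto
    also have "\<dots> < \<epsilon>" using \<phi>(2) by (simp add: field_simps)
    finally show "\<exists>\<phi>\<in>test_functions \<Omega>. H1.nrm (c *\<^sub>R u - \<phi>) < \<epsilon>"
      using \<phi>(1) subspace_test_functions subspace_scale by blast
  qed
qed

lemma H10_sub_H1: "H10 \<Omega> \<subseteq> H1 \<Omega>" using H10_H1 by blast

lemma semi_inner_H10: "semi_inner (H10 \<Omega>) H1_inner"
  by (rule semi_inner_subspace[OF semi_inner_H1 H10_sub_H1 subspace_H10])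

lemma H10_complete: "semi_inner.complete_form (H10 \<Omega>) H1_inner"
  by (rule complete_form_subspace[OF semi_inner_H1 H1_complete H10_sub_H1 subspace_H10 H10_closed])

sublocale gelfand "L2 \<Omega>" "L2_inner \<Omega>" "H10 \<Omega>"
  by unfold_locales (use H10_H1 H1_L2 in blast)

text \<open>
  The form \<open>(u, v) + k a(u, v)\<close> induces a norm equivalent to that of \<open>H1\<close>. The \<open>L2\<close> part of the form
  controls the part of that norm which the coercivity of \<open>a\<close> leaves out.
\<close>

lemma coercive_resolvable:
  assumes a: "semi_inner (H10 \<Omega>) a" and lower: "c > 0"
      "\<And>u. u \<in> H10 \<Omega> \<Longrightarrow> c * (\<Sum>i\<in>UNIV. (L2_norm \<Omega> (D i u))\<^sup>2) \<le> a u u"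
    and upper: "\<And>u. u \<in> H10 \<Omega> \<Longrightarrow> a u u \<le> C * H1_inner u u"
  shows "resolvable a"
  unfolding resolvable_def
proof (intro allI impI ballI)
  fix k :: real and \<phi> assume k: "k > 0" and \<phi>: "\<phi> \<in> L2 \<Omega>"
  interpret a: semi_inner "H10 \<Omega>" a by (fact a)
  define b where "b u v = L2_inner \<Omega> u v + k * a u v" for u v
  have HL: "u \<in> L2 \<Omega>" if "u \<in> H10 \<Omega>" for u using that H10_H1 H1_L2 by blast
  interpret b: semi_inner "H10 \<Omega>" b
  proof
    show "subspace (H10 \<Omega>)" by (rule subspace_H10)
    show "b u v = b v u" if "u \<in> H10 \<Omega>" "v \<in> H10 \<Omega>" for u v
      using L2.sym[OF HL[OF that(1)] HL[OF that(2)]] a.sym[OF that] by (simp add: b_def)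
  qed (use HL k in \<open>auto simp: b_def L2.bilinear a.bilinear L2.nonneg a.nonneg algebra_simps\<close>)
  have H1_inner_eq: "H1_inner u u = (L2_norm \<Omega> u)\<^sup>2 + (\<Sum>i\<in>UNIV. (L2_norm \<Omega> (D i u))\<^sup>2)"
    if "u \<in> H10 \<Omega>" for u
    using H1_inner_nrm_sq[OF H10_H1[OF that]] H1.nrm_sq[OF H10_H1[OF that]] by simp
  have ip_eq: "L2_inner \<Omega> u u = (L2_norm \<Omega> u)\<^sup>2" if "u \<in> H10 \<Omega>" for u
    using L2.nrm_sq[OF HL[OF that]] by (simp add: L2_norm_eq)
  have "semi_inner.complete_form (H10 \<Omega>) b"
  proof (rule complete_form_equivalent[OF semi_inner_H10 H10_complete b.semi_inner_axioms])
    show "min 1 (k * c) > 0" using k lower by simp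
    fix u assume u: "u \<in> H10 \<Omega>"
    define S where "S = (\<Sum>i\<in>UNIV. (L2_norm \<Omega> (D i u))\<^sup>2)"
    have S: "0 \<le> S" unfolding S_def by (intro sum_nonneg) auto
    have "min 1 (k * c) * (L2_norm \<Omega> u)\<^sup>2 \<le> 1 * (L2_norm \<Omega> u)\<^sup>2"
      by (intro mult_right_mono) auto
    moreover have "min 1 (k * c) * S \<le> (k * c) * S" using S by (intro mult_right_mono) auto
    moreover have "k * (c * S) \<le> k * a u u" using lower(2)[OF u] k by (intro mult_left_mono) (auto simp: S_def)
    ultimately show "min 1 (k * c) * H1_inner u u \<le> b u u"
      by (simp add: H1_inner_eq[OF u] b_def ip_eq[OF u] S_def[symmetric] distrib_left mult.assoc)
    have "k * a u u \<le> k * (C * H1_inner u u)" using upper[OF u] k by (intro mult_left_mono) auto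
    then show "b u u \<le> (1 + k * C) * H1_inner u u"
      using S by (simp add: b_def ip_eq[OF u] H1_inner_eq[OF u] S_def[symmetric] algebra_simps)
  qed
  moreover have "\<bar>L2_inner \<Omega> \<phi> v\<bar> \<le> L2.nrm \<Omega> \<phi> * b.nrm v" if v: "v \<in> H10 \<Omega>" for v
  proof -
    have "L2.nrm \<Omega> v \<le> b.nrm v"
      unfolding L2.nrm_def b.nrm_def b_def using k a.nonneg[OF v] by simp
    then show ?thesis
      using L2.Cauchy_Schwarz[OF \<phi> HL[OF v]] \<phi> by (meson L2.nrm_nonneg mult_left_mono order_trans)
  qed
  ultimately have "\<exists>g\<in>H10 \<Omega>. \<forall>v\<in>H10 \<Omega>. L2_inner \<Omega> \<phi> v = b g v"
    using HL \<phi> by (intro b.Riesz_representation) (auto simp: L2.bilinear)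
  then show "\<exists>\<psi>\<in>H10 \<Omega>. \<forall>v\<in>H10 \<Omega>. L2_inner \<Omega> \<psi> v + k * a \<psi> v = L2_inner \<Omega> \<phi> v"
    by (auto simp: b_def)
qed

end

section \<open>Elliptic forms\<close>

lemma integrable_lebesgue_on_subset:
  fixes f :: "'a::euclidean_space \<Rightarrow> real"
  assumes "integrable (lebesgue_on B) f" "A \<subseteq> B" "A \<in> sets lebesgue" "B \<in> sets lebesgue"
  shows "integrable (lebesgue_on A) f"
proof -
  have "integrable lebesgue (\<lambda>x. indicator A x *\<^sub>R (if x \<in> B then f x else 0))"
    using assms by (intro integrable_mult_indicator) (simp_all add: Lebesgue_Measure.integrable_restrict_UNIV)
  moreover have "(\<lambda>x. indicator A x *\<^sub>R (if x \<in> B then f x else 0)) = (\<lambda>x. if x \<in> A then f x else 0)"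
    using assms(2) by (auto simp: indicator_def fun_eq_iff)
  ultimately show ?thesis using assms(3) by (simp add: Lebesgue_Measure.integrable_restrict_UNIV)
qed

lemma average_ge:
  fixes f :: "real \<Rightarrow> real"
  assumes "l < r" "integrable (lebesgue_on {l<..r}) f" "\<And>t. t \<in> {l<..r} \<Longrightarrow> c \<le> f t"
  shows "c \<le> 1 / (r - l) * (\<integral>t. f t \<partial>lebesgue_on {l<..r})"
proof -
  interpret finite_measure "lebesgue_on {l<..r}"
    by (rule finite_measureI) (use assms(1) in \<open>simp add: emeasure_restrict_space\<close>)
  have "(\<integral>t. c \<partial>lebesgue_on {l<..r}) \<le> (\<integral>t. f t \<partial>lebesgue_on {l<..r})"
    using assms by (intro integral_mono) auto
  moreover have "(\<integral>t. c \<partial>lebesgue_on {l<..r}) = (r - l) * c"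
    using assms(1) by (simp add: measure_restrict_space)
  ultimately show ?thesis using assms(1) by (simp add: field_simps)
qed

lemma average_le:
  fixes f :: "real \<Rightarrow> real"
  assumes "l < r" "integrable (lebesgue_on {l<..r}) f" "\<And>t. t \<in> {l<..r} \<Longrightarrow> f t \<le> c"
  shows "1 / (r - l) * (\<integral>t. f t \<partial>lebesgue_on {l<..r}) \<le> c"
  using average_ge[of l r "\<lambda>t. - f t" "- c"] assms by simp

lemma L2_norm_sq: "p \<in> L2 \<Omega> \<Longrightarrow> (L2_norm \<Omega> p)\<^sup>2 = (\<integral>x. (p x)\<^sup>2 \<partial>lebesgue_on \<Omega>)"
  unfolding L2_norm_eq L2.nrm_sq by (simp add: L2_inner_def power2_eq_square)

context open_domain
begin

abbreviation energy_density ::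
    "(real^'d \<Rightarrow> real^'d^'d) \<Rightarrow> (real^'d \<Rightarrow> real) \<Rightarrow> (real^'d \<Rightarrow> real) \<Rightarrow> real^'d \<Rightarrow> real" where
  "energy_density c u v x \<equiv> (\<Sum>i\<in>UNIV. \<Sum>j\<in>UNIV. c x $ i $ j * D i u x * D j v x)"

text \<open>
  The form of a single coefficient matrix \<open>c\<close>, so that facts about it apply to the coefficients at one
  time and to their difference at two times alike.
\<close>

definition mform :: "(real^'d \<Rightarrow> real^'d^'d) \<Rightarrow> (real^'d \<Rightarrow> real) \<Rightarrow> (real^'d \<Rightarrow> real) \<Rightarrow> real" where
  "mform c u v = (\<integral>x. energy_density c u v x \<partial>lebesgue_on \<Omega>)"

definition bounded_matrix :: "(real^'d \<Rightarrow> real^'d^'d) \<Rightarrow> real \<Rightarrow> bool" where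
  "bounded_matrix c K \<longleftrightarrow> 0 \<le> K \<and> (\<forall>i j. (\<lambda>x. c x $ i $ j) \<in> borel_measurable (lebesgue_on \<Omega>)) \<and>
     (AE x in lebesgue_on \<Omega>. \<forall>i j. \<bar>c x $ i $ j\<bar> \<le> K)"

definition grad_sum :: "(real^'d \<Rightarrow> real) \<Rightarrow> real" where
  "grad_sum u = (\<Sum>i\<in>UNIV. L2_norm \<Omega> (D i u))"

lemma L2_norm_nonneg [simp]: "0 \<le> L2_norm \<Omega> u"
  by (simp add: L2_norm_def L2_inner_def)

lemma grad_sum_nonneg [simp]: "0 \<le> grad_sum u"
  by (simp add: grad_sum_def sum_nonneg)

lemma weighted_product:
  assumes c: "bounded_matrix c K" and p: "p \<in> L2 \<Omega>" and q: "q \<in> L2 \<Omega>"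
  shows "integrable (lebesgue_on \<Omega>) (\<lambda>x. c x $ i $ j * p x * q x)"
    and "\<bar>\<integral>x. c x $ i $ j * p x * q x \<partial>lebesgue_on \<Omega>\<bar> \<le> K * (L2_norm \<Omega> p * L2_norm \<Omega> q)"
proof -
  have c': "(\<lambda>x. c x $ i $ j) \<in> borel_measurable (lebesgue_on \<Omega>)" "0 \<le> K"
    "AE x in lebesgue_on \<Omega>. \<bar>c x $ i $ j\<bar> \<le> K"
    using c by (auto simp: bounded_matrix_def elim: eventually_mono)
  have abs_L2: "(\<lambda>x. \<bar>f x\<bar>) \<in> L2 \<Omega>" "L2_norm \<Omega> (\<lambda>x. \<bar>f x\<bar>) = L2_norm \<Omega> f" if "f \<in> L2 \<Omega>" for f
    using that by (auto simp: L2_def L2_norm_def L2_inner_def)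
  have pq: "integrable (lebesgue_on \<Omega>) (\<lambda>x. K * (\<bar>p x\<bar> * \<bar>q x\<bar>))"
    using integrable_L2_mult[OF abs_L2(1)[OF p] abs_L2(1)[OF q]] by simp
  have m: "(\<lambda>x. c x $ i $ j * p x * q x) \<in> borel_measurable (lebesgue_on \<Omega>)"
    by (intro borel_measurable_times c' L2D(1)[OF p] L2D(1)[OF q])
  have le: "AE x in lebesgue_on \<Omega>. \<bar>c x $ i $ j * p x * q x\<bar> \<le> K * (\<bar>p x\<bar> * \<bar>q x\<bar>)"
    using c'(3) by eventually_elim (simp add: abs_mult mult.assoc mult_right_mono)
  show int: "integrable (lebesgue_on \<Omega>) (\<lambda>x. c x $ i $ j * p x * q x)"
  proof (rule Bochner_Integration.integrable_bound[OF pq m])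
    show "AE x in lebesgue_on \<Omega>. norm (c x $ i $ j * p x * q x) \<le> norm (K * (\<bar>p x\<bar> * \<bar>q x\<bar>))"
      using le by eventually_elim (use c'(2) in simp)
  qed
  have "\<bar>\<integral>x. c x $ i $ j * p x * q x \<partial>lebesgue_on \<Omega>\<bar> \<le> (\<integral>x. \<bar>c x $ i $ j * p x * q x\<bar> \<partial>lebesgue_on \<Omega>)"
    by (rule integral_abs_bound)
  also have "\<dots> \<le> (\<integral>x. K * (\<bar>p x\<bar> * \<bar>q x\<bar>) \<partial>lebesgue_on \<Omega>)"
    using int pq le by (intro integral_mono_AE) auto
  also have "\<dots> = K * L2_inner \<Omega> (\<lambda>x. \<bar>p x\<bar>) (\<lambda>x. \<bar>q x\<bar>)"
    by (simp add: L2_inner_def)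
  also have "\<dots> \<le> K * (L2_norm \<Omega> p * L2_norm \<Omega> q)"
    using L2.Cauchy_Schwarz[OF abs_L2(1)[OF p] abs_L2(1)[OF q], folded L2_norm_eq] c'(2)
    by (intro mult_left_mono) (simp_all add: abs_L2(2)[OF p] abs_L2(2)[OF q])
  finally show "\<bar>\<integral>x. c x $ i $ j * p x * q x \<partial>lebesgue_on \<Omega>\<bar> \<le> K * (L2_norm \<Omega> p * L2_norm \<Omega> q)" .
qed

context
  fixes c K assumes c: "bounded_matrix c K"
begin

lemma mform_integrable:
  assumes "u \<in> H1 \<Omega>" "v \<in> H1 \<Omega>"
  shows "integrable (lebesgue_on \<Omega>)
    (\<lambda>x. energy_density c u v x)"
  using assms by (intro Bochner_Integration.integrable_sum weighted_product[OF c] weak_partial_L2)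

lemma mform_bound:
  assumes "u \<in> H1 \<Omega>" "v \<in> H1 \<Omega>"
  shows "\<bar>mform c u v\<bar> \<le> K * (grad_sum u * grad_sum v)"
proof -
  have "mform c u v = (\<Sum>i\<in>UNIV. \<Sum>j\<in>UNIV.
      \<integral>x. c x $ i $ j * D i u x * D j v x \<partial>lebesgue_on \<Omega>)"
    unfolding mform_def using assms
    by (simp add: Bochner_Integration.integral_sum weighted_product[OF c] weak_partial_L2)
  also have "\<bar>\<dots>\<bar> \<le> (\<Sum>i\<in>UNIV. \<Sum>j\<in>UNIV.
      \<bar>\<integral>x. c x $ i $ j * D i u x * D j v x \<partial>lebesgue_on \<Omega>\<bar>)"
    by (rule order_trans[OF sum_abs]) (intro sum_mono sum_abs)
  also have "\<dots> \<le> (\<Sum>i\<in>UNIV. \<Sum>j\<in>UNIV.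
      K * (L2_norm \<Omega> (D i u) * L2_norm \<Omega> (D j v)))"
    using assms by (intro sum_mono weighted_product(2)[OF c] weak_partial_L2)
  also have "\<dots> = K * (grad_sum u * grad_sum v)"
    unfolding grad_sum_def sum_product by (simp only: sum_distrib_left)
  finally show ?thesis .
qed

lemma mform_add_left:
  assumes "u \<in> H1 \<Omega>" "v \<in> H1 \<Omega>" "w \<in> H1 \<Omega>"
  shows "mform c (u + v) w = mform c u w + mform c v w"
proof -
  have "mform c (u + v) w = (\<integral>x.
      energy_density c u w x +
      energy_density c v w x \<partial>lebesgue_on \<Omega>)"
    unfolding mform_def
  proof (rule integral_cong_AE)
    have "AE x in lebesgue_on \<Omega>. \<forall>i\<in>UNIV. D i (u + v) x = D i u x + D i v x"
      using weak_partial_add_AE[OF assms(1,2)] by (subst AE_finite_all) auto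
    then show "AE x in lebesgue_on \<Omega>.
       energy_density c (u + v) w x =
       energy_density c u w x +
       energy_density c v w x"
      by eventually_elim (simp add: sum.distrib[symmetric] algebra_simps)
  qed (use assms mform_integrable[THEN borel_measurable_integrable] in \<open>auto intro!: borel_measurable_add\<close>)
  then show ?thesis
    using mform_integrable assms by (simp add: mform_def)
qed

lemma mform_scale_left:
  assumes "u \<in> H1 \<Omega>" "w \<in> H1 \<Omega>"
  shows "mform c (r *\<^sub>R u) w = r * mform c u w"
proof -
  have "mform c (r *\<^sub>R u) w = (\<integral>x. r *
      energy_density c u w x \<partial>lebesgue_on \<Omega>)"
    unfolding mform_def
  proof (rule integral_cong_AE)
    have "AE x in lebesgue_on \<Omega>. \<forall>i\<in>UNIV. D i (r *\<^sub>R u) x = r * D i u x"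
      using weak_partial_scale_AE[OF assms(1)] by (subst AE_finite_all) auto
    then show "AE x in lebesgue_on \<Omega>.
       energy_density c (r *\<^sub>R u) w x =
       r * energy_density c u w x"
      by eventually_elim (simp add: sum_distrib_left mult_ac)
  qed (use assms mform_integrable[THEN borel_measurable_integrable] in \<open>auto intro!: borel_measurable_times\<close>)
  then show ?thesis by (simp add: mform_def)
qed

lemma mform_sym:
  assumes "u \<in> H1 \<Omega>" "v \<in> H1 \<Omega>" and s: "AE x in lebesgue_on \<Omega>. \<forall>i j. c x $ i $ j = c x $ j $ i"
  shows "mform c u v = mform c v u"
  unfolding mform_def
proof (rule integral_cong_AE)
  show "AE x in lebesgue_on \<Omega>.
       energy_density c u v x =
       energy_density c v u x"
    using s
  proof eventually_elim
    case (elim x)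
    have "energy_density c u v x =
       (\<Sum>j\<in>UNIV. \<Sum>i\<in>UNIV. c x $ i $ j * D i u x * D j v x)"
      by (rule sum.swap)
    also have "\<dots> = energy_density c v u x"
      using elim by (intro sum.cong refl) (simp add: mult_ac)
    finally show ?case .
  qed
qed (use assms mform_integrable[THEN borel_measurable_integrable] in auto)

lemma mform_coercive:
  assumes "u \<in> H1 \<Omega>"
    and e: "AE x in lebesgue_on \<Omega>. \<forall>\<xi>. \<alpha> * (norm \<xi>)\<^sup>2 \<le> (\<Sum>i\<in>UNIV. \<Sum>j\<in>UNIV. c x $ i $ j * \<xi> $ i * \<xi> $ j)"
  shows "\<alpha> * (\<Sum>i\<in>UNIV. (L2_norm \<Omega> (D i u))\<^sup>2) \<le> mform c u u"
proof -
  have L: "D i u \<in> L2 \<Omega>" for i using weak_partial_L2 assms by blast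
  have "\<alpha> * (\<Sum>i\<in>UNIV. (L2_norm \<Omega> (D i u))\<^sup>2)
      = \<alpha> * (\<Sum>i\<in>UNIV. \<integral>x. (D i u x)\<^sup>2 \<partial>lebesgue_on \<Omega>)"
    by (simp add: L2_norm_sq[OF L])
  also have "\<dots> = (\<integral>x. \<alpha> * (\<Sum>i\<in>UNIV. (D i u x)\<^sup>2) \<partial>lebesgue_on \<Omega>)"
    using L2D(2)[OF L] by (simp add: Bochner_Integration.integral_sum)
  also have "\<dots> \<le> mform c u u"
    unfolding mform_def
  proof (rule integral_mono_AE)
    show "integrable (lebesgue_on \<Omega>) (\<lambda>x. \<alpha> * (\<Sum>i\<in>UNIV. (D i u x)\<^sup>2))"
      using L2D(2)[OF L] by simp
    show "AE x in lebesgue_on \<Omega>. \<alpha> * (\<Sum>i\<in>UNIV. (D i u x)\<^sup>2)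
        \<le> energy_density c u u x"
      using e
    proof eventually_elim
      case (elim x)
      have "(norm ((\<chi> i. D i u x) :: real^'d))\<^sup>2 = (\<Sum>i\<in>UNIV. (D i u x)\<^sup>2)"
        by (simp add: norm_vec_def L2_set_def sum_nonneg)
      then show ?case using elim[rule_format, of "\<chi> i. D i u x"] by simp
    qed
  qed (rule mform_integrable[OF assms(1,1)])
  finally show ?thesis .
qed

end

lemma grad_sum_sq:
  "(grad_sum u)\<^sup>2 \<le> real CARD('d) * (\<Sum>i\<in>UNIV. (L2_norm \<Omega> (D i u))\<^sup>2)"
proof -
  have "(\<Sum>i\<in>(UNIV::'d set). 1 * L2_norm \<Omega> (D i u))\<^sup>2
      \<le> (\<Sum>i\<in>(UNIV::'d set). 1\<^sup>2) * (\<Sum>i\<in>UNIV. (L2_norm \<Omega> (D i u))\<^sup>2)"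
    by (rule Cauchy_Schwarz_ineq_sum)
  then show ?thesis by (simp add: grad_sum_def)
qed

lemma mform_diff:
  assumes "bounded_matrix c K" "bounded_matrix c' K'" "u \<in> H1 \<Omega>" "v \<in> H1 \<Omega>"
  shows "mform c u v - mform c' u v = mform (\<lambda>x. c x - c' x) u v"
  unfolding mform_def
  using mform_integrable[OF assms(1,3,4)] mform_integrable[OF assms(2,3,4)]
  by (simp add: Bochner_Integration.integral_diff[symmetric] sum_subtractf[symmetric] left_diff_distrib)

end

section \<open>Time-dependent coefficients\<close>

lemma AE_lebesgue_on_slices:
  fixes S :: "('a::euclidean_space \<times> 'b::euclidean_space) set"
  assumes "S \<in> sets lebesgue" "AE z in lebesgue_on S. P z"
  shows "AE t in lborel. AE x in lborel. (t, x) \<in> S \<longrightarrow> P (t, x)"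
proof -
  have "AE z in lborel. z \<in> S \<longrightarrow> P z"
    using assms by (simp add: AE_restrict_space_iff AE_completion_iff)
  then show ?thesis
    unfolding lborel_prod[symmetric] by (rule lborel_pair.AE_pair)
qed

text \<open>
  Slices of a Lebesgue measurable function need not be measurable, but almost all of them agree almost
  everywhere with the slices of a Borel function.
\<close>

lemma borel_measurable_lebesgue_on_slices:
  fixes f :: "real \<times> 'b::euclidean_space \<Rightarrow> real"
  assumes S: "S \<in> sets lebesgue" and f: "f \<in> borel_measurable (lebesgue_on S)"
  shows "AE t in lborel. (\<lambda>x. if (t, x) \<in> S then f (t, x) else 0) \<in> borel_measurable lebesgue"
proof -
  define F where "F z = (if z \<in> S then f z else 0)" for z
  have "F \<in> borel_measurable lebesgue"
    unfolding F_def using S f by (simp add: borel_measurable_if)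
  then obtain g where g: "g \<in> borel_measurable lborel" and Fg: "AE z in lborel. F z = g z"
    using completion_ex_borel_measurable_real by blast
  have "AE t in lborel. AE x in lborel. F (t, x) = g (t, x)"
    using Fg unfolding lborel_prod[symmetric] by (rule lborel_pair.AE_pair)
  then show ?thesis
  proof eventually_elim
    case (elim t)
    have "(\<lambda>x. g (t, x)) \<in> borel_measurable lborel"
      using g by (intro measurable_compose[of "\<lambda>x. (t, x)" lborel borel g borel]) (simp_all add: borel_measurable_Pair)
    then have "(\<lambda>x. g (t, x)) \<in> borel_measurable lebesgue" by (rule measurable_completion)
    moreover have "AE x in lebesgue. g (t, x) = F (t, x)"
      using elim by (intro AE_completion) (auto elim: eventually_mono)
    ultimately show ?case unfolding F_def by (rule borel_measurable_AE)
  qed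
qed

lemma borel_measurable_lebesgue_on_AE_limit:
  fixes f :: "nat \<Rightarrow> 'b::euclidean_space \<Rightarrow> real"
  assumes S: "S \<in> sets lebesgue" and f: "\<And>n. f n \<in> borel_measurable (lebesgue_on S)"
    and lim: "AE x in lebesgue_on S. (\<lambda>n. f n x) \<longlonglongrightarrow> g x"
  shows "g \<in> borel_measurable (lebesgue_on S)"
proof -
  have "(\<lambda>x. if x \<in> S then f n x else 0) \<in> borel_measurable lebesgue" for n
    using S f by (simp add: borel_measurable_if)
  then have "(\<lambda>x. lim (\<lambda>n. if x \<in> S then f n x else 0)) \<in> borel_measurable lebesgue"
    by (rule borel_measurable_lim_metric)
  moreover have "AE x in lebesgue. lim (\<lambda>n. if x \<in> S then f n x else 0) = (if x \<in> S then g x else 0)"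
    using lim[unfolded AE_restrict_space_iff[of S lebesgue, simplified, OF S]]
    by eventually_elim (auto intro: limI)
  ultimately have "(\<lambda>x. if x \<in> S then g x else 0) \<in> borel_measurable lebesgue"
    by (rule borel_measurable_AE)
  then show ?thesis using S by (simp add: borel_measurable_if)
qed

locale coefficients = open_domain \<Omega> for \<Omega> :: "(real^'d) set" +
  fixes T \<alpha> :: real and \<omega> :: "real \<Rightarrow> real" and a :: "real \<Rightarrow> real^'d \<Rightarrow> real^'d^'d"
  assumes T: "T > 0" and \<alpha>: "\<alpha> > 0"
    and modulus: "admissible_modulus T \<omega>"
    and coeff: "admissible_coefficients \<Omega> T \<alpha> \<omega> a"
begin

definition elliptic_slice :: "real \<Rightarrow> real \<Rightarrow> bool" where
  "elliptic_slice B t \<longleftrightarrow> bounded_matrix (a t) B \<and>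
     (AE x in lebesgue_on \<Omega>. \<forall>i j. a t x $ i $ j = a t x $ j $ i) \<and>
     (AE x in lebesgue_on \<Omega>. \<forall>\<xi>. \<alpha> * (norm \<xi>)\<^sup>2 \<le> (\<Sum>i\<in>UNIV. \<Sum>j\<in>UNIV. a t x $ i $ j * \<xi> $ i * \<xi> $ j))"

lemma elliptic_slice_AE: "\<exists>B. AE t in lborel. t \<in> {0<..<T} \<longrightarrow> elliptic_slice B t"
proof -
  let ?S = "{0<..<T} \<times> \<Omega>"
  have "open ?S" using open_\<Omega> by (intro open_Times) auto
  then have S: "?S \<in> sets lebesgue" by auto
  have \<Omega>: "\<Omega> \<in> sets lebesgue" using open_\<Omega> by auto
  obtain B0 where B0: "AE (t, x) in lebesgue_on ?S. \<forall>i j. \<bar>a t x $ i $ j\<bar> \<le> B0"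
    using coeff unfolding admissible_coefficients_def by blast
  define B where "B = max 0 B0"
  have *: "AE x in lebesgue_on \<Omega>. P t x" if "AE x in lborel. (t, x) \<in> ?S \<longrightarrow> (\<lambda>(t, x). P t x) (t, x)" "t \<in> {0<..<T}"
    for P and t :: real
    using AE_completion[OF that(1)] that(2) \<Omega> by (simp add: AE_restrict_space_iff)
  have "AE t in lborel. AE x in lborel. (t, x) \<in> ?S \<longrightarrow> (\<lambda>(t, x). \<forall>i j. \<bar>a t x $ i $ j\<bar> \<le> B0) (t, x)"
    by (rule AE_lebesgue_on_slices[OF S B0])
  moreover have "AE t in lborel. AE x in lborel. (t, x) \<in> ?S \<longrightarrow>
      (\<lambda>(t, x). \<forall>i j. a t x $ i $ j = a t x $ j $ i) (t, x)"
    using coeff unfolding admissible_coefficients_def by (intro AE_lebesgue_on_slices[OF S]) blast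
  moreover have "AE t in lborel. AE x in lborel. (t, x) \<in> ?S \<longrightarrow>
      (\<lambda>(t, x). \<forall>\<xi>. (\<Sum>i\<in>UNIV. \<Sum>j\<in>UNIV. a t x $ i $ j * \<xi> $ i * \<xi> $ j) \<ge> \<alpha> * (norm \<xi>)\<^sup>2) (t, x)"
    using coeff unfolding admissible_coefficients_def by (intro AE_lebesgue_on_slices[OF S]) blast
  moreover have "AE t in lborel. \<forall>i\<in>UNIV. \<forall>j\<in>UNIV.
      (\<lambda>x. if (t, x) \<in> ?S then (\<lambda>(t, x). a t x $ i $ j) (t, x) else 0) \<in> borel_measurable lebesgue"
    using coeff unfolding admissible_coefficients_def
    by (intro AE_finite_allI borel_measurable_lebesgue_on_slices[OF S]) auto
  ultimately have "AE t in lborel. t \<in> {0<..<T} \<longrightarrow> elliptic_slice B t"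
  proof eventually_elim
    case (elim t)
    show ?case
    proof
      assume t: "t \<in> {0<..<T}"
      have "(\<lambda>x. a t x $ i $ j) \<in> borel_measurable (lebesgue_on \<Omega>)" for i j
        using elim(4) t \<Omega> by (simp add: borel_measurable_if)
      moreover have "AE x in lebesgue_on \<Omega>. \<forall>i j. \<bar>a t x $ i $ j\<bar> \<le> B"
        using *[OF elim(1) t] by eventually_elim (auto simp: B_def le_max_iff_disj)
      ultimately show "elliptic_slice B t"
        using *[OF elim(2) t] *[OF elim(3) t] by (simp add: elliptic_slice_def bounded_matrix_def B_def)
    qed
  qed
  then show ?thesis by blast
qed

text \<open>
  The bounds hold for almost all times, hence on a dense set of times. By continuity in time they
  pass to the limit at every time, and so does measurability.
\<close>

lemma elliptic_slice_all: "\<exists>B. \<forall>t\<in>{0..T}. elliptic_slice B t"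
proof -
  have \<Omega>: "\<Omega> \<in> sets lebesgue" using open_\<Omega> by auto
  obtain B where B: "AE t in lborel. t \<in> {0<..<T} \<longrightarrow> elliptic_slice B t"
    using elliptic_slice_AE by blast
  \<comment> \<open>A relatively open interval of times without good times would be a null set.\<close>
  have dense: "\<exists>s\<in>{0<..<T}. \<bar>s - t\<bar> < e \<and> elliptic_slice B s" if t: "t \<in> {0..T}" and e: "e > 0" for t e
  proof (rule ccontr)
    assume n: "\<not> ?thesis"
    define l r where "l = max 0 (t - e)" and "r = min T (t + e)"
    have lr: "l < r" using t e T by (auto simp: l_def r_def)
    have "AE s in lborel. s \<notin> {l<..<r}"
      using B by eventually_elim (use n in \<open>auto simp: l_def r_def abs_if\<close>)
    then have "{l<..<r} \<in> null_sets lborel" by (subst AE_iff_null_sets) auto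
    then show False using lr by (simp add: null_sets_def)
  qed
  have "elliptic_slice B t" if t: "t \<in> {0..T}" for t
  proof -
    obtain s where s: "\<And>n. s n \<in> {0<..<T}" "\<And>n. \<bar>s n - t\<bar> < 1 / real (Suc n)" "\<And>n. elliptic_slice B (s n)"
      using dense[OF t, of "1 / real (Suc _)"] by (metis of_nat_0_less_iff zero_less_Suc zero_less_divide_1_iff)
    have st: "s \<longlonglongrightarrow> t"
    proof (rule LIM_zero_cancel, rule Lim_null_comparison)
      show "\<forall>\<^sub>F n in sequentially. norm (s n - t) \<le> 1 / real (Suc n)"
        using s(2) by (auto intro: always_eventually less_imp_le)
      show "(\<lambda>n. 1 / real (Suc n)) \<longlonglongrightarrow> 0" by (rule LIMSEQ_Suc[OF lim_1_over_n])
    qed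
    have "AE x in lebesgue_on \<Omega>. \<forall>i j. continuous_on {0..T} (\<lambda>t. a t x $ i $ j)"
      using coeff unfolding admissible_coefficients_def by blast
    then have conv: "AE x in lebesgue_on \<Omega>. \<forall>i j. (\<lambda>n. a (s n) x $ i $ j) \<longlonglongrightarrow> a t x $ i $ j"
    proof eventually_elim
      case (elim x)
      have "s n \<in> {0..T}" for n using s(1)[of n] by simp
      then have "(\<lambda>n. a (s n) x $ i $ j) \<longlonglongrightarrow> a t x $ i $ j" for i j
        by (intro continuous_on_tendsto_compose[of "{0..T}" "\<lambda>t. a t x $ i $ j" s t])
          (use elim t st in auto)
      then show ?case by blast
    qed
    have bd: "AE x in lebesgue_on \<Omega>. \<forall>n. \<forall>i j. \<bar>a (s n) x $ i $ j\<bar> \<le> B"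
      using s(3) by (subst AE_all_countable) (simp add: elliptic_slice_def bounded_matrix_def)
    have sy: "AE x in lebesgue_on \<Omega>. \<forall>n. \<forall>i j. a (s n) x $ i $ j = a (s n) x $ j $ i"
      using s(3) by (subst AE_all_countable) (simp add: elliptic_slice_def)
    have el: "AE x in lebesgue_on \<Omega>. \<forall>n. \<forall>\<xi>. \<alpha> * (norm \<xi>)\<^sup>2 \<le>
        (\<Sum>i\<in>UNIV. \<Sum>j\<in>UNIV. a (s n) x $ i $ j * \<xi> $ i * \<xi> $ j)"
      using s(3) by (subst AE_all_countable) (simp add: elliptic_slice_def)
    have m: "(\<lambda>x. a t x $ i $ j) \<in> borel_measurable (lebesgue_on \<Omega>)" for i j
    proof (rule borel_measurable_lebesgue_on_AE_limit[OF \<Omega>])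
      show "(\<lambda>x. a (s n) x $ i $ j) \<in> borel_measurable (lebesgue_on \<Omega>)" for n
        using s(3)[of n] by (simp add: elliptic_slice_def bounded_matrix_def)
      show "AE x in lebesgue_on \<Omega>. (\<lambda>n. a (s n) x $ i $ j) \<longlonglongrightarrow> a t x $ i $ j"
        using conv by eventually_elim blast
    qed
    have "AE x in lebesgue_on \<Omega>. \<forall>i j. \<bar>a t x $ i $ j\<bar> \<le> B"
      using conv bd
    proof eventually_elim
      case (elim x)
      show ?case
      proof (intro allI)
        fix i j
        have "(\<lambda>n. \<bar>a (s n) x $ i $ j\<bar>) \<longlonglongrightarrow> \<bar>a t x $ i $ j\<bar>"
          using elim(1) by (intro tendsto_rabs) blast
        then show "\<bar>a t x $ i $ j\<bar> \<le> B"
          by (rule LIMSEQ_le_const2) (use elim(2) in blast)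
      qed
    qed
    moreover have "AE x in lebesgue_on \<Omega>. \<forall>i j. a t x $ i $ j = a t x $ j $ i"
      using conv sy
    proof eventually_elim
      case (elim x)
      show ?case
      proof (intro allI)
        fix i j
        have "(\<lambda>n. a (s n) x $ i $ j) = (\<lambda>n. a (s n) x $ j $ i)" using elim(2) by blast
        moreover have "(\<lambda>n. a (s n) x $ i $ j) \<longlonglongrightarrow> a t x $ i $ j"
          "(\<lambda>n. a (s n) x $ j $ i) \<longlonglongrightarrow> a t x $ j $ i"
          using elim(1) by blast+
        ultimately show "a t x $ i $ j = a t x $ j $ i" using LIMSEQ_unique by simp
      qed
    qed
    moreover have "AE x in lebesgue_on \<Omega>. \<forall>\<xi>. \<alpha> * (norm \<xi>)\<^sup>2 \<le>
        (\<Sum>i\<in>UNIV. \<Sum>j\<in>UNIV. a t x $ i $ j * \<xi> $ i * \<xi> $ j)"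
      using conv el
    proof eventually_elim
      case (elim x)
      show ?case
      proof
        fix \<xi> :: "real^'d"
        have "(\<lambda>n. \<Sum>i\<in>UNIV. \<Sum>j\<in>UNIV. a (s n) x $ i $ j * \<xi> $ i * \<xi> $ j)
            \<longlonglongrightarrow> (\<Sum>i\<in>UNIV. \<Sum>j\<in>UNIV. a t x $ i $ j * \<xi> $ i * \<xi> $ j)"
          using elim(1) by (intro tendsto_sum tendsto_mult tendsto_const) blast
        then show "\<alpha> * (norm \<xi>)\<^sup>2 \<le> (\<Sum>i\<in>UNIV. \<Sum>j\<in>UNIV. a t x $ i $ j * \<xi> $ i * \<xi> $ j)"
          by (rule LIMSEQ_le_const) (use elim(2) in auto)
      qed
    qed
    ultimately show ?thesis
      using m s(3)[of 0] by (simp add: elliptic_slice_def bounded_matrix_def)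
  qed
  then show ?thesis by blast
qed

definition coeff_bound :: real where "coeff_bound = (SOME B. \<forall>t\<in>{0..T}. elliptic_slice B t)"

lemma slice_properties:
  assumes "t \<in> {0..T}"
  shows "bounded_matrix (a t) coeff_bound"
    and "AE x in lebesgue_on \<Omega>. \<forall>i j. a t x $ i $ j = a t x $ j $ i"
    and "AE x in lebesgue_on \<Omega>. \<forall>\<xi>. \<alpha> * (norm \<xi>)\<^sup>2 \<le> (\<Sum>i\<in>UNIV. \<Sum>j\<in>UNIV. a t x $ i $ j * \<xi> $ i * \<xi> $ j)"
  using someI_ex[OF elliptic_slice_all, folded coeff_bound_def] assms by (auto simp: elliptic_slice_def)

lemma coeff_bound_nonneg: "0 \<le> coeff_bound"
  using slice_properties(1)[of 0] T by (simp add: bounded_matrix_def)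

lemma \<omega>_nonneg: "t \<in> {0..T} \<Longrightarrow> 0 \<le> \<omega> t"
  using modulus by (simp add: admissible_modulus_def)

lemma mform_time_diff:
  assumes t: "t1 \<in> {0..T}" "t2 \<in> {0..T}" and u: "u \<in> H1 \<Omega>" and v: "v \<in> H1 \<Omega>"
  shows "\<bar>mform (a t1) u v - mform (a t2) u v\<bar> \<le> \<omega> \<bar>t1 - t2\<bar> * (grad_sum u * grad_sum v)"
proof -
  have "\<bar>t1 - t2\<bar> \<in> {0..T}" using t by auto
  moreover have "(\<lambda>x. (a t1 x - a t2 x) $ i $ j) \<in> borel_measurable (lebesgue_on \<Omega>)" for i j
    using slice_properties(1)[OF t(1)] slice_properties(1)[OF t(2)]
    by (auto simp: bounded_matrix_def intro!: borel_measurable_diff)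
  moreover have "AE x in lebesgue_on \<Omega>. \<forall>i j. \<bar>(a t1 x - a t2 x) $ i $ j\<bar> \<le> \<omega> \<bar>t1 - t2\<bar>"
    using coeff t unfolding admissible_coefficients_def by simp
  ultimately have "bounded_matrix (\<lambda>x. a t1 x - a t2 x) (\<omega> \<bar>t1 - t2\<bar>)"
    by (simp add: bounded_matrix_def \<omega>_nonneg)
  from mform_bound[OF this u v] show ?thesis
    by (simp add: mform_diff[OF slice_properties(1)[OF t(1)] slice_properties(1)[OF t(2)] u v])
qed

text \<open>
  Dominated convergence applies because the coefficients are continuous in time at almost every point
  and uniformly bounded.
\<close>

lemma mform_continuous:
  assumes u: "u \<in> H1 \<Omega>" and v: "v \<in> H1 \<Omega>"
  shows "continuous_on {0..T} (\<lambda>t. mform (a t) u v)"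
proof (unfold continuous_on_sequentially comp_def, intro ballI allI impI, elim conjE)
  fix t s assume t: "t \<in> {0..T}" and s: "\<forall>n. s n \<in> {0..T}" and st: "s \<longlonglongrightarrow> t"
  define w where "w x = (\<Sum>i\<in>UNIV. \<Sum>j\<in>UNIV. coeff_bound * (\<bar>D i u x\<bar> * \<bar>D j v x\<bar>))" for x
  show "(\<lambda>n. mform (a (s n)) u v) \<longlonglongrightarrow> mform (a t) u v"
    unfolding mform_def
  proof (rule integral_dominated_convergence[where w = w])
    show "(\<lambda>x. energy_density (a t) u v x)
        \<in> borel_measurable (lebesgue_on \<Omega>)"
      by (rule borel_measurable_integrable) (rule mform_integrable[OF slice_properties(1)[OF t] u v])
    show "(\<lambda>x. energy_density (a (s n)) u v x)
        \<in> borel_measurable (lebesgue_on \<Omega>)" for n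
      by (rule borel_measurable_integrable) (rule mform_integrable[OF slice_properties(1) u v], use s in auto)
    have "integrable (lebesgue_on \<Omega>) (\<lambda>x. \<bar>D i u x\<bar> * \<bar>D j v x\<bar>)" for i j
      using integrable_abs[OF integrable_L2_mult[OF weak_partial_L2[OF u] weak_partial_L2[OF v]]]
      by (simp add: abs_mult)
    then show "integrable (lebesgue_on \<Omega>) w" unfolding w_def by simp
    have "AE x in lebesgue_on \<Omega>. \<forall>i j. continuous_on {0..T} (\<lambda>t. a t x $ i $ j)"
      using coeff unfolding admissible_coefficients_def by blast
    then show "AE x in lebesgue_on \<Omega>. (\<lambda>n. energy_density (a (s n)) u v x)
      \<longlonglongrightarrow> energy_density (a t) u v x"
    proof eventually_elim
      case (elim x)
      have "(\<lambda>n. a (s n) x $ i $ j) \<longlonglongrightarrow> a t x $ i $ j" for i j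
        by (rule continuous_on_tendsto_compose[of "{0..T}" "\<lambda>t. a t x $ i $ j" s t])
          (use elim t s st in auto)
      then show ?case by (intro tendsto_sum tendsto_mult tendsto_const)
    qed
    show "AE x in lebesgue_on \<Omega>. norm (energy_density (a (s n)) u v x) \<le> w x" for n
    proof -
      have "AE x in lebesgue_on \<Omega>. \<forall>i j. \<bar>a (s n) x $ i $ j\<bar> \<le> coeff_bound"
        using slice_properties(1)[of "s n"] s by (simp add: bounded_matrix_def)
      then show ?thesis
      proof eventually_elim
        case (elim x)
        have "norm (energy_density (a (s n)) u v x)
            \<le> (\<Sum>i\<in>UNIV. \<Sum>j\<in>UNIV. norm (a (s n) x $ i $ j * D i u x * D j v x))"
          by (rule order_trans[OF norm_sum]) (intro sum_mono norm_sum)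
        also have "\<dots> \<le> w x"
          unfolding w_def using elim
          by (intro sum_mono) (simp add: abs_mult mult.assoc mult_right_mono)
        finally show ?case .
      qed
    qed
  qed
qed

definition avg_form :: "real \<Rightarrow> real \<Rightarrow> (real^'d \<Rightarrow> real) \<Rightarrow> (real^'d \<Rightarrow> real) \<Rightarrow> real" where
  "avg_form l r u v = 1 / (r - l) * (\<integral>t. mform (a t) u v \<partial>lebesgue_on {l<..r})"

lemma mform_time_integrable:
  assumes "0 \<le> l" "r \<le> T" "u \<in> H1 \<Omega>" "v \<in> H1 \<Omega>"
  shows "integrable (lebesgue_on {l<..r}) (\<lambda>t. mform (a t) u v)"
  using continuous_imp_integrable_real[OF mform_continuous[OF assms(3,4)]]
  by (rule integrable_lebesgue_on_subset) (use assms in auto)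

context
  fixes l r assumes lr: "0 \<le> l" "l < r" "r \<le> T"
begin

lemma avg_form_semi_inner: "semi_inner (H10 \<Omega>) (avg_form l r)"
proof
  have inT: "t \<in> {0..T}" if "t \<in> {l<..r}" for t using that lr by auto
  note int = mform_time_integrable[OF lr(1,3)]
  fix u v w :: "real^'d \<Rightarrow> real" and c :: real
  assume u: "u \<in> H10 \<Omega>" and v: "v \<in> H10 \<Omega>"
  note u' = H10_H1[OF u] and v' = H10_H1[OF v]
  have "(\<integral>t. mform (a t) (c *\<^sub>R u) v \<partial>lebesgue_on {l<..r}) = (\<integral>t. c * mform (a t) u v \<partial>lebesgue_on {l<..r})"
    by (rule Bochner_Integration.integral_cong[OF refl])
      (rule mform_scale_left[OF slice_properties(1)[OF inT] u' v'], simp)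
  then show "avg_form l r (c *\<^sub>R u) v = c * avg_form l r u v" by (simp add: avg_form_def)
  have "(\<integral>t. mform (a t) u v \<partial>lebesgue_on {l<..r}) = (\<integral>t. mform (a t) v u \<partial>lebesgue_on {l<..r})"
    by (rule Bochner_Integration.integral_cong[OF refl])
      (rule mform_sym[OF slice_properties(1)[OF inT] u' v' slice_properties(2)[OF inT]], simp_all)
  then show "avg_form l r u v = avg_form l r v u" by (simp add: avg_form_def)
  assume w: "w \<in> H10 \<Omega>"
  note w' = H10_H1[OF w]
  have "(\<integral>t. mform (a t) (u + v) w \<partial>lebesgue_on {l<..r})
      = (\<integral>t. mform (a t) u w + mform (a t) v w \<partial>lebesgue_on {l<..r})"
    by (rule Bochner_Integration.integral_cong[OF refl])
      (rule mform_add_left[OF slice_properties(1)[OF inT] u' v' w'], simp)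
  then show "avg_form l r (u + v) w = avg_form l r u w + avg_form l r v w"
    using int u' v' w' by (simp add: avg_form_def distrib_left)
next
  fix u assume u: "u \<in> H10 \<Omega>"
  note u' = H10_H1[OF u]
  show "0 \<le> avg_form l r u u"
    unfolding avg_form_def
  proof (rule average_ge[OF lr(2) mform_time_integrable[OF lr(1,3) u' u']])
    fix t assume "t \<in> {l<..r}"
    then have "t \<in> {0..T}" using lr by auto
    from mform_coercive[OF slice_properties(1)[OF this] u' slice_properties(3)[OF this]]
    show "0 \<le> mform (a t) u u"
      using \<alpha> by (meson order_trans mult_nonneg_nonneg less_imp_le sum_nonneg zero_le_power2)
  qed
qed (rule subspace_H10)

lemma avg_form_coercive:
  assumes u: "u \<in> H1 \<Omega>"
  shows "\<alpha> * (\<Sum>i\<in>UNIV. (L2_norm \<Omega> (D i u))\<^sup>2) \<le> avg_form l r u u"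
  unfolding avg_form_def
  by (rule average_ge[OF lr(2) mform_time_integrable[OF lr(1,3) u u]])
    (use lr in \<open>auto intro!: mform_coercive[OF slice_properties(1) u slice_properties(3)]\<close>)

lemma grad_sum_le_avg_form:
  assumes u: "u \<in> H1 \<Omega>"
  shows "grad_sum u \<le> sqrt (real CARD('d) / \<alpha>) * sqrt (avg_form l r u u)"
proof -
  have "(grad_sum u)\<^sup>2 \<le> real CARD('d) / \<alpha> * (\<alpha> * (\<Sum>i\<in>UNIV. (L2_norm \<Omega> (D i u))\<^sup>2))"
    using grad_sum_sq[of u] \<alpha> by simp
  also have "\<dots> \<le> real CARD('d) / \<alpha> * avg_form l r u u"
    using \<alpha> by (intro mult_left_mono avg_form_coercive[OF u]) auto
  finally show ?thesis
    unfolding real_sqrt_mult[symmetric] by (rule real_le_rsqrt)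
qed

lemma avg_form_upper:
  assumes u: "u \<in> H1 \<Omega>"
  shows "avg_form l r u u \<le> coeff_bound * real CARD('d) * H1_inner u u"
proof -
  have "avg_form l r u u \<le> coeff_bound * (grad_sum u)\<^sup>2"
    unfolding avg_form_def
  proof (rule average_le[OF lr(2) mform_time_integrable[OF lr(1,3) u u]])
    fix t assume "t \<in> {l<..r}"
    then have "t \<in> {0..T}" using lr by auto
    from mform_bound[OF slice_properties(1)[OF this] u u]
    show "mform (a t) u u \<le> coeff_bound * (grad_sum u)\<^sup>2" by (simp add: power2_eq_square)
  qed
  also have "\<dots> \<le> coeff_bound * (real CARD('d) * (\<Sum>i\<in>UNIV. (L2_norm \<Omega> (D i u))\<^sup>2))"
    using grad_sum_sq coeff_bound_nonneg by (intro mult_left_mono)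
  also have "\<dots> \<le> coeff_bound * (real CARD('d) * H1_inner u u)"
    using coeff_bound_nonneg H1_inner_nrm_sq[OF u] H1.nrm_sq[OF u] by (intro mult_left_mono) auto
  finally show ?thesis by (simp add: mult.assoc)
qed

lemma avg_form_resolvable: "resolvable (avg_form l r)"
  by (rule coercive_resolvable[OF avg_form_semi_inner \<alpha>])
    (use avg_form_coercive avg_form_upper H10_H1 in auto)

end

text \<open>
  Two times in the intervals are at most \<open>r' - l\<close> apart, and \<open>\<omega>\<close> is monotone; averaging over both
  intervals preserves the bound.
\<close>

lemma avg_form_diff:
  assumes lr: "0 \<le> l" "l < r" "r \<le> l'" "l' < r'" "r' \<le> T" and u: "u \<in> H1 \<Omega>" and v: "v \<in> H1 \<Omega>"
  shows "\<bar>avg_form l' r' u v - avg_form l r u v\<bar> \<le> \<omega> (r' - l) * (grad_sum u * grad_sum v)"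
proof -
  define E where "E = \<omega> (r' - l) * (grad_sum u * grad_sum v)"
  have mono: "\<omega> s \<le> \<omega> (r' - l)" if "0 \<le> s" "s \<le> r' - l" for s
    using modulus that lr by (auto simp: admissible_modulus_def intro: mono_onD)
  have pt: "\<bar>mform (a t) u v - mform (a s) u v\<bar> \<le> E" if "t \<in> {l'<..r'}" "s \<in> {l<..r}" for t s
  proof -
    have "\<bar>mform (a t) u v - mform (a s) u v\<bar> \<le> \<omega> \<bar>t - s\<bar> * (grad_sum u * grad_sum v)"
      using that lr by (intro mform_time_diff u v) auto
    also have "\<dots> \<le> E"
      unfolding E_def using that lr by (intro mult_right_mono mono) auto
    finally show ?thesis .
  qed
  have int: "integrable (lebesgue_on {l<..r}) (\<lambda>t. mform (a t) u v)"
    "integrable (lebesgue_on {l'<..r'}) (\<lambda>t. mform (a t) u v)"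
    using lr by (auto intro!: mform_time_integrable u v)
  have in1: "avg_form l r u v \<le> mform (a t) u v + E" "mform (a t) u v - E \<le> avg_form l r u v"
    if t: "t \<in> {l'<..r'}" for t
  proof -
    show "avg_form l r u v \<le> mform (a t) u v + E"
      unfolding avg_form_def by (rule average_le[OF lr(2) int(1)], drule pt[OF t], linarith)
    show "mform (a t) u v - E \<le> avg_form l r u v"
      unfolding avg_form_def by (rule average_ge[OF lr(2) int(1)], drule pt[OF t], linarith)
  qed
  have "avg_form l' r' u v \<le> avg_form l r u v + E"
    unfolding avg_form_def[of l'] by (rule average_le[OF lr(4) int(2)], drule in1(2), linarith)
  moreover have "avg_form l r u v - E \<le> avg_form l' r' u v"
    unfolding avg_form_def[of l'] by (rule average_ge[OF lr(4) int(2)], drule in1(1), linarith)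
  ultimately show ?thesis by (simp add: E_def abs_le_iff)
qed

end

section \<open>Sums over a mesh\<close>

lemma set_integral_step_lower:
  fixes h :: "real \<Rightarrow> real"
  assumes ab: "0 < a" "a < b" "b \<le> T"
    and nonneg: "\<And>s. s \<in> {0<..T} \<Longrightarrow> 0 \<le> h s" and anti: "antimono_on {0<..T} h"
    and int: "set_integrable lebesgue {0<..<T} h"
  shows "(LINT s:{0<..<a}|lebesgue. h s) + (b - a) * h b \<le> (LINT s:{0<..<b}|lebesgue. h s)"
proof -
  have sub: "set_integrable lebesgue A h" if "A \<in> sets lebesgue" "A \<subseteq> {0<..<T}" for A
    using int that by (rule set_integrable_subset)
  have i: "set_integrable lebesgue {0<..<a} h" "set_integrable lebesgue {a<..<b} h"
    "set_integrable lebesgue ({0<..<a} \<union> {a<..<b}) h" "set_integrable lebesgue {0<..<b} h"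
    using ab by (auto intro!: sub)
  have c: "set_integrable lebesgue {a<..<b} (\<lambda>_. h b)"
    unfolding set_integrable_def using ab
    by (auto intro!: integrable_mult_left integrable_real_indicator)
  have "(b - a) * h b = (LINT s:{a<..<b}|lebesgue. h b)"
    using ab by (simp add: set_lebesgue_integral_def)
  also have "\<dots> \<le> (LINT s:{a<..<b}|lebesgue. h s)"
    using ab by (intro set_integral_mono c i) (auto intro!: monotone_onD[OF anti])
  also have "(LINT s:{0<..<a}|lebesgue. h s) + \<dots> = (LINT s:{0<..<a} \<union> {a<..<b}|lebesgue. h s)"
    using i by (subst set_integral_Un) auto
  also have "\<dots> \<le> (LINT s:{0<..<b}|lebesgue. h s)"
    unfolding set_lebesgue_integral_def
    using i(3,4) ab nonneg unfolding set_integrable_def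
    by (intro integral_mono) (auto simp: indicator_def)
  finally show ?thesis by simp
qed

text \<open>
  A function that decreases is bounded below on each interval by its value at the right end. The
  first node is positive and the integral extends over an open interval, since \<open>h\<close> may be singular
  at 0.
\<close>

lemma right_sums_le_integral:
  fixes h :: "real \<Rightarrow> real" and \<sigma> :: "nat \<Rightarrow> real"
  assumes \<sigma>: "\<And>m. \<lbrakk>i < m; m \<le> M\<rbrakk> \<Longrightarrow> \<sigma> (m - 1) < \<sigma> m" "0 < \<sigma> i" "i \<le> M" "\<sigma> M \<le> T"
    and nonneg: "\<And>s. s \<in> {0<..T} \<Longrightarrow> 0 \<le> h s" and anti: "antimono_on {0<..T} h"
    and int: "set_integrable lebesgue {0<..<T} h"
  shows "(\<Sum>m=Suc i..M. (\<sigma> m - \<sigma> (m - 1)) * h (\<sigma> m)) \<le> (LINT s:{0<..<T}|lebesgue. h s)"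
proof -
  have mono: "\<sigma> m \<le> \<sigma> n" if "i \<le> m" "m \<le> n" "n \<le> M" for m n
    using that(2,3)
  proof (induction n rule: dec_induct)
    case (step n)
    then show ?case using \<sigma>(1)[of "Suc n"] that(1) by simp
  qed simp
  have le_T: "(LINT s:A|lebesgue. h s) \<le> (LINT s:{0<..<T}|lebesgue. h s)"
    if "A \<in> sets lebesgue" "A \<subseteq> {0<..<T}" for A
    unfolding set_lebesgue_integral_def
    using set_integrable_subset[OF int that] int that(2) nonneg unfolding set_integrable_def
    by (intro integral_mono) (auto simp: indicator_def)
  have "(\<Sum>m=Suc i..n. (\<sigma> m - \<sigma> (m - 1)) * h (\<sigma> m)) \<le> (LINT s:{0<..<\<sigma> n}|lebesgue. h s)"
    if "i \<le> n" "n \<le> M" for n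
    using that
  proof (induction n rule: dec_induct)
    case base
    have "\<sigma> i \<le> T" using mono[of i M] \<sigma> by simp
    then show ?case
      using nonneg by (auto simp: set_lebesgue_integral_def indicator_def intro!: integral_nonneg)
  next
    case (step n)
    have "0 < \<sigma> n" "\<sigma> n < \<sigma> (Suc n)" "\<sigma> (Suc n) \<le> T"
      using \<sigma>(1)[of "Suc n"] mono[of i n] mono[of "Suc n" M] \<sigma> step by auto
    from set_integral_step_lower[OF this nonneg anti int]
    show ?case using step by simp
  qed
  from this[of M] show ?thesis
    using le_T[of "{0<..<\<sigma> M}"] \<sigma>(3,4) by force
qed

text \<open>
  The first summand is 1. The others are of the form \<open>1 - x / y\<close>, hence at most \<open>ln y - ln x\<close>, and
  telescope.
\<close>

lemma step_ratio_sum_le_ln: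
  fixes \<tau> :: "nat \<Rightarrow> real"
  assumes \<tau>: "\<And>m. \<lbrakk>1 \<le> m; m \<le> M\<rbrakk> \<Longrightarrow> \<tau> (m - 1) < \<tau> m" and i: "1 \<le> i" "i \<le> M"
  shows "(\<Sum>m=i..M. step \<tau> m / (\<tau> m - \<tau> (i - 1))) \<le> 1 + ln ((\<tau> M - \<tau> (i - 1)) / step \<tau> i)"
proof -
  have pos: "\<tau> (i - 1) < \<tau> n" if "i \<le> n" "n \<le> M" for n
    using that
  proof (induction n rule: dec_induct)
    case base
    then show ?case using \<tau>[of i] i by simp
  next
    case (step n)
    then show ?case using \<tau>[of "Suc n"] i by simp
  qed
  have "(\<Sum>m=i..n. step \<tau> m / (\<tau> m - \<tau> (i - 1))) \<le> 1 + ln ((\<tau> n - \<tau> (i - 1)) / step \<tau> i)"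
    if "i \<le> n" "n \<le> M" for n
    using that
  proof (induction n rule: dec_induct)
    case base
    then show ?case using \<tau>[of i] i by (simp add: step_def)
  next
    case (step n)
    define x where "x = \<tau> n - \<tau> (i - 1)"
    define y where "y = \<tau> (Suc n) - \<tau> (i - 1)"
    have xy: "0 < x" "x < y" using pos[of n] \<tau>[of "Suc n"] step i by (auto simp: x_def y_def)
    have k: "0 < step \<tau> i" using \<tau>[of i] i by (simp add: step_def)
    have "ln (x / y) \<le> x / y - 1" using xy by (intro ln_le_minus_one) simp
    then have "(y - x) / y \<le> ln y - ln x" using xy by (simp add: ln_div diff_divide_distrib)
    then have "step \<tau> (Suc n) / y \<le> ln y - ln x" by (simp add: step_def x_def y_def)
    moreover have "(\<Sum>m=i..Suc n. step \<tau> m / (\<tau> m - \<tau> (i - 1)))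
        = (\<Sum>m=i..n. step \<tau> m / (\<tau> m - \<tau> (i - 1))) + step \<tau> (Suc n) / y"
      using step(1) by (simp add: y_def)
    moreover have "(\<Sum>m=i..n. step \<tau> m / (\<tau> m - \<tau> (i - 1))) \<le> 1 + (ln x - ln (step \<tau> i))"
      using step xy k by (simp add: ln_div x_def)
    moreover have "ln (y / step \<tau> i) = ln y - ln (step \<tau> i)" using xy k by (simp add: ln_div)
    ultimately show ?case unfolding y_def[symmetric] by linarith
  qed
  then show ?thesis using i by simp
qed

section \<open>Time integrals of the data\<close>

context open_domain
begin

lemma L2_inner_time_measurable:
  assumes f: "f \<in> bochner_Lp 1 S (L2 \<Omega>) (L2_norm \<Omega>)" and S: "S \<in> sets lebesgue" and v: "v \<in> L2 \<Omega>"
  shows "(\<lambda>t. L2_inner \<Omega> (f t) v) \<in> borel_measurable (lebesgue_on S)"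
proof -
  obtain s where s: "\<And>n. simple_function (lebesgue_on S) (s n)" "\<And>n t. t \<in> S \<Longrightarrow> s n t \<in> L2 \<Omega>"
    and lim: "AE t in lebesgue_on S. (\<lambda>n. L2_norm \<Omega> (\<lambda>x. s n t x - f t x)) \<longlonglongrightarrow> 0"
    and fL: "AE t in lebesgue_on S. f t \<in> L2 \<Omega>"
    using f unfolding bochner_Lp_def by blast
  show ?thesis
  proof (rule borel_measurable_lebesgue_on_AE_limit[OF S])
    show "(\<lambda>t. L2_inner \<Omega> (s n t) v) \<in> borel_measurable (lebesgue_on S)" for n
      by (rule borel_measurable_simple_function) (rule simple_function_compose1[OF s(1)])
    show "AE t in lebesgue_on S. (\<lambda>n. L2_inner \<Omega> (s n t) v) \<longlonglongrightarrow> L2_inner \<Omega> (f t) v"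
      using lim fL AE_space
    proof eventually_elim
      case (elim t)
      then have "(\<lambda>n. L2.nrm \<Omega> (s n t - f t)) \<longlonglongrightarrow> 0" by (simp add: L2_norm_eq fun_diff_def)
      then show ?case using elim s(2) v by (intro L2_inner_limit) auto
    qed
  qed
qed

text \<open>
  The integral of an \<open>L2\<close>-valued function is obtained from the Riesz theorem as the vector that represents
  the integrated scalar products; the bound for its norm is the triangle inequality for integrals.
\<close>

lemma L2_time_integral:
  assumes f: "f \<in> bochner_Lp 1 S (L2 \<Omega>) (L2_norm \<Omega>)" and S: "S \<in> sets lebesgue" and I: "I \<in> sets lebesgue"
  shows "\<exists>F\<in>L2 \<Omega>. (\<forall>v\<in>L2 \<Omega>. L2_inner \<Omega> F v = (\<integral>t. indicator I t * L2_inner \<Omega> (f t) v \<partial>lebesgue_on S)) \<and>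
    L2_norm \<Omega> F \<le> (\<integral>t. indicator I t * L2_norm \<Omega> (f t) \<partial>lebesgue_on S)"
proof -
  let ?M = "lebesgue_on S"
  have fL: "AE t in ?M. f t \<in> L2 \<Omega>" and fi: "integrable ?M (\<lambda>t. L2_norm \<Omega> (f t))"
    using f by (auto simp: bochner_Lp_def)
  have I_meas: "(indicator I :: real \<Rightarrow> real) \<in> borel_measurable ?M"
    using I by (intro measurable_restrict_space1) simp
  define N where "N = (\<integral>t. indicator I t * L2_norm \<Omega> (f t) \<partial>?M)"
  define l where "l v = (\<integral>t. indicator I t * L2_inner \<Omega> (f t) v \<partial>?M)" for v
  have Ni: "integrable ?M (\<lambda>t. indicator I t * L2_norm \<Omega> (f t))"
  proof (rule Bochner_Integration.integrable_bound[OF fi])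
    show "(\<lambda>t. indicator I t * L2_norm \<Omega> (f t)) \<in> borel_measurable ?M"
      by (intro borel_measurable_times I_meas borel_measurable_integrable[OF fi])
  qed (simp add: indicator_def)
  have le: "AE t in ?M. \<bar>indicator I t * L2_inner \<Omega> (f t) v\<bar> \<le> indicator I t * L2_norm \<Omega> (f t) * L2_norm \<Omega> v"
    if v: "v \<in> L2 \<Omega>" for v
    using fL by eventually_elim (use L2.Cauchy_Schwarz[OF _ v, folded L2_norm_eq] in \<open>simp add: indicator_def\<close>)
  have li: "integrable ?M (\<lambda>t. indicator I t * L2_inner \<Omega> (f t) v)" if v: "v \<in> L2 \<Omega>" for v
  proof (rule Bochner_Integration.integrable_bound)
    show "integrable ?M (\<lambda>t. indicator I t * L2_norm \<Omega> (f t) * L2_norm \<Omega> v)" using Ni by simp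
    show "(\<lambda>t. indicator I t * L2_inner \<Omega> (f t) v) \<in> borel_measurable ?M"
      by (intro borel_measurable_times I_meas L2_inner_time_measurable[OF f S v])
    show "AE t in ?M. norm (indicator I t * L2_inner \<Omega> (f t) v) \<le> norm (indicator I t * L2_norm \<Omega> (f t) * L2_norm \<Omega> v)"
      using le[OF v] by eventually_elim simp
  qed
  have bound: "\<bar>l v\<bar> \<le> N * L2_norm \<Omega> v" if v: "v \<in> L2 \<Omega>" for v
  proof -
    have "\<bar>l v\<bar> \<le> (\<integral>t. \<bar>indicator I t * L2_inner \<Omega> (f t) v\<bar> \<partial>?M)"
      unfolding l_def by (rule integral_abs_bound)
    also have "\<dots> \<le> (\<integral>t. indicator I t * L2_norm \<Omega> (f t) * L2_norm \<Omega> v \<partial>?M)"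
      using li[OF v] Ni le[OF v] by (intro integral_mono_AE) auto
    finally show ?thesis by (simp add: N_def)
  qed
  have "\<exists>F\<in>L2 \<Omega>. \<forall>v\<in>L2 \<Omega>. l v = L2_inner \<Omega> F v"
  proof (rule L2.Riesz_representation[OF L2_complete])
    fix u v :: "real^'d \<Rightarrow> real" assume uv: "u \<in> L2 \<Omega>" "v \<in> L2 \<Omega>"
    have "l (u + v) = (\<integral>t. indicator I t * L2_inner \<Omega> (f t) u + indicator I t * L2_inner \<Omega> (f t) v \<partial>?M)"
      unfolding l_def
    proof (rule integral_cong_AE)
      show "AE t in ?M. indicator I t * L2_inner \<Omega> (f t) (u + v) =
          indicator I t * L2_inner \<Omega> (f t) u + indicator I t * L2_inner \<Omega> (f t) v"
        using fL by eventually_elim (use uv in \<open>simp add: L2.bilinear distrib_left\<close>)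
    qed (use uv in \<open>auto intro!: borel_measurable_integrable li Bochner_Integration.integrable_add\<close>)
    then show "l (u + v) = l u + l v" using li uv by (simp add: l_def)
  next
    fix u :: "real^'d \<Rightarrow> real" and r assume u: "u \<in> L2 \<Omega>"
    have "l (r *\<^sub>R u) = (\<integral>t. r * (indicator I t * L2_inner \<Omega> (f t) u) \<partial>?M)"
      unfolding l_def
    proof (rule integral_cong_AE)
      show "AE t in ?M. indicator I t * L2_inner \<Omega> (f t) (r *\<^sub>R u) = r * (indicator I t * L2_inner \<Omega> (f t) u)"
        using fL by eventually_elim (use u in \<open>simp add: L2.bilinear\<close>)
    qed (use u in \<open>auto intro!: borel_measurable_integrable li integrable_mult_right\<close>)
    then show "l (r *\<^sub>R u) = r * l u" by (simp add: l_def)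
  qed (use bound in \<open>simp add: L2_norm_eq\<close>)
  then obtain F where F: "F \<in> L2 \<Omega>" "\<And>v. v \<in> L2 \<Omega> \<Longrightarrow> l v = L2_inner \<Omega> F v" by blast
  have N0: "0 \<le> N" unfolding N_def by (intro Bochner_Integration.integral_nonneg) simp
  have "L2_norm \<Omega> F * L2_norm \<Omega> F \<le> N * L2_norm \<Omega> F"
    using bound[OF F(1)] F(2)[OF F(1)] L2.nrm_sq[OF F(1)] by (simp add: L2_norm_eq power2_eq_square)
  then have "L2_norm \<Omega> F \<le> N"
    using N0 L2_norm_nonneg[of F] by (cases "L2_norm \<Omega> F = 0") (auto simp: less_le)
  then show ?thesis using F by (auto simp: l_def N_def)
qed

end

section \<open>The dG(0) scheme\<close>

locale dG0_problem = coefficients \<Omega> T \<alpha> \<omega> a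
  for \<Omega> :: "(real^'d) set" and T \<alpha> \<omega> a +
  fixes M :: nat and \<tau> :: "nat \<Rightarrow> real" and f :: "real \<Rightarrow> real^'d \<Rightarrow> real"
    and u0 :: "real^'d \<Rightarrow> real" and u :: "real \<Rightarrow> real^'d \<Rightarrow> real"
  assumes \<tau>_0: "\<tau> 0 = 0" and \<tau>_M: "\<tau> M = T"
    and \<tau>_step: "\<And>m. \<lbrakk>1 \<le> m; m \<le> M\<rbrakk> \<Longrightarrow> \<tau> (m - 1) < \<tau> m"
    and f: "f \<in> bochner_Lp 1 {0<..<T} (L2 \<Omega>) (L2_norm \<Omega>)" and u0: "u0 \<in> L2 \<Omega>"
    and sol: "dG0_solution \<Omega> T a M \<tau> f u0 u"
begin

lemma node_mono: "i \<le> j \<Longrightarrow> j \<le> M \<Longrightarrow> \<tau> i \<le> \<tau> j"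
proof (induction j rule: dec_induct)
  case (step n)
  then show ?case using \<tau>_step[of "Suc n"] by simp
qed simp

lemma interval_disjoint:
  assumes "t \<in> interval \<tau> m" "t \<in> interval \<tau> n" "m \<in> {1..M}" "n \<in> {1..M}"
  shows "m = n"
proof (rule ccontr)
  assume "m \<noteq> n"
  then consider "m \<le> n - 1" | "n \<le> m - 1" by linarith
  then show False
  proof cases
    case 1
    then have "\<tau> m \<le> \<tau> (n - 1)" by (rule node_mono) (use assms in auto)
    then show False using assms by (simp add: interval_def)
  next
    case 2
    then have "\<tau> n \<le> \<tau> (m - 1)" by (rule node_mono) (use assms in auto)
    then show False using assms by (simp add: interval_def)
  qed
qed

lemma interval_bounds:
  assumes m: "m \<in> {1..M}"
  shows "0 \<le> \<tau> (m - 1)" "\<tau> (m - 1) < \<tau> m" "\<tau> m \<le> T"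
  using node_mono[of 0 "m - 1"] node_mono[of m M] \<tau>_step[of m] m \<tau>_0 \<tau>_M by auto

lemma node_in_interval: "m \<in> {1..M} \<Longrightarrow> \<tau> m \<in> interval \<tau> m"
  using interval_bounds(2) by (simp add: interval_def)

lemma u_const: "m \<in> {1..M} \<Longrightarrow> t \<in> interval \<tau> m \<Longrightarrow> u t = piece \<tau> u m"
  using sol node_in_interval unfolding dG0_solution_def X_k0_def piece_def by blast

text \<open>
  Membership in \<open>H10\<close> is known for almost every time only, but the value is constant on an interval of
  positive length.
\<close>

lemma piece_H10:
  assumes m: "m \<in> {1..M}"
  shows "piece \<tau> u m \<in> H10 \<Omega>"
proof (rule ccontr)
  assume n: "piece \<tau> u m \<notin> H10 \<Omega>"
  note b = interval_bounds[OF m]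
  have "AE t in lebesgue_on {0<..<T}. u t \<in> H10 \<Omega>"
    using sol by (simp add: dG0_solution_def X_k0_def bochner_Lp_def)
  then have "AE t in lborel. t \<in> {0<..<T} \<longrightarrow> u t \<in> H10 \<Omega>"
    by (simp add: AE_restrict_space_iff AE_completion_iff)
  then have "AE t in lborel. t \<notin> {\<tau> (m - 1)<..<\<tau> m}"
    by eventually_elim (use n b u_const[OF m] in \<open>force simp: interval_def\<close>)
  then have "{\<tau> (m - 1)<..<\<tau> m} \<in> null_sets lborel" by (subst AE_iff_null_sets) auto
  then show False using b by (simp add: null_sets_def)
qed

lemma weak_partial_zero: "AE x in lebesgue_on \<Omega>. D i (\<lambda>x. 0) x = 0"
  using weak_partial_0_AE[of i] by (simp add: zero_fun_def)

lemma step_test_function: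
  assumes m: "m \<in> {1..M}" and v: "v \<in> H10 \<Omega>"
  shows "(\<lambda>t. if t \<in> interval \<tau> m then v else (\<lambda>x. 0)) \<in> X_k0 \<Omega> T M \<tau>" (is "?\<phi> \<in> _")
  unfolding X_k0_def bochner_Lp_def
proof (intro CollectI conjI ballI)
  have 0: "(\<lambda>x. 0) \<in> H10 \<Omega>" using subspace_0[OF subspace_H10] by (simp add: zero_fun_def)
  have meas: "interval \<tau> m \<in> sets lebesgue" by (simp add: interval_def)
  have norm0: "H1_norm \<Omega> (\<lambda>x. 0) = 0"
    using H1_norm_eq[OF H1_mem(1)] by (simp add: zero_fun_def[symmetric] H1.nrm_def)
  show "AE t in lebesgue_on {0<..<T}. ?\<phi> t \<in> H10 \<Omega>" using v 0 by simp
  show "\<exists>s. (\<forall>n. simple_function (lebesgue_on {0<..<T}) (s n) \<and> (\<forall>t\<in>{0<..<T}. s n t \<in> H10 \<Omega>)) \<and>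
      (AE t in lebesgue_on {0<..<T}. (\<lambda>n. H1_norm \<Omega> (\<lambda>x. s n t x - ?\<phi> t x)) \<longlonglongrightarrow> 0)"
  proof (intro exI[of _ "\<lambda>_. ?\<phi>"] conjI allI ballI)
    show "simple_function (lebesgue_on {0<..<T}) ?\<phi>"
      using meas by (intro simple_function_If_set simple_function_const) (auto simp: sets_restrict_space)
    show "?\<phi> t \<in> H10 \<Omega>" for t using v 0 by simp
    show "AE t in lebesgue_on {0<..<T}. (\<lambda>n. H1_norm \<Omega> (\<lambda>x. ?\<phi> t x - ?\<phi> t x)) \<longlonglongrightarrow> 0"
      by (simp add: norm0)
  qed
  have "finite_measure (lebesgue_on {0<..<T})"
    by (rule finite_measureI) (use T in \<open>simp add: emeasure_restrict_space\<close>)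
  then have "integrable (lebesgue_on {0<..<T}) (\<lambda>t. H1_norm \<Omega> v powr 2)"
    by (rule finite_measure.integrable_const)
  then have "integrable (lebesgue_on {0<..<T}) (\<lambda>t. indicator (interval \<tau> m) t *\<^sub>R (H1_norm \<Omega> v powr 2))"
  proof (rule Bochner_Integration.integrable_bound)
    show "(\<lambda>t. indicator (interval \<tau> m) t *\<^sub>R (H1_norm \<Omega> v powr 2)) \<in> borel_measurable (lebesgue_on {0<..<T})"
      using meas by (intro measurable_restrict_space1 borel_measurable_scaleR borel_measurable_indicator) auto
  qed (auto simp: indicator_def)
  moreover have "(\<lambda>t. H1_norm \<Omega> (?\<phi> t) powr 2) = (\<lambda>t. indicator (interval \<tau> m) t *\<^sub>R (H1_norm \<Omega> v powr 2))"
    by (auto simp: fun_eq_iff indicator_def norm0)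
  ultimately show "integrable (lebesgue_on {0<..<T}) (\<lambda>t. H1_norm \<Omega> (?\<phi> t) powr 2)" by simp
next
  fix n s t assume n: "n \<in> {1..M}" and s: "s \<in> interval \<tau> n" and t: "t \<in> interval \<tau> n"
  show "?\<phi> s = ?\<phi> t"
    using interval_disjoint[OF s _ n m] interval_disjoint[OF t _ n m] s t by auto
qed

text \<open>
  The value at index 0 is zero and not the initial value, which is moved to the load of the first step.
\<close>

definition nodal :: "nat \<Rightarrow> real^'d \<Rightarrow> real" where
  "nodal m = (if m = 0 then 0 else piece \<tau> u m)"

text \<open>
  The integral of \<open>f\<close> over the \<open>m\<close>-th interval, in the weak sense of \<open>L2_time_integral\<close>. Since \<open>f\<close> is a
  function on the open interval \<open>{0<..<T}\<close>, the last mesh interval loses its end point here, a null set.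
\<close>

definition load :: "nat \<Rightarrow> real^'d \<Rightarrow> real" where
  "load m = (SOME F. F \<in> L2 \<Omega> \<and>
    (\<forall>v\<in>L2 \<Omega>. L2_inner \<Omega> F v =
      (\<integral>t. indicator (interval \<tau> m) t * L2_inner \<Omega> (f t) v \<partial>lebesgue_on {0<..<T})) \<and>
    L2_norm \<Omega> F \<le> (\<integral>t. indicator (interval \<tau> m) t * L2_norm \<Omega> (f t) \<partial>lebesgue_on {0<..<T}))"

lemma load:
  shows "load m \<in> L2 \<Omega>"
    and "v \<in> L2 \<Omega> \<Longrightarrow> L2_inner \<Omega> (load m) v =
      (\<integral>t. indicator (interval \<tau> m) t * L2_inner \<Omega> (f t) v \<partial>lebesgue_on {0<..<T})"
    and "L2_norm \<Omega> (load m) \<le> (\<integral>t. indicator (interval \<tau> m) t * L2_norm \<Omega> (f t) \<partial>lebesgue_on {0<..<T})"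
proof -
  have "\<exists>F. F \<in> L2 \<Omega> \<and>
    (\<forall>v\<in>L2 \<Omega>. L2_inner \<Omega> F v =
      (\<integral>t. indicator (interval \<tau> m) t * L2_inner \<Omega> (f t) v \<partial>lebesgue_on {0<..<T})) \<and>
    L2_norm \<Omega> F \<le> (\<integral>t. indicator (interval \<tau> m) t * L2_norm \<Omega> (f t) \<partial>lebesgue_on {0<..<T})"
    using L2_time_integral[OF f, of "interval \<tau> m"] by (auto simp: interval_def)
  from someI_ex[OF this, folded load_def]
  show "load m \<in> L2 \<Omega>"
    and "v \<in> L2 \<Omega> \<Longrightarrow> L2_inner \<Omega> (load m) v =
      (\<integral>t. indicator (interval \<tau> m) t * L2_inner \<Omega> (f t) v \<partial>lebesgue_on {0<..<T})"
    and "L2_norm \<Omega> (load m) \<le> (\<integral>t. indicator (interval \<tau> m) t * L2_norm \<Omega> (f t) \<partial>lebesgue_on {0<..<T})"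
    by blast+
qed

lemma sum_load_le: "(\<Sum>m=1..M. L2_norm \<Omega> (load m)) \<le> bochner_Lp_norm 1 {0<..<T} (L2_norm \<Omega>) f"
proof -
  let ?M = "lebesgue_on {0<..<T}"
  have fi: "integrable ?M (\<lambda>t. L2_norm \<Omega> (f t))"
    using f by (simp add: bochner_Lp_def)
  have meas: "(indicator (interval \<tau> m) :: real \<Rightarrow> real) \<in> borel_measurable ?M" for m
    by (intro measurable_restrict_space1 borel_measurable_indicator) (simp add: interval_def)
  have int: "integrable ?M (\<lambda>t. indicator (interval \<tau> m) t * L2_norm \<Omega> (f t))" for m
  proof (rule Bochner_Integration.integrable_bound[OF fi])
    show "(\<lambda>t. indicator (interval \<tau> m) t * L2_norm \<Omega> (f t)) \<in> borel_measurable ?M"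
      by (intro borel_measurable_times meas borel_measurable_integrable[OF fi])
  qed (simp add: indicator_def)
  have one: "(\<Sum>m=1..M. indicator (interval \<tau> m) t) \<le> (1::real)" for t
  proof (cases "\<exists>m\<in>{1..M}. t \<in> interval \<tau> m")
    case True
    then obtain m where m: "m \<in> {1..M}" "t \<in> interval \<tau> m" by blast
    have "(\<Sum>n=1..M. indicator (interval \<tau> n) t) = (\<Sum>n=1..M. if n = m then 1 else (0::real))"
    proof (rule sum.cong[OF refl])
      fix n assume "n \<in> {1..M}"
      then have "t \<in> interval \<tau> n \<longleftrightarrow> n = m" using interval_disjoint[OF m(2) _ m(1)] m(2) by blast
      then show "indicator (interval \<tau> n) t = (if n = m then 1 else (0::real))"
        by (simp add: indicator_def)
    qed
    then show ?thesis using m(1) by simp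
  next
    case False
    then have "(\<Sum>m=1..M. indicator (interval \<tau> m) t) = (0::real)" by (intro sum.neutral) auto
    then show ?thesis by simp
  qed
  have "(\<Sum>m=1..M. L2_norm \<Omega> (load m))
      \<le> (\<Sum>m=1..M. \<integral>t. indicator (interval \<tau> m) t * L2_norm \<Omega> (f t) \<partial>?M)"
    by (intro sum_mono load)
  also have "\<dots> = (\<integral>t. (\<Sum>m=1..M. indicator (interval \<tau> m) t) * L2_norm \<Omega> (f t) \<partial>?M)"
    unfolding sum_distrib_right by (rule Bochner_Integration.integral_sum[symmetric]) (rule int)
  also have "\<dots> \<le> (\<integral>t. 1 * L2_norm \<Omega> (f t) \<partial>?M)"
  proof (rule integral_mono)
    show "integrable ?M (\<lambda>t. (\<Sum>m=1..M. indicator (interval \<tau> m) t) * L2_norm \<Omega> (f t))"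
      unfolding sum_distrib_right by (intro Bochner_Integration.integrable_sum int)
    show "(\<Sum>m=1..M. indicator (interval \<tau> m) t) * L2_norm \<Omega> (f t) \<le> 1 * L2_norm \<Omega> (f t)" for t
      by (rule mult_right_mono[OF one]) simp
  qed (simp add: fi)
  finally show ?thesis
    using Bochner_Integration.integral_nonneg[of ?M "\<lambda>t. L2_norm \<Omega> (f t)"]
    by (simp add: bochner_Lp_norm_def)
qed

lemma op_A_avg_eq: "op_A_avg \<Omega> a \<tau> m p v = avg_form (\<tau> (m - 1)) (\<tau> m) p v"
  by (simp add: op_A_avg_def op_A_def bilinear_form_def avg_form_def mform_def step_def interval_def)

text \<open>
  The scheme is tested with a function that equals \<open>v\<close> on one mesh interval and vanishes on the others.
\<close>

lemma step_equation:
  assumes m: "m \<in> {1..M}" and v: "v \<in> H10 \<Omega>"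
  shows "step \<tau> m * avg_form (\<tau> (m - 1)) (\<tau> m) (nodal m) v + L2_inner \<Omega> (nodal m - nodal (m - 1)) v
    = L2_inner \<Omega> (load m + (if m = 1 then u0 else 0)) v"
proof -
  let ?I = "interval \<tau> m" and ?M = "lebesgue_on {0<..<T}"
  let ?\<phi> = "\<lambda>t. if t \<in> ?I then v else (\<lambda>x. 0)"
  note b = interval_bounds[OF m]
  have vL: "v \<in> L2 \<Omega>" and vH: "v \<in> H1 \<Omega>" using v H10_H1 H1_L2 by auto
  have pH: "piece \<tau> u n \<in> H1 \<Omega>" "piece \<tau> u n \<in> L2 \<Omega>" if "n \<in> {1..M}" for n
    using piece_H10[OF that] H10_H1 H1_L2 by auto
  have I_meas: "?I \<in> sets lebesgue" by (simp add: interval_def)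
  have zero: "L2_inner \<Omega> w (\<lambda>x. 0) = 0" for w by (simp add: L2_inner_def)
  have piece_\<phi>: "piece \<tau> ?\<phi> n = (if n = m then v else (\<lambda>x. 0))" if "n \<in> {1..M}" for n
    using interval_disjoint[OF node_in_interval[OF that] _ that m] node_in_interval[OF m]
    by (auto simp: piece_def)
  have eq: "(\<integral>t. bilinear_form \<Omega> a t (u t) (?\<phi> t) \<partial>?M)
        + (\<Sum>n=2..M. L2_inner \<Omega> (\<lambda>x. piece \<tau> u n x - piece \<tau> u (n - 1) x) (piece \<tau> ?\<phi> n))
        + L2_inner \<Omega> (piece \<tau> u 1) (piece \<tau> ?\<phi> 1)
        = (\<integral>t. L2_inner \<Omega> (f t) (?\<phi> t) \<partial>?M) + L2_inner \<Omega> u0 (piece \<tau> ?\<phi> 1)"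
    by (rule bspec[OF conjunct2[OF sol[unfolded dG0_solution_def]] step_test_function[OF m v]])
  have bil0: "bilinear_form \<Omega> a t w (\<lambda>x. 0) = 0" for t w
    unfolding bilinear_form_def
  proof (rule integral_eq_zero_AE)
    have "AE x in lebesgue_on \<Omega>. \<forall>j\<in>UNIV. D j (\<lambda>x. 0) x = 0"
      using weak_partial_zero by (subst AE_finite_all) auto
    then show "AE x in lebesgue_on \<Omega>. (\<Sum>i\<in>UNIV. \<Sum>j\<in>UNIV.
        a t x $ i $ j * D i w x * D j (\<lambda>x. 0) x) = 0"
      by eventually_elim simp
  qed
  have form: "(\<integral>t. bilinear_form \<Omega> a t (u t) (?\<phi> t) \<partial>?M) = step \<tau> m * avg_form (\<tau> (m - 1)) (\<tau> m) (nodal m) v"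
  proof -
    define g where "g t = mform (a t) (piece \<tau> u m) v" for t
    have gi: "integrable (lebesgue_on ?I) g"
      unfolding g_def interval_def using b pH[OF m] vH by (intro mform_time_integrable) auto
    then have gi': "integrable lebesgue (\<lambda>t. if t \<in> ?I then g t else 0)"
      using I_meas by (simp add: Lebesgue_Measure.integrable_restrict_UNIV)
    have "(\<integral>t. bilinear_form \<Omega> a t (u t) (?\<phi> t) \<partial>?M) = (\<integral>t. (if t \<in> ?I then g t else 0) \<partial>?M)"
      using u_const[OF m] bil0
      by (intro Bochner_Integration.integral_cong) (auto simp: g_def mform_def bilinear_form_def)
    also have "\<dots> = (\<integral>t. (if t \<in> {0<..<T} then (if t \<in> ?I then g t else 0) else 0) \<partial>lebesgue)"
      by (subst Lebesgue_Measure.integral_restrict_UNIV) auto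
    also have "\<dots> = (\<integral>t. (if t \<in> ?I then g t else 0) \<partial>lebesgue)"
    proof (rule integral_cong_AE)
      have "AE t in lebesgue. t \<noteq> T" by (rule AE_completion) (rule AE_lborel_singleton)
      then show "AE t in lebesgue. (if t \<in> {0<..<T} then (if t \<in> ?I then g t else 0) else 0)
          = (if t \<in> ?I then g t else 0)"
        by eventually_elim (use b in \<open>auto simp: interval_def\<close>)
      have "integrable (lebesgue_on {0<..<T}) (\<lambda>t. if t \<in> ?I then g t else 0)"
        using gi' integrable_lebesgue_on_subset[of UNIV "\<lambda>t. if t \<in> ?I then g t else 0" "{0<..<T}"]
        by (simp add: lebesgue_on_UNIV_eq)
      then show "(\<lambda>t. if t \<in> {0<..<T} then (if t \<in> ?I then g t else 0) else 0) \<in> borel_measurable lebesgue"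
        by (subst borel_measurable_if) auto
    qed (use gi' in auto)
    also have "\<dots> = (\<integral>t. g t \<partial>lebesgue_on ?I)"
      using I_meas by (rule Lebesgue_Measure.integral_restrict_UNIV)
    also have "\<dots> = step \<tau> m * avg_form (\<tau> (m - 1)) (\<tau> m) (nodal m) v"
      using b m by (auto simp: avg_form_def g_def step_def interval_def nodal_def)
    finally show ?thesis .
  qed
  have data: "(\<integral>t. L2_inner \<Omega> (f t) (?\<phi> t) \<partial>?M) = L2_inner \<Omega> (load m) v"
    unfolding load(2)[OF vL] by (intro Bochner_Integration.integral_cong) (auto simp: zero)
  have M1: "1 \<in> {1..M}" using m by auto
  have sum: "(\<Sum>n=2..M. L2_inner \<Omega> (\<lambda>x. piece \<tau> u n x - piece \<tau> u (n - 1) x) (piece \<tau> ?\<phi> n))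
      = (if m = 1 then 0 else L2_inner \<Omega> (nodal m - nodal (m - 1)) v)"
  proof -
    have "(\<Sum>n=2..M. L2_inner \<Omega> (\<lambda>x. piece \<tau> u n x - piece \<tau> u (n - 1) x) (piece \<tau> ?\<phi> n))
        = (\<Sum>n=2..M. if n = m then L2_inner \<Omega> (nodal m - nodal (m - 1)) v else 0)"
      by (intro sum.cong) (auto simp: piece_\<phi> zero nodal_def fun_diff_def)
    also have "\<dots> = (if m = 1 then 0 else L2_inner \<Omega> (nodal m - nodal (m - 1)) v)"
      using m by auto
    finally show ?thesis .
  qed
  show ?thesis
  proof (cases "m = 1")
    case True
    then show ?thesis
      using eq unfolding form data sum piece_\<phi>[OF M1]
      using L2.add_left[OF load(1)[of m] u0 vL] by (simp add: nodal_def)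
  next
    case False
    then show ?thesis
      using eq unfolding form data sum piece_\<phi>[OF M1] by (simp add: zero)
  qed
qed

end

section \<open>Maximal regularity\<close>

context coefficients
begin

definition dini :: real where
  "dini = (LINT s:{0<..<T}|lebesgue. \<omega> s / s powr (3 / 2))"

lemma dini_integrable: "set_integrable lebesgue {0<..<T} (\<lambda>s. \<omega> s / s powr (3 / 2))"
proof -
  have "integrable (lebesgue_on {0<..<T}) (\<lambda>s. \<omega> s / s powr (3 / 2))"
    using modulus by (simp add: admissible_modulus_def powr_minus_divide)
  then show ?thesis by (simp add: set_integrable_def integrable_restrict_space)
qed

lemma dini_nonneg: "0 \<le> dini"
  unfolding dini_def set_lebesgue_integral_def
  by (intro Bochner_Integration.integral_nonneg) (auto simp: indicator_def intro!: divide_nonneg_nonneg \<omega>_nonneg)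

end

context dG0_problem
begin

definition source :: "nat \<Rightarrow> real^'d \<Rightarrow> real" where
  "source m = load m + (if m = 1 then u0 else 0)"

text \<open>
  Solving the scheme for \<open>A\<^sub>m u\<^sub>m\<close> produces its \<open>L2\<close> representative.
\<close>

definition Au :: "nat \<Rightarrow> real^'d \<Rightarrow> real" where
  "Au m = (1 / step \<tau> m) *\<^sub>R (source m + nodal (m - 1) - nodal m)"

lemma nodal_L2: "m \<le> M \<Longrightarrow> nodal m \<in> L2 \<Omega>"
  using piece_H10[of m] H10_H1 H1_L2 by (auto simp: nodal_def)

lemma nodal_prev_L2: "m \<in> {1..M} \<Longrightarrow> nodal (m - 1) \<in> L2 \<Omega>"
  by (rule nodal_L2) auto

lemma M_pos: "1 \<le> M"
  using \<tau>_0 \<tau>_M T by (cases "M = 0") auto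

lemma source_L2: "source m \<in> L2 \<Omega>"
  using load(1) u0 by (simp add: source_def)

lemma Au_L2: "m \<in> {1..M} \<Longrightarrow> Au m \<in> L2 \<Omega>"
  using nodal_L2[of m] nodal_prev_L2[of m] source_L2[of m] by (auto simp: Au_def)

lemma mesh_step_pos: "m \<in> {1..M} \<Longrightarrow> 0 < step \<tau> m"
  using interval_bounds(2) by (simp add: step_def)

lemma Au_weak:
  assumes m: "m \<in> {1..M}" and v: "v \<in> H10 \<Omega>"
  shows "L2_inner \<Omega> (Au m) v = avg_form (\<tau> (m - 1)) (\<tau> m) (nodal m) v"
proof -
  have vL: "v \<in> L2 \<Omega>" using v H10_H1 H1_L2 by blast
  have "L2_inner \<Omega> (source m + nodal (m - 1) - nodal m) v = step \<tau> m * avg_form (\<tau> (m - 1)) (\<tau> m) (nodal m) v"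
    using step_equation[OF m v, folded source_def] nodal_L2[of m] nodal_prev_L2[OF m] source_L2[of m] m vL
    by (simp add: L2.bilinear)
  then show ?thesis
    using mesh_step_pos[OF m] nodal_L2[of m] nodal_prev_L2[OF m] source_L2[of m] m vL
    by (simp add: Au_def L2.scale_left)
qed

text \<open>
  The abstract scheme applies with \<open>\<rho>\<close> given by the modulus of continuity; \<open>k\<close> is a lower bound for the
  steps. Each jump is the difference of the load and \<open>k\<^sub>m A\<^sub>m u\<^sub>m\<close>, whence the factor 2 and the summand 1.
\<close>

theorem dG0_maximal_regularity:
  assumes \<kappa>: "\<kappa> > 0"
    and up: "\<And>m. \<lbrakk>1 \<le> m; m < M\<rbrakk> \<Longrightarrow> step \<tau> (Suc m) \<le> \<kappa> * step \<tau> m"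
    and down: "\<And>m. \<lbrakk>1 \<le> m; m < M\<rbrakk> \<Longrightarrow> step \<tau> m \<le> \<kappa> * step \<tau> (Suc m)"
    and kmin: "0 < k" "\<And>m. m \<in> {1..M} \<Longrightarrow> k \<le> step \<tau> m"
  shows "\<forall>m\<in>{1..M}. L2_represents \<Omega> (op_A_avg \<Omega> a \<tau> m (piece \<tau> u m)) (Au m)"
    and "(\<Sum>m=1..M. step \<tau> m * L2_norm \<Omega> (Au m) + L2_norm \<Omega> (jump \<tau> u0 u (m - 1)))
      \<le> (2 * (1 + ln (T / k) + sqrt (3 + \<kappa>) * (real CARD('d) / \<alpha> * dini) * sqrt T) + 1) *
        (bochner_Lp_norm 1 {0<..<T} (L2_norm \<Omega>) f + L2_norm \<Omega> u0)"
proof -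
  show "\<forall>m\<in>{1..M}. L2_represents \<Omega> (op_A_avg \<Omega> a \<tau> m (piece \<tau> u m)) (Au m)"
    using Au_L2 Au_weak by (auto simp: L2_represents_def op_A_avg_eq nodal_def)
  define C where "C = real CARD('d) / \<alpha>"
  have C: "0 < C" using \<alpha> by (simp add: C_def)
  define \<rho> where "\<rho> i m = C * \<omega> (\<tau> m - \<tau> (i - 1))" for i m
  have span: "\<tau> m - \<tau> (i - 1) \<in> {0<..T}" if "1 \<le> i" "i \<le> m" "m \<le> M" for i m
  proof -
    have "i - 1 \<le> M" using that by simp
    then show ?thesis
      using node_mono[of 0 "i - 1"] node_mono[of i m] node_mono[of m M] \<tau>_step[of i] \<tau>_0 \<tau>_M that by auto
  qed
  interpret discrete_parabolic "L2 \<Omega>" "L2_inner \<Omega>" "H10 \<Omega>" "\<lambda>m. avg_form (\<tau> (m - 1)) (\<tau> m)" \<tau> M \<kappa> nodal source Au \<rho>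
  proof (intro discrete_parabolic.intro discrete_parabolic_axioms.intro gelfand_axioms)
    fix m assume m: "1 \<le> m" "m \<le> M"
    then have m': "m \<in> {1..M}" by simp
    note b = interval_bounds[OF m']
    show "semi_inner (H10 \<Omega>) (avg_form (\<tau> (m - 1)) (\<tau> m))" by (rule avg_form_semi_inner[OF b])
    show "resolvable (avg_form (\<tau> (m - 1)) (\<tau> m))" by (rule avg_form_resolvable[OF b])
    show "0 < step \<tau> m" by (rule mesh_step_pos[OF m'])
    show "nodal m \<in> H10 \<Omega>" using piece_H10[OF m'] m by (simp add: nodal_def)
    show "source m \<in> L2 \<Omega>" by (rule source_L2)
    show "step \<tau> m *\<^sub>R Au m = source m + nodal (m - 1) - nodal m" using mesh_step_pos[OF m'] by (simp add: Au_def)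
    show "Au m \<in> L2 \<Omega>" by (rule Au_L2[OF m'])
    show "L2_inner \<Omega> (Au m) v = avg_form (\<tau> (m - 1)) (\<tau> m) (nodal m) v" if "v \<in> H10 \<Omega>" for v
      by (rule Au_weak[OF m' that])
  next
    fix i m assume im: "1 \<le> i" "i < m" "m \<le> M"
    then have im': "i \<in> {1..M}" "m \<in> {1..M}" "\<tau> i \<le> \<tau> (m - 1)" using node_mono[of i "m - 1"] by auto
    note bi = interval_bounds[OF im'(1)] and bm = interval_bounds[OF im'(2)]
    show "0 \<le> \<rho> i m" using span[of i m] im C \<omega>_nonneg by (simp add: \<rho>_def)
    fix x v assume x: "x \<in> H10 \<Omega>" and v: "v \<in> H10 \<Omega>"
    note x' = H10_H1[OF x] and v' = H10_H1[OF v]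
    have "\<bar>avg_form (\<tau> (m - 1)) (\<tau> m) x v - avg_form (\<tau> (i - 1)) (\<tau> i) x v\<bar>
        \<le> \<omega> (\<tau> m - \<tau> (i - 1)) * (grad_sum x * grad_sum v)"
      using bi bm im'(3) by (intro avg_form_diff x' v') auto
    also have "\<dots> \<le> \<omega> (\<tau> m - \<tau> (i - 1)) *
        ((sqrt C * sqrt (avg_form (\<tau> (i - 1)) (\<tau> i) x x)) * (sqrt C * sqrt (avg_form (\<tau> (m - 1)) (\<tau> m) v v)))"
      unfolding C_def
      using grad_sum_le_avg_form[OF bi x'] grad_sum_le_avg_form[OF bm v'] span[of i m] im
      by (intro mult_left_mono mult_mono \<omega>_nonneg) (auto intro: order_trans[OF grad_sum_nonneg])
    also have "\<dots> = \<rho> i m * sqrt (avg_form (\<tau> (i - 1)) (\<tau> i) x x) * sqrt (avg_form (\<tau> (m - 1)) (\<tau> m) v v)"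
    proof -
      have "sqrt C * sqrt C = C" using C by simp
      moreover have "w * ((s * p) * (s * q)) = (s * s) * w * p * q" for w s p q :: real
        by (simp only: mult_ac)
      ultimately show ?thesis by (simp only: \<rho>_def)
    qed
    finally show "\<bar>avg_form (\<tau> (m - 1)) (\<tau> m) x v - avg_form (\<tau> (i - 1)) (\<tau> i) x v\<bar>
        \<le> \<rho> i m * sqrt (avg_form (\<tau> (i - 1)) (\<tau> i) x x) * sqrt (avg_form (\<tau> (m - 1)) (\<tau> m) v v)" .
  qed (simp_all add: \<kappa> up down nodal_def)
  define N where "N = bochner_Lp_norm 1 {0<..<T} (L2_norm \<Omega>) f + L2_norm \<Omega> u0"
  define \<Lambda> where "\<Lambda> = 1 + ln (T / k)"
  define K where "K = sqrt (3 + \<kappa>) * (C * dini) * sqrt T"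
  note M1 = M_pos
  have k_le_T: "k \<le> T"
    using kmin(2)[of 1] interval_bounds[of 1] M1 by (simp add: step_def)
  have log: "(\<Sum>m=i..M. step \<tau> m / (\<tau> m - \<tau> (i - 1))) \<le> \<Lambda>" if i: "1 \<le> i" "i \<le> M" for i
  proof -
    have i': "i \<in> {1..M}" using i by simp
    have "(\<tau> M - \<tau> (i - 1)) / step \<tau> i \<le> T / k"
      using span[of i M] i kmin(2)[OF i'] kmin(1) T by (intro frac_le) auto
    moreover have "0 < (\<tau> M - \<tau> (i - 1)) / step \<tau> i"
      using span[of i M] i mesh_step_pos[OF i'] by simp
    ultimately have "ln ((\<tau> M - \<tau> (i - 1)) / step \<tau> i) \<le> ln (T / k)" by (intro ln_mono)
    then show ?thesis
      using step_ratio_sum_le_ln[of M \<tau> i, OF \<tau>_step i] by (simp add: \<Lambda>_def)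
  qed
  have dini_sum: "(\<Sum>m=Suc i..M. step \<tau> m * (\<rho> i m / (\<tau> m - \<tau> (i - 1)) powr (3 / 2))) \<le> C * dini"
    if i: "1 \<le> i" "i \<le> M" for i
  proof -
    define \<sigma> where "\<sigma> m = \<tau> m - \<tau> (i - 1)" for m
    have "(\<Sum>m=Suc i..M. (\<sigma> m - \<sigma> (m - 1)) * (\<omega> (\<sigma> m) / \<sigma> m powr (3 / 2))) \<le> dini"
      unfolding dini_def
    proof (rule right_sums_le_integral)
      show "antimono_on {0<..T} (\<lambda>s. \<omega> s / s powr (3 / 2))"
        using modulus by (simp add: admissible_modulus_def)
    qed (use i span[of i i] span[of i M] \<tau>_step \<omega>_nonneg dini_integrable in \<open>auto simp: \<sigma>_def\<close>)
    then have "C * (\<Sum>m=Suc i..M. (\<sigma> m - \<sigma> (m - 1)) * (\<omega> (\<sigma> m) / \<sigma> m powr (3 / 2))) \<le> C * dini"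
      using C by (intro mult_left_mono) auto
    then show ?thesis
      by (simp add: sum_distrib_left \<rho>_def \<sigma>_def step_def mult_ac)
  qed
  have load_sum: "(\<Sum>m=1..M. L2_norm \<Omega> (load m)) \<le> N"
    using sum_load_le L2_norm_nonneg[of u0] unfolding N_def by linarith
  have source_sum: "(\<Sum>m=1..M. L2_norm \<Omega> (source m)) \<le> N"
  proof -
    have "L2_norm \<Omega> (source m) \<le> L2_norm \<Omega> (load m) + (if m = 1 then L2_norm \<Omega> u0 else 0)" for m
      using L2.nrm_add_le[OF load(1)[of m] u0] by (cases "m = 1") (simp_all add: source_def L2_norm_eq)
    then have "(\<Sum>m=1..M. L2_norm \<Omega> (source m))
        \<le> (\<Sum>m=1..M. L2_norm \<Omega> (load m) + (if m = 1 then L2_norm \<Omega> u0 else 0))"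
      by (intro sum_mono)
    also have "\<dots> = (\<Sum>m=1..M. L2_norm \<Omega> (load m)) + L2_norm \<Omega> u0"
      using M1 by (simp add: sum.distrib)
    also have "\<dots> \<le> N" using sum_load_le by (simp add: N_def)
    finally show ?thesis .
  qed
  have "(\<Sum>m=1..M. step \<tau> m * L2.nrm \<Omega> (Au m))
      \<le> (\<Lambda> + sqrt (3 + \<kappa>) * (C * dini) * sqrt (\<tau> M - \<tau> 0)) * (\<Sum>i=1..M. L2.nrm \<Omega> (source i))"
    by (rule summed_smoothing[OF log dini_sum]) (use C dini_nonneg in auto)
  also have "\<dots> \<le> (\<Lambda> + K) * N"
  proof -
    have "0 \<le> \<Lambda> + K"
      using kmin(1) k_le_T T \<kappa> C dini_nonneg by (simp add: \<Lambda>_def K_def)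
    then show ?thesis
      using source_sum by (simp add: K_def \<tau>_0 \<tau>_M L2_norm_eq mult_left_mono)
  qed
  finally have A: "(\<Sum>m=1..M. step \<tau> m * L2_norm \<Omega> (Au m)) \<le> (\<Lambda> + K) * N" by (simp add: L2_norm_eq)
  have jump: "L2_norm \<Omega> (jump \<tau> u0 u (m - 1)) \<le> L2_norm \<Omega> (load m) + step \<tau> m * L2_norm \<Omega> (Au m)"
    if m: "m \<in> {1..M}" for m
  proof -
    have "jump \<tau> u0 u (m - 1) = load m - step \<tau> m *\<^sub>R Au m"
      using mesh_step_pos[OF m] m by (cases "m = 1") (auto simp: Au_def source_def nodal_def jump_def fun_eq_iff)
    then show ?thesis
      using L2.nrm_diff_le[OF load(1)[of m] L2.mem(3)[OF Au_L2[OF m], of "step \<tau> m"]]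
        L2.nrm_scale[OF Au_L2[OF m], of "step \<tau> m"] mesh_step_pos[OF m]
      by (simp add: L2_norm_eq)
  qed
  have "(\<Sum>m=1..M. step \<tau> m * L2_norm \<Omega> (Au m) + L2_norm \<Omega> (jump \<tau> u0 u (m - 1)))
      \<le> (\<Sum>m=1..M. step \<tau> m * L2_norm \<Omega> (Au m) + (L2_norm \<Omega> (load m) + step \<tau> m * L2_norm \<Omega> (Au m)))"
    by (intro sum_mono add_left_mono jump)
  also have "\<dots> = 2 * (\<Sum>m=1..M. step \<tau> m * L2_norm \<Omega> (Au m)) + (\<Sum>m=1..M. L2_norm \<Omega> (load m))"
    by (simp add: sum.distrib sum_distrib_left)
  also have "\<dots> \<le> 2 * ((\<Lambda> + K) * N) + N"
    using A load_sum by simp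
  finally show "(\<Sum>m=1..M. step \<tau> m * L2_norm \<Omega> (Au m) + L2_norm \<Omega> (jump \<tau> u0 u (m - 1)))
      \<le> (2 * (1 + ln (T / k) + sqrt (3 + \<kappa>) * (real CARD('d) / \<alpha> * dini) * sqrt T) + 1) *
        (bochner_Lp_norm 1 {0<..<T} (L2_norm \<Omega>) f + L2_norm \<Omega> u0)"
    by (simp add: \<Lambda>_def K_def C_def N_def algebra_simps)
qed

end

text \<open>
  For the lower bound \<open>c * k powr \<beta>\<close> of the minimal step, \<open>ln (T / (c * k powr \<beta>))\<close> equals \<open>\<beta> * ln (T / k)\<close> plus
  a constant. As \<open>k \<le> T / 4\<close>, the constant is absorbed by \<open>ln (T / k) \<ge> 1\<close>.
\<close>

lemma ln_max_min_step:
  fixes T c \<beta> k :: real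
  assumes T: "T > 0" and c: "c > 0" and \<beta>: "\<beta> > 0" and k: "0 < k" "k \<le> T / 4"
  shows "1 \<le> ln (T / k)"
    and "1 + ln (T / (c * k powr \<beta>)) \<le> (1 + \<bar>ln T\<bar> + \<bar>ln c\<bar> + \<beta> * \<bar>ln T\<bar> + \<beta>) * ln (T / k)"
proof -
  have "4 \<le> T / k" using k by (simp add: field_simps)
  then have "exp 1 \<le> T / k" using exp_le by linarith
  then have "ln (exp 1) \<le> ln (T / k)" by (intro ln_mono) auto
  then show L: "1 \<le> ln (T / k)" by simp
  define L where "L = ln (T / k)"
  have lk: "ln k = ln T - L" using T k by (simp add: L_def ln_div)
  have "ln (T / (c * k powr \<beta>)) = ln T - ln c - \<beta> * ln k"
    using T c k by (simp add: ln_div ln_mult ln_powr)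
  then have "1 + ln (T / (c * k powr \<beta>)) = 1 + ln T - ln c - \<beta> * ln T + \<beta> * L"
    by (simp add: lk right_diff_distrib)
  also have "\<dots> \<le> (1 + \<bar>ln T\<bar> + \<bar>ln c\<bar> + \<beta> * \<bar>ln T\<bar>) + \<beta> * L"
  proof -
    have "\<beta> * (- ln T) \<le> \<beta> * \<bar>ln T\<bar>" using \<beta> by (intro mult_left_mono) auto
    then show ?thesis using abs_ge_self[of "ln T"] abs_ge_minus_self[of "ln c"] by simp
  qed
  also have "\<dots> \<le> (1 + \<bar>ln T\<bar> + \<bar>ln c\<bar> + \<beta> * \<bar>ln T\<bar>) * L + \<beta> * L"
    using L \<beta> mult_left_mono[of 1 L "1 + \<bar>ln T\<bar> + \<bar>ln c\<bar> + \<beta> * \<bar>ln T\<bar>"] by (simp add: L_def)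
  finally show "1 + ln (T / (c * k powr \<beta>)) \<le> (1 + \<bar>ln T\<bar> + \<bar>ln c\<bar> + \<beta> * \<bar>ln T\<bar> + \<beta>) * ln (T / k)"
    by (simp add: L_def distrib_right)
qed

theorem theorem3p13:
  fixes \<Omega> :: "(real^'d) set"
    and T \<alpha> c \<beta> \<kappa> :: real
    and \<omega> :: "real \<Rightarrow> real"
    and a :: "real \<Rightarrow> real^'d \<Rightarrow> real^'d^'d"
  assumes "bounded_lipschitz_domain \<Omega>"
    and "T > 0" and "\<alpha> > 0" and "c > 0" and "\<beta> > 0" and "\<kappa> > 0"
    and "admissible_modulus T \<omega>"
    and "admissible_coefficients \<Omega> T \<alpha> \<omega> a"
  shows "\<exists>\<mu>>0. \<exists>\<delta>0>0. \<exists>C>0. \<forall>M \<tau>.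
    time_mesh T c \<beta> \<kappa> M \<tau> \<and> max_step M \<tau> - min_step M \<tau> \<le> \<delta>0 \<longrightarrow>
    (\<forall>f u0 u. f \<in> bochner_Lp 1 {0<..<T} (L2 \<Omega>) (L2_norm \<Omega>) \<and> u0 \<in> L2 \<Omega> \<and>
       dG0_solution \<Omega> T a M \<tau> f u0 u \<longrightarrow>
       (\<exists>w. (\<forall>m\<in>{1..M}. L2_represents \<Omega> (op_A_avg \<Omega> a \<tau> m (piece \<tau> u m)) (w m)) \<and>
          (\<Sum>m=1..M. step \<tau> m * L2_norm \<Omega> (w m) + L2_norm \<Omega> (jump \<tau> u0 u (m - 1)))
          \<le> C * exp (\<mu> * T) * ln (T / max_step M \<tau>) *
             (bochner_Lp_norm 1 {0<..<T} (L2_norm \<Omega>) f + L2_norm \<Omega> u0)))"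
proof -
  interpret coefficients \<Omega> T \<alpha> \<omega> a
    using assms by unfold_locales (auto simp: bounded_lipschitz_domain_def)
  define K where "K = sqrt (3 + \<kappa>) * (real CARD('d) / \<alpha> * dini) * sqrt T"
  define B' where "B' = 1 + \<bar>ln T\<bar> + \<bar>ln c\<bar> + \<beta> * \<bar>ln T\<bar> + \<beta>"
  define C where "C = 2 * (B' + K) + 1"
  have K: "0 \<le> K" using dini_nonneg assms by (simp add: K_def)
  have B': "0 \<le> B'" using assms by (simp add: B'_def)
  have C: "0 < C" using K B' by (simp add: C_def)
  have bound: "\<exists>w. (\<forall>m\<in>{1..M}. L2_represents \<Omega> (op_A_avg \<Omega> a \<tau> m (piece \<tau> u m)) (w m)) \<and>
          (\<Sum>m=1..M. step \<tau> m * L2_norm \<Omega> (w m) + L2_norm \<Omega> (jump \<tau> u0 u (m - 1)))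
          \<le> C * exp (1 * T) * ln (T / max_step M \<tau>) *
             (bochner_Lp_norm 1 {0<..<T} (L2_norm \<Omega>) f + L2_norm \<Omega> u0)"
    if mesh: "time_mesh T c \<beta> \<kappa> M \<tau>" and f: "f \<in> bochner_Lp 1 {0<..<T} (L2 \<Omega>) (L2_norm \<Omega>)"
      and u0: "u0 \<in> L2 \<Omega>" and sol: "dG0_solution \<Omega> T a M \<tau> f u0 u" for M \<tau> f u0 u
  proof -
    interpret dG0_problem \<Omega> T \<alpha> \<omega> a M \<tau> f u0 u
      using mesh f u0 sol by unfold_locales (auto simp: time_mesh_def)
    note M1 = M_pos
    have steps: "0 < step \<tau> m \<and> min_step M \<tau> \<le> step \<tau> m \<and> step \<tau> m \<le> max_step M \<tau>" if "m \<in> {1..M}" for m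
      using mesh_step_pos[OF that] that by (auto simp: min_step_def max_step_def)
    define k where "k = max_step M \<tau>"
    have k: "0 < k" using steps[of 1] M1 by (simp add: k_def)
    have k4: "k \<le> T / 4" and kc: "c * k powr \<beta> \<le> min_step M \<tau>"
      using mesh by (auto simp: time_mesh_def k_def)
    have ratio: "1 / \<kappa> \<le> step \<tau> m / step \<tau> (Suc m)" "step \<tau> m / step \<tau> (Suc m) \<le> \<kappa>"
      if "1 \<le> m" "m < M" for m
      using mesh that by (auto simp: time_mesh_def)
    have up: "step \<tau> (Suc m) \<le> \<kappa> * step \<tau> m" and down: "step \<tau> m \<le> \<kappa> * step \<tau> (Suc m)"
      if "1 \<le> m" "m < M" for m
      using ratio[OF that] steps[of "Suc m"] that assms by (simp_all add: field_simps)
    have kmin: "0 < c * k powr \<beta>" "\<And>m. m \<in> {1..M} \<Longrightarrow> c * k powr \<beta> \<le> step \<tau> m"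
      using k assms(4) kc steps order_trans by auto
    note bounds = dG0_maximal_regularity[OF assms(6) up down kmin]
    note logs = ln_max_min_step[OF assms(2,4,5) k k4]
    define N where "N = bochner_Lp_norm 1 {0<..<T} (L2_norm \<Omega>) f + L2_norm \<Omega> u0"
    have N: "0 \<le> N" by (simp add: N_def bochner_Lp_norm_def)
    define L where "L = ln (T / k)"
    have L: "1 \<le> L" using logs(1) by (simp add: L_def)
    have "(\<Sum>m=1..M. step \<tau> m * L2_norm \<Omega> (Au m) + L2_norm \<Omega> (jump \<tau> u0 u (m - 1)))
        \<le> (2 * (1 + ln (T / (c * k powr \<beta>)) + K) + 1) * N"
      using bounds(2) by (simp add: K_def N_def)
    also have "\<dots> \<le> (2 * (B' * L + K * L) + L) * N"
    proof (intro mult_right_mono N)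
      have "1 + ln (T / (c * k powr \<beta>)) \<le> B' * L" using logs(2) by (simp add: B'_def L_def)
      moreover have "K * 1 \<le> K * L" using K L by (intro mult_left_mono)
      ultimately show "2 * (1 + ln (T / (c * k powr \<beta>)) + K) + 1 \<le> 2 * (B' * L + K * L) + L"
        using L by simp
    qed
    also have "\<dots> = 1 * (C * L * N)" by (simp add: C_def algebra_simps)
    \<comment> \<open>The exponential factor enters through \<open>exp T \<ge> 1\<close>, with \<open>\<mu> = 1\<close>.\<close>
    also have "\<dots> \<le> exp (1 * T) * (C * L * N)"
      using C L N T by (intro mult_right_mono) auto
    also have "\<dots> = C * exp (1 * T) * L * N" by simp
    finally show ?thesis
      using bounds(1) by (intro exI[of _ Au]) (simp add: L_def N_def k_def)
  qed
  show ?thesis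
    by (rule exI[of _ 1], rule conjI, simp, rule exI[of _ 1], rule conjI, simp, rule exI[of _ C])
      (use C bound in blast)
qed

end
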